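(* Fix an ordinal $\xi$ and a Banach space $X$. (i) If $X\in P^\vee_1(\xi,\infty)$, then the dual of $X$ and any predual of $X$ lie in $P^\vee_1(\xi,1)$. (ii) Fix $i\in\{2,3\}$. Suppose $E$ is an FDD for $X$ such that $(E,X)\in P^\vee_i(\xi,\infty)$. Then $(E^*,[E^*])\in P^\vee_i(\xi,1)$. If $Y$ is a Banach space with FDD $F$ so that $F^*=E$ and $[F^*]=X$, then $(F,Y)\in P^\vee_i(\xi,1)$. (iii) If $X\in P^\vee_4(\xi,\infty)$, then the dual of $X$ and any predual of $X$ lie in $P^\vee_4(\xi,1)$.
   Context: Trees: a tree is a set of finite sequences (including $\varnothing$) closed under initial segments. $T'$ is $T$ with its maximal members removed, $d^0(T)=T$, $d^{\xi+1}(T)=(d^\xi(T))'$, $d^\xi(T)=\bigcap_{\zeta<\xi}d^\zeta(T)$ for limit $\xi$, $o(T)=\min\{\xi:d^\xi(T)=\varnothing\}$, with $o(T)=\infty$ if no such ordinal exists; $\xi<\infty$ for all ordinals $\xi$. An FDD for $X$ is a sequence $E=(E_n)$ of finite dimensional subspaces so that each $x\in X$ is uniquely $x=\sum x_n$ with $x_n\in E_n$; $P^E_nx=x_n$, $\mathrm{supp}_E(x)=\{n:P^E_nx\neq0\}$. $E_n^*$ is regarded as a subspace of $X^*$ via $(P^E_n)^*$; $E^*=(E_n^* )$, and $[E^*]=[E_n^*:n\in\mathbb{N}]$ is the closed span, for which $E^*$ is an FDD. $\Sigma(E,X)$ is the set of finite block sequences: finite sequences of non-zero, finitely supported vectors with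 $\max\mathrm{supp}_E(x_i)<\min\mathrm{supp}_E(x_{i+1})$. $T_p(X,K)$ is the tree of all finite sequences $(x_i)_{i=1}^n$ in the unit ball $B_X$ with $K^{-1}\leqslant\|\sum_{i=1}^na_ix_i\|\leqslant1$ for all $(a_i)_{i=1}^n$ in the unit sphere of $\ell_p^n$; $T_p(X,E,K)=T_p(X,K)\cap\Sigma(E,X)$. For a tree $T$ of sequences in $X$, $d_E(T)$ is the set of $(x_i)_{i=1}^n\in T$ for which there exist $(y_i)_{i\in\mathbb{N}}$ with $i\leqslant\min\mathrm{supp}_E(y_i)$ and $(x_1,\ldots,x_n,y_i)\in T$ for all $i$; $d^\xi_E$ is its transfinite iteration (intersections at limits), $o_E(T)=\min\{\xi:d^\xi_E(T)=\varnothing\}$ (or $\infty$). $I_p(X,K)=o(T_p(X,K))$, $I_p(X,E,K)=o(T_p(X,E,K))$, $I^a_p(X,E,K)=o_E(T_p(X,E,K))$. Schreier families: for families $\mathcal{F},\mathcal{G}$ of finite subsets of $\mathbb{N}$, $\mathcal{F}[\mathcal{G}]$ consists of $\varnothing$ and all unions $\bigcup_{i=1}^sE_i$ with non-empty $E_i\in\mathcal{G}$, $\max E_i<\min E_{i+1}$, $\{\min E_i\}_{i=1}^s\in\mathcal{F}$. $\mathcal{S}_0=\{E:|E|\leqslant1\}$, $\mathcal{S}=\mathcal{S}_1=\{\varnothing\}\cup\{E:|E|\leqslant\min E\}$, $\mathcal{S}_{\xi+1}=\mathcal{S}[\mathcal{S}_\xi]$; for limit $\xi<\omega_1$, $\mathcal{S}_\xi=\{E:\exists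 n\leqslant\min E,\ E\in\mathcal{S}_{\xi_n+1}\}$ for a fixed sequence $\xi_n\uparrow\xi$ with $\mathcal{S}_{\xi_n+1}\subset\mathcal{S}_{\xi_{n+1}}$; $\mathcal{S}_{\omega_1}$ is the family of all finite subsets of $\mathbb{N}$. An infinite sequence $(x_n)\subset X$ is a $K$-$\ell_p^\xi$ spreading model ($K$-$c_0^\xi$ spreading model if $p=\infty$) if $(x_n)_{n\in E}\in T_p(X,K)$ for each $E\in\mathcal{S}_\xi$. $\mathcal{SM}_p(X,K)=\min\{\xi\leqslant\omega_1:X\text{ admits no }K\text{-}\ell_p^\xi\text{ spreading model}\}$ (with $c_0$ in place of $\ell_p$ when $p=\infty$), $=\infty$ if there is no such $\xi$. Classes: $P^\vee_1(\xi,p)$ is the class of Banach spaces $X$ with $I_p(X,K)>\omega^\xi$ for some $K>1$; $P^\vee_2(\xi,p)$ (resp. $P^\vee_3(\xi,p)$) is the class of pairs $(E,X)$, $E$ an FDD for the (separable) Banach space $X$, with $I_p(X,E,K)>\omega^\xi$ (resp. $I^a_p(X,E,K)>\omega^\xi$) for some $K>1$; $P^\vee_4(\xi,p)$ is the class of Banach spaces $X$ with $\mathcal{SM}_p(X,K)>\xi$ for some $K>1$. A predual of $X$ is a Banach space $Y$ with $Y^*=X$. *)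

theory Defs
  imports
    "HOL-Analysis.Analysis"
    "HOL-Library.Extended"
    "HOL-Library.Sublist"
begin

no_notation Extended.Pinf (\<open>\<infinity>\<close>)
no_notation Extended.Minf (\<open>-\<infinity>\<close>)

section \<open>Ordinals\<close>

text \<open>
  HOL has no type of all ordinals.  The type \<open>'o ordinal\<close> consists of all ordinals below the
  successor cardinal of \<open>nat set + 'o\<close>.  Every well-order on a subset of \<open>'o\<close> is isomorphic to a
  proper initial segment of it, so leaving \<open>'o\<close> arbitrary amounts to quantifying over all ordinals.
  The summand \<open>nat set\<close> makes sure that \<open>\<omega>\<^sub>1\<close> is always present; since a successor cardinal is
  regular, the type is closed under successors, suprema of small sets and ordinal arithmetic.
\<close>

typedef 'o ordinal = "Field (cardSuc (card_of (UNIV :: (nat set + 'o) set)))"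
  using Field_cardSuc_not_empty card_of_Card_order by blast

instantiation ordinal :: (type) wellorder
begin

definition less_eq_ordinal :: "'a ordinal \<Rightarrow> 'a ordinal \<Rightarrow> bool" where
  "(\<alpha> :: 'a ordinal) \<le> \<beta> \<longleftrightarrow> (Rep_ordinal \<alpha>, Rep_ordinal \<beta>) \<in> cardSuc (card_of (UNIV :: (nat set + 'a) set))"

definition less_ordinal :: "'a ordinal \<Rightarrow> 'a ordinal \<Rightarrow> bool" where
  "(\<alpha> :: 'a ordinal) < \<beta> \<longleftrightarrow> \<alpha> \<le> \<beta> \<and> \<alpha> \<noteq> \<beta>"

instance
proof -
  let ?r = "cardSuc (card_of (UNIV :: (nat set + 'a) set))"
  have wo: "Well_order ?r"
    by (rule cardSuc_Well_order[OF card_of_Card_order])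
  have lin: "Linear_order ?r" and wf: "wf (?r - Id)"
    using wo by (auto simp: well_order_on_def)
  have refl: "\<And>x. x \<in> Field ?r \<Longrightarrow> (x, x) \<in> ?r" and tr: "trans ?r" and anti: "antisym ?r"
    and tot: "\<And>x y. x \<in> Field ?r \<Longrightarrow> y \<in> Field ?r \<Longrightarrow> x \<noteq> y \<Longrightarrow> (x, y) \<in> ?r \<or> (y, x) \<in> ?r"
    using lin by (auto simp: linear_order_on_def partial_order_on_def preorder_on_def
        refl_on_def total_on_def)
  show "OFCLASS('a ordinal, wellorder_class)"
  proof (intro_classes)
    fix x y z :: "'a ordinal"
    show "(x < y) = (x \<le> y \<and> \<not> y \<le> x)"
      unfolding less_ordinal_def less_eq_ordinal_def
      using antisymD[OF anti] refl[OF Rep_ordinal] Rep_ordinal_inject by metis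
    show "x \<le> x" by (simp add: less_eq_ordinal_def refl Rep_ordinal)
    show "x \<le> y \<Longrightarrow> y \<le> z \<Longrightarrow> x \<le> z"
      using tr unfolding less_eq_ordinal_def trans_def by blast
    show "x \<le> y \<Longrightarrow> y \<le> x \<Longrightarrow> x = y"
      using anti unfolding less_eq_ordinal_def antisym_def by (metis Rep_ordinal_inject)
    show "x \<le> y \<or> y \<le> x"
      using tot[OF Rep_ordinal Rep_ordinal] refl[OF Rep_ordinal]
      unfolding less_eq_ordinal_def by metis
  next
    fix P :: "'a ordinal \<Rightarrow> bool" and a
    assume step: "\<And>x. (\<And>y. y < x \<Longrightarrow> P y) \<Longrightarrow> P x"
    have "{(x, y :: 'a ordinal). x < y} \<subseteq> inv_image (?r - Id) Rep_ordinal"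
      by (auto simp: less_ordinal_def less_eq_ordinal_def inv_image_def Rep_ordinal_inject)
    then have "wf {(x, y :: 'a ordinal). x < y}"
      using wf_subset[OF wf_inv_image[OF wf]] by blast
    then show "P a"
      using step by (induction a rule: wf_induct_rule) auto
  qed
qed

end

definition ozero :: "'o ordinal" where
  "ozero = (LEAST \<alpha>. True)"

definition osucc :: "'o ordinal \<Rightarrow> 'o ordinal" where
  "osucc \<alpha> = (LEAST \<beta>. \<alpha> < \<beta>)"

definition olimit :: "'o ordinal \<Rightarrow> bool" where
  "olimit \<xi> \<longleftrightarrow> \<xi> \<noteq> ozero \<and> (\<nexists>\<zeta>. \<xi> = osucc \<zeta>)"

definition osup :: "'o ordinal set \<Rightarrow> 'o ordinal" where
  "osup A = (LEAST \<beta>. \<forall>\<alpha>\<in>A. \<alpha> \<le> \<beta>)"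

lemma ordinal_less_osucc: "\<alpha> < osucc (\<alpha> :: 'o ordinal)"
proof -
  let ?r = "cardSuc (card_of (UNIV :: (nat set + 'o) set))"
  have "infinite (Field ?r)"
    by (simp add: card_of_cardSuc_finite Finite_Set.finite_set)
  then obtain b where "b \<in> Field ?r" "Rep_ordinal \<alpha> \<noteq> b" "(Rep_ordinal \<alpha>, b) \<in> ?r"
    using infinite_Card_order_limit[OF cardSuc_Card_order[OF card_of_Card_order]]
      Rep_ordinal by blast
  then have "\<alpha> < Abs_ordinal b"
    by (auto simp: less_ordinal_def less_eq_ordinal_def Abs_ordinal_inverse)
  then show ?thesis
    unfolding osucc_def by (rule LeastI)
qed

lemma osucc_le_iff: "osucc \<alpha> \<le> \<beta> \<longleftrightarrow> \<alpha> < \<beta>"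
  by (metis Least_le order_less_le_trans ordinal_less_osucc osucc_def)

lemma osucc_inject [simp]: "osucc \<alpha> = osucc \<beta> \<longleftrightarrow> \<alpha> = \<beta>"
  by (metis linorder_neq_iff not_le order.refl osucc_le_iff ordinal_less_osucc)

lemma ozero_le [simp]: "ozero \<le> \<alpha>"
  by (simp add: ozero_def Least_le)

lemma osucc_neq_ozero [simp]: "osucc \<alpha> \<noteq> ozero"
  by (metis not_le ordinal_less_osucc ozero_le)

lemma ordinal_small_bounded:
  fixes A :: "'o ordinal set"
  assumes "(card_of A, card_of (UNIV :: (nat set + 'o) set)) \<in> ordLeq"
  shows "\<exists>\<beta>. \<forall>\<alpha>\<in>A. \<alpha> \<le> \<beta>"
proof -
  let ?c = "card_of (UNIV :: (nat set + 'o) set)"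
  let ?r = "cardSuc ?c"
  let ?As = "\<lambda>i. {x. (x, i) \<in> ?r}"
  have wo: "Well_order ?r"
    by (rule cardSuc_Well_order[OF card_of_Card_order])
  then have tr: "trans ?r" and refl: "\<And>x. x \<in> Field ?r \<Longrightarrow> (x, x) \<in> ?r"
    by (auto simp: well_order_on_def linear_order_on_def partial_order_on_def
        preorder_on_def refl_on_def)
  have "\<exists>i\<in>Field ?r. Rep_ordinal ` A \<subseteq> ?As i"
  proof (rule cardSuc_UNION[OF card_of_Card_order])
    show "infinite (Field ?c)"
      by (simp add: Field_card_of Finite_Set.finite_set)
    show "relChain ?r ?As"
      using tr by (auto simp: relChain_def trans_def)
    show "Rep_ordinal ` A \<subseteq> (\<Union>i\<in>Field ?r. ?As i)"
      using refl Rep_ordinal by blast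
    show "(card_of (Rep_ordinal ` A), ?c) \<in> ordLeq"
      by (rule ordLeq_transitive[OF card_of_image assms])
  qed
  then obtain i where "i \<in> Field ?r" "\<forall>\<alpha>\<in>A. (Rep_ordinal \<alpha>, i) \<in> ?r"
    by auto
  then have "\<forall>\<alpha>\<in>A. \<alpha> \<le> Abs_ordinal i"
    by (auto simp: less_eq_ordinal_def Abs_ordinal_inverse)
  then show ?thesis by blast
qed

lemma osup_upper:
  assumes "(card_of A, card_of (UNIV :: (nat set + 'o) set)) \<in> ordLeq"
    and "\<alpha> \<in> A"
  shows "\<alpha> \<le> osup (A :: 'o ordinal set)"
  using LeastI_ex[OF ordinal_small_bounded[OF assms(1)]] assms(2) by (simp add: osup_def)

text \<open>Transfinite recursion; the third argument receives the set of all earlier values.\<close>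

function orec :: "'b \<Rightarrow> ('b \<Rightarrow> 'b) \<Rightarrow> ('b set \<Rightarrow> 'b) \<Rightarrow> 'o ordinal \<Rightarrow> 'b" where
  "orec z s l \<xi> =
     (if \<xi> = ozero then z
      else if \<exists>\<zeta>. \<xi> = osucc \<zeta> then s (orec z s l (THE \<zeta>. \<xi> = osucc \<zeta>))
      else l (orec z s l ` {..<\<xi>}))"
  by pat_completeness auto
termination
  by (relation "inv_image {(\<alpha>, \<beta>). \<alpha> < \<beta>} (\<lambda>(z, s, l, \<xi>). \<xi>)")
    (auto intro: wf_inv_image wf simp: ordinal_less_osucc)

declare orec.simps [simp del]

lemma orec_zero: "orec z s l ozero = z"
  by (simp add: orec.simps)

lemma orec_succ: "orec z s l (osucc \<zeta>) = s (orec z s l \<zeta>)"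
  by (subst orec.simps) auto

lemma orec_limit: "olimit \<xi> \<Longrightarrow> orec z s l \<xi> = l (orec z s l ` {..<\<xi>})"
  by (subst orec.simps) (auto simp: olimit_def)

definition oadd :: "'o ordinal \<Rightarrow> 'o ordinal \<Rightarrow> 'o ordinal" where
  "oadd \<alpha> = orec \<alpha> osucc osup"

definition omult :: "'o ordinal \<Rightarrow> 'o ordinal \<Rightarrow> 'o ordinal" where
  "omult \<alpha> = orec ozero (\<lambda>\<beta>. oadd \<beta> \<alpha>) osup"

definition opow :: "'o ordinal \<Rightarrow> 'o ordinal \<Rightarrow> 'o ordinal" where
  "opow \<alpha> = orec (osucc ozero) (\<lambda>\<beta>. omult \<beta> \<alpha>) osup"

definition omega :: "'o ordinal" where
  "omega = (LEAST \<xi>. olimit \<xi>)"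

definition omega1 :: "'o ordinal" where
  "omega1 = (LEAST \<xi>. uncountable {..<\<xi>})"


lemma card_of_image_small:
  fixes f :: "nat set \<Rightarrow> 'o ordinal"
  shows "(card_of (f ` A), card_of (UNIV :: (nat set + 'o) set)) \<in> ordLeq"
proof -
  have "(card_of (UNIV :: nat set set), card_of (UNIV :: (nat set + 'o) set)) \<in> ordLeq"
    by (rule card_of_ordLeqI[of Inl]) auto
  moreover have "(card_of (f ` A), card_of (UNIV :: nat set set)) \<in> ordLeq"
    by (meson card_of_image card_of_mono1 ordLeq_transitive subset_UNIV)
  ultimately show ?thesis using ordLeq_transitive by blast
qed

lemma uncountable_below_omega1: "uncountable {..<omega1 :: 'o ordinal}"
proof -
  let ?c = "card_of (UNIV :: (nat set + 'o) set)"
  have "(card_of (UNIV :: nat set set), ?c) \<in> ordLeq"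
    by (rule card_of_ordLeqI[of Inl]) auto
  moreover have "(?c, card_of (Field (cardSuc ?c))) \<in> ordLeq"
    using cardSuc_ordLeq[OF card_of_Card_order] ordLeq_ordIso_trans ordIso_symmetric
      card_of_Field_ordIso[OF cardSuc_Card_order[OF card_of_Card_order]] by blast
  ultimately have "(card_of (UNIV :: nat set set), card_of (Field (cardSuc ?c))) \<in> ordLeq"
    using ordLeq_transitive by blast
  then obtain f :: "nat set \<Rightarrow> (nat set + 'o) set"
    where f: "inj f" "range f \<subseteq> Field (cardSuc ?c)"
    unfolding card_of_ordLeq[symmetric] by blast
  define g :: "nat set \<Rightarrow> 'o ordinal" where "g = Abs_ordinal \<circ> f"
  have g: "inj g"
  proof (rule injI)
    fix x y assume "g x = g y"
    moreover have "f x \<in> Field (cardSuc ?c)" "f y \<in> Field (cardSuc ?c)"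
      using f(2) by auto
    ultimately have "f x = f y"
      by (simp add: g_def Abs_ordinal_inject)
    then show "x = y" using f(1) by (simp add: inj_eq)
  qed
  obtain \<beta> where \<beta>: "\<forall>\<alpha>\<in>range g. \<alpha> \<le> \<beta>"
    using ordinal_small_bounded[OF card_of_image_small] by blast
  have "uncountable (range g)"
  proof
    assume "countable (range g)"
    then have "countable (UNIV :: nat set set)"
      using g countable_image_inj_on by blast
    then obtain h :: "nat set \<Rightarrow> nat" where "inj h" unfolding countable_def by blast
    then have "inv h ` (UNIV :: nat set) = Pow (UNIV :: nat set)"
      by (simp add: inj_imp_surj_inv)
    then have "\<exists>k. k ` (UNIV :: nat set) = Pow (UNIV :: nat set)"
      by (rule exI[of _ "inv h"])
    then show False
      using Cantors_theorem[of "UNIV :: nat set"] by simp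
  qed
  moreover have "range g \<subseteq> {..<osucc \<beta>}"
    using \<beta> order_le_less_trans[OF _ ordinal_less_osucc] by auto
  ultimately have "uncountable {..<osucc \<beta>}"
    using countable_subset by blast
  then show ?thesis
    unfolding omega1_def by (rule LeastI)
qed

lemma olimit_omega: "olimit (omega :: 'o ordinal)"
proof -
  define f :: "nat \<Rightarrow> 'o ordinal" where "f n = (osucc ^^ n) ozero" for n
  define U where "U = {\<beta>. \<forall>n. f n < \<beta>}"
  have "range f = (f \<circ> card) ` range (lessThan :: nat \<Rightarrow> nat set)"
    by (simp add: image_image)
  then obtain \<beta> where "\<forall>\<alpha>\<in>range f. \<alpha> \<le> \<beta>"
    using ordinal_small_bounded[OF card_of_image_small] by metis
  then have "osucc \<beta> \<in> U"
    by (auto simp: U_def intro: order_le_less_trans[OF _ ordinal_less_osucc])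
  then have L: "(LEAST \<beta>. \<beta> \<in> U) \<in> U" (is "?l \<in> U") by (rule LeastI)
  have "?l \<noteq> osucc \<zeta>" for \<zeta>
  proof
    assume eq: "?l = osucc \<zeta>"
    then have "\<zeta> \<notin> U"
      using not_less_Least ordinal_less_osucc by metis
    then obtain n where "\<zeta> \<le> f n" by (auto simp: U_def not_less)
    moreover have "f (Suc n) < osucc \<zeta>" using L eq by (auto simp: U_def)
    moreover have "f (Suc n) = osucc (f n)" by (simp add: f_def)
    ultimately show False
      by (metis not_le osucc_le_iff)
  qed
  moreover have "?l \<noteq> ozero"
    using L ozero_le[of "f 0"] by (metis U_def mem_Collect_eq not_le)
  ultimately have "olimit ?l" by (simp add: olimit_def)
  then show ?thesis unfolding omega_def by (rule LeastI)
qed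


section \<open>Derivations and indices of trees\<close>

text \<open>A node is a list; the tree order is \<^const>\<open>strict_prefix\<close>.\<close>

definition tree_deriv :: "'a list set \<Rightarrow> 'a list set" where
  "tree_deriv T = T - {t \<in> T. \<nexists>s. s \<in> T \<and> strict_prefix t s}"

definition iter_deriv :: "('b set \<Rightarrow> 'b set) \<Rightarrow> 'b set \<Rightarrow> 'o ordinal \<Rightarrow> 'b set" where
  "iter_deriv d T = orec T d Inter"

text \<open>
  \<^const>\<open>Pinf\<close> stands for the value \<open>\<infinity>\<close> of an index.  Whether an index exceeds a given
  ordinal does not depend on the choice of the parameter \<open>'o\<close>.
\<close>

definition deriv_index :: "('b set \<Rightarrow> 'b set) \<Rightarrow> 'b set \<Rightarrow> 'o ordinal extended" where
  "deriv_index d T =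
     (if \<exists>\<xi> :: 'o ordinal. iter_deriv d T \<xi> = {}
      then Fin (LEAST \<xi> :: 'o ordinal. iter_deriv d T \<xi> = {}) else Pinf)"


section \<open>Finite dimensional decompositions\<close>

text \<open>
  A Banach space is given by its carrier, a complete linear subspace of a normed type; a Banach
  space which is a type is represented by \<^const>\<open>UNIV\<close>.  The members of an FDD are numbered from
  \<open>0\<close>.
\<close>

definition banach_carrier :: "'a::real_normed_vector set \<Rightarrow> bool" where
  "banach_carrier X \<longleftrightarrow> subspace X \<and> complete X"

definition is_FDD :: "(nat \<Rightarrow> 'a::real_normed_vector set) \<Rightarrow> 'a set \<Rightarrow> bool" where
  "is_FDD E X \<longleftrightarrow> banach_carrier X
     \<and> (\<forall>n. E n \<subseteq> X \<and> subspace (E n) \<and> (\<exists>B. finite B \<and> span B = E n))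
     \<and> (\<forall>x\<in>X. \<exists>!f. (\<forall>n. f n \<in> E n) \<and> f sums x)"

definition fdd_proj :: "(nat \<Rightarrow> 'a::real_normed_vector set) \<Rightarrow> nat \<Rightarrow> 'a \<Rightarrow> 'a" where
  "fdd_proj E n x = (THE f. (\<forall>k. f k \<in> E k) \<and> f sums x) n"

definition fdd_supp :: "(nat \<Rightarrow> 'a::real_normed_vector set) \<Rightarrow> 'a \<Rightarrow> nat set" where
  "fdd_supp E x = {n. fdd_proj E n x \<noteq> 0}"

definition block_sequences ::
  "(nat \<Rightarrow> 'a::real_normed_vector set) \<Rightarrow> 'a set \<Rightarrow> 'a list set" where
  "block_sequences E X =
     {xs. set xs \<subseteq> X \<and> (\<forall>x\<in>set xs. x \<noteq> 0 \<and> finite (fdd_supp E x))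
        \<and> successively (\<lambda>x y. Max (fdd_supp E x) < Min (fdd_supp E y)) xs}"

text \<open>
  For an FDD of the whole type, \<open>E\<^sub>n\<^sup>*\<close> is the image of the algebraic dual of \<open>E\<^sub>n\<close> (all of whose
  members are continuous, as \<open>E\<^sub>n\<close> is finite dimensional) under the adjoint of \<open>P\<^sub>n\<close>.
\<close>

definition fdd_dual ::
  "(nat \<Rightarrow> 'a::real_normed_vector set) \<Rightarrow> nat \<Rightarrow> ('a \<Rightarrow>\<^sub>L real) set" where
  "fdd_dual E n =
     {f. \<exists>\<phi>. (\<forall>u\<in>E n. \<forall>v\<in>E n. \<phi> (u + v) = \<phi> u + \<phi> v)
           \<and> (\<forall>c. \<forall>u\<in>E n. \<phi> (c *\<^sub>R u) = c * \<phi> u)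
           \<and> (\<forall>x. blinfun_apply f x = \<phi> (fdd_proj E n x))}"

definition closed_span_of :: "(nat \<Rightarrow> 'a::real_normed_vector set) \<Rightarrow> 'a set" where
  "closed_span_of E = closure (span (\<Union>n. E n))"


section \<open>The trees and their indices\<close>

definition lp_norm :: "ereal \<Rightarrow> real list \<Rightarrow> real" where
  "lp_norm p a =
     (if p = \<infinity> then Max (insert 0 (abs ` set a))
      else (\<Sum>i<length a. \<bar>a ! i\<bar> powr real_of_ereal p) powr (1 / real_of_ereal p))"

definition lp_tree :: "ereal \<Rightarrow> 'a::real_normed_vector set \<Rightarrow> real \<Rightarrow> 'a list set" where
  "lp_tree p X K =
     {xs. set xs \<subseteq> X \<and> (\<forall>x\<in>set xs. norm x \<le> 1)
        \<and> (\<forall>a. length a = length xs \<and> lp_norm p a = 1 \<longrightarrow>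
             inverse K \<le> norm (\<Sum>i<length xs. a ! i *\<^sub>R xs ! i)
             \<and> norm (\<Sum>i<length xs. a ! i *\<^sub>R xs ! i) \<le> 1)}"

definition lp_block_tree ::
  "ereal \<Rightarrow> (nat \<Rightarrow> 'a::real_normed_vector set) \<Rightarrow> 'a set \<Rightarrow> real \<Rightarrow> 'a list set" where
  "lp_block_tree p E X K = lp_tree p X K \<inter> block_sequences E X"

text \<open>
  Only applied to trees of block sequences, where \<^const>\<open>Min\<close> is taken over a finite non-empty
  support.  Numbering both the \<open>E\<^sub>n\<close> and the \<open>y\<^sub>i\<close> from \<open>0\<close> instead of \<open>1\<close> leaves the condition
  unchanged.
\<close>

definition fdd_deriv ::
  "(nat \<Rightarrow> 'a::real_normed_vector set) \<Rightarrow> 'a list set \<Rightarrow> 'a list set" where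
  "fdd_deriv E T =
     {xs \<in> T. \<exists>y :: nat \<Rightarrow> 'a. \<forall>i. i \<le> Min (fdd_supp E (y i)) \<and> xs @ [y i] \<in> T}"

definition index_I :: "ereal \<Rightarrow> 'a::real_normed_vector set \<Rightarrow> real \<Rightarrow> 'o ordinal extended" where
  "index_I p X K = deriv_index tree_deriv (lp_tree p X K)"

definition index_I_block ::
  "ereal \<Rightarrow> (nat \<Rightarrow> 'a::real_normed_vector set) \<Rightarrow> 'a set \<Rightarrow> real \<Rightarrow> 'o ordinal extended" where
  "index_I_block p E X K = deriv_index tree_deriv (lp_block_tree p E X K)"

definition index_I_asymp ::
  "ereal \<Rightarrow> (nat \<Rightarrow> 'a::real_normed_vector set) \<Rightarrow> 'a set \<Rightarrow> real \<Rightarrow> 'o ordinal extended" where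
  "index_I_asymp p E X K = deriv_index (fdd_deriv E) (lp_block_tree p E X K)"


section \<open>Schreier families and spreading models\<close>

text \<open>
  Here the natural numbers start with \<open>1\<close>: all families consist of finite subsets of \<open>{1..}\<close>.
\<close>

definition family_compose :: "nat set set \<Rightarrow> nat set set \<Rightarrow> nat set set" where
  "family_compose \<F> \<G> =
     insert {} {\<Union> (set Es) | Es. (\<forall>A\<in>set Es. A \<noteq> {} \<and> A \<in> \<G>)
                  \<and> successively (\<lambda>A B. Max A < Min B) Es \<and> Min ` set Es \<in> \<F>}"

definition schreier :: "nat set set" where
  "schreier = insert {} {A. finite A \<and> A \<noteq> {} \<and> A \<subseteq> {1..} \<and> card A \<le> Min A}"

text \<open>
  \<open>schreier_system S\<close> states that \<open>(S \<xi>)\<close> for \<open>\<xi> \<le> \<omega>\<^sub>1\<close> are the Schreier families arising from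
  some choice of the approximating sequences \<open>s n\<close> (\<open>n \<ge> 1\<close>) at countable limit ordinals.
  The condition at \<open>1 = 0 + 1\<close> yields \<^const>\<open>schreier\<close>.
\<close>

definition schreier_system :: "('o ordinal \<Rightarrow> nat set set) \<Rightarrow> bool" where
  "schreier_system S \<longleftrightarrow>
     S ozero = {A. finite A \<and> A \<subseteq> {1..} \<and> card A \<le> 1}
     \<and> (\<forall>\<xi><omega1. S (osucc \<xi>) = family_compose schreier (S \<xi>))
     \<and> (\<forall>\<xi><omega1. olimit \<xi> \<longrightarrow>
          (\<exists>s :: nat \<Rightarrow> 'o ordinal.
             strict_mono_on {1..} s \<and> (\<forall>n\<ge>1. s n < \<xi>) \<and> (\<forall>\<zeta><\<xi>. \<exists>n\<ge>1. \<zeta> < s n)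
             \<and> (\<forall>n\<ge>1. S (osucc (s n)) \<subseteq> S (s (Suc n)))
             \<and> S \<xi> = insert {} {A. A \<noteq> {} \<and> (\<exists>n\<ge>1. n \<le> Min A \<and> A \<in> S (osucc (s n)))}))
     \<and> S omega1 = {A. finite A \<and> A \<subseteq> {1..}}"

text \<open>
  The term \<open>x 0\<close> of the sequence plays no role beyond lying in the space.
\<close>

definition spreading_model ::
  "('o ordinal \<Rightarrow> nat set set) \<Rightarrow> ereal \<Rightarrow> 'o ordinal \<Rightarrow> 'a::real_normed_vector set \<Rightarrow> real
     \<Rightarrow> (nat \<Rightarrow> 'a) \<Rightarrow> bool" where
  "spreading_model S p \<xi> X K x \<longleftrightarrow>
     range x \<subseteq> X \<and> (\<forall>A\<in>S \<xi>. map x (sorted_list_of_set A) \<in> lp_tree p X K)"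

definition index_SM ::
  "('o ordinal \<Rightarrow> nat set set) \<Rightarrow> ereal \<Rightarrow> 'a::real_normed_vector set \<Rightarrow> real
     \<Rightarrow> 'o ordinal extended" where
  "index_SM S p X K =
     (if \<exists>\<xi>\<le>omega1. \<nexists>x. spreading_model S p \<xi> X K x
      then Fin (LEAST \<xi>. \<xi> \<le> omega1 \<and> (\<nexists>x. spreading_model S p \<xi> X K x)) else Pinf)"


section \<open>The classes\<close>

definition class_P1 :: "'o ordinal \<Rightarrow> ereal \<Rightarrow> 'a::real_normed_vector set \<Rightarrow> bool" where
  "class_P1 \<xi> p X \<longleftrightarrow> banach_carrier X \<and> (\<exists>K>1. index_I p X K > Fin (opow omega \<xi>))"

definition class_P2 ::
  "'o ordinal \<Rightarrow> ereal \<Rightarrow> (nat \<Rightarrow> 'a::real_normed_vector set) \<Rightarrow> 'a set \<Rightarrow> bool" where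
  "class_P2 \<xi> p E X \<longleftrightarrow> is_FDD E X \<and> (\<exists>K>1. index_I_block p E X K > Fin (opow omega \<xi>))"

definition class_P3 ::
  "'o ordinal \<Rightarrow> ereal \<Rightarrow> (nat \<Rightarrow> 'a::real_normed_vector set) \<Rightarrow> 'a set \<Rightarrow> bool" where
  "class_P3 \<xi> p E X \<longleftrightarrow> is_FDD E X \<and> (\<exists>K>1. index_I_asymp p E X K > Fin (opow omega \<xi>))"

definition class_P4 ::
  "('o ordinal \<Rightarrow> nat set set) \<Rightarrow> 'o ordinal \<Rightarrow> ereal \<Rightarrow> 'a::real_normed_vector set \<Rightarrow> bool" where
  "class_P4 S \<xi> p X \<longleftrightarrow> banach_carrier X \<and> (\<exists>K>1. index_SM S p X K > Fin \<xi>)"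


section \<open>Preduals\<close>

text \<open>
  The identity \<open>Y\<^sup>* = X\<close> is witnessed by a linear isometry \<open>J\<close> of \<open>X\<close> onto \<open>Y\<^sup>*\<close>; likewise the
  identities \<open>F\<^sup>* = E\<close>, \<open>[F\<^sup>*] = X\<close> by a linear isometry of \<open>X\<close> onto \<open>[F\<^sup>*]\<close> taking each \<open>E\<^sub>n\<close> to
  \<open>F\<^sub>n\<^sup>*\<close>.
\<close>

definition predual_via :: "('x::real_normed_vector \<Rightarrow> ('y::real_normed_vector \<Rightarrow>\<^sub>L real)) \<Rightarrow> bool" where
  "predual_via J \<longleftrightarrow> linear J \<and> (\<forall>x. norm (J x) = norm x) \<and> range J = UNIV"

definition fdd_predual_via ::
  "('x::real_normed_vector \<Rightarrow> ('y::real_normed_vector \<Rightarrow>\<^sub>L real))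
     \<Rightarrow> (nat \<Rightarrow> 'x set) \<Rightarrow> (nat \<Rightarrow> 'y set) \<Rightarrow> bool" where
  "fdd_predual_via J E F \<longleftrightarrow> linear J \<and> (\<forall>x. norm (J x) = norm x)
     \<and> range J = closed_span_of (fdd_dual F) \<and> (\<forall>n. J ` E n = fdd_dual F n)"

end

theory Submission
  imports Defs
begin

text \<open>
  If \<open>(x\<^sub>i)\<close> is \<open>K\<close>-equivalent to the basis of a finite dimensional \<open>c\<^sub>0\<close> with \<open>\<parallel>\<Sum> \<plusminus>x\<^sub>i\<parallel> \<le> 1\<close>, and
  bounded functionals \<open>z\<^sub>i\<close> are almost biorthogonal to it, then testing \<open>\<Sum> a\<^sub>i z\<^sub>i\<close> against
  \<open>\<Sum> sgn(a\<^sub>i) x\<^sub>i\<close> shows that \<open>(z\<^sub>i)\<close> dominates a multiple of the \<open>\<ell>\<^sub>1\<close> basis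
  (\<open>almost_biorthogonal_imp_l1\<close>). The theorem is about making such choices coherently: in a tree,
  \<open>z\<^sub>i\<close> may depend on the part of the branch read so far, but not on its continuation.

  A space and its dual, or a dual space and its predual, are treated at once as a bilinear pairing
  in which the functionals norm the vectors up to a factor. No extension of functionals with prescribed
  values is needed: given \<open>x\<^sub>1,\<dots>,x\<^sub>k\<close> and \<open>z\<^sub>1,\<dots>,z\<^sub>k\<close> and a long \<open>c\<^sub>0\<close> sequence
  \<open>y\<^sub>1,\<dots>,y\<^sub>N\<close>, some difference of functionals norming two of the \<open>y\<^sub>j\<close> continues the almost
  biorthogonal sequence (\<open>almost_biorthogonal_extend\<close>). The reason is that among
  sufficiently many bounded functionals some almost agree at \<open>x\<^sub>1,\<dots>,x\<^sub>k\<close>, and that a bounded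
  functional is large at boundedly many terms of a \<open>c\<^sub>0\<close> sequence only, with a bound that does not
  depend on the sequence.

  For the index of the tree of all sequences, each choice costs a bounded number of terms of the
  branch, that is, finitely many derivations. Such losses vanish at limit ordinals, and \<open>\<omega>\<^sup>\<xi>\<close> is a
  limit ordinal unless \<open>\<xi> = 0\<close> (\<open>iter_deriv_lp_tree_transfer\<close>, \<open>index_I_transfer\<close>).

  For spreading models the same step is applied along a single sequence. Every Schreier family of
  positive index contains arbitrarily long intervals far out, which provide the long \<open>c\<^sub>0\<close>
  sequences, and all Schreier families are closed under spreading, so that the subsequence of
  \<open>(x\<^sub>n)\<close> selected in the process is again a spreading model (\<open>spreading_model_transfer\<close>).

  For block trees no choice is necessary. The partial sum projections of a decomposition are
  uniformly bounded (\<open>S_uniformly_bounded\<close>), hence a functional norming a block can be cut down to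
  the interval spanned by the support of that block. Functionals obtained from successive blocks are
  successive blocks and exactly biorthogonal, so the passage from \<open>x\<^sub>i\<close> to \<open>z\<^sub>i\<close> commutes with both
  derivations (\<open>map_functional_block_tree\<close>).
\<close>

section \<open>Ordinal arithmetic\<close>

lemma ordinal_induct [case_names zero succ limit]:
  fixes \<alpha> :: "'o ordinal"
  assumes "P ozero" and "\<And>\<zeta>. P \<zeta> \<Longrightarrow> P (osucc \<zeta>)"
    and "\<And>\<nu>. olimit \<nu> \<Longrightarrow> (\<And>\<zeta>. \<zeta> < \<nu> \<Longrightarrow> P \<zeta>) \<Longrightarrow> P \<nu>"
  shows "P \<alpha>"
proof (induction \<alpha> rule: less_induct)
  case (less \<alpha>)
  then show ?case
    using assms ordinal_less_osucc by (metis olimit_def)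
qed

lemma less_osucc_iff: "\<zeta> < osucc \<alpha> \<longleftrightarrow> \<zeta> \<le> \<alpha>"
  by (metis not_le osucc_le_iff)

lemma ozero_less_iff: "ozero < \<alpha> \<longleftrightarrow> \<alpha> \<noteq> ozero"
  using ozero_le[of \<alpha>] by (auto simp: order_le_less)

lemma ozero_less_olimit: "olimit \<nu> \<Longrightarrow> ozero < \<nu>"
  by (simp add: olimit_def ozero_less_iff)

lemma osucc_less_olimit: "olimit \<nu> \<Longrightarrow> \<zeta> < \<nu> \<Longrightarrow> osucc \<zeta> < \<nu>"
  by (metis olimit_def order_le_less osucc_le_iff)

lemma osucc_funpow_less_olimit: "olimit \<nu> \<Longrightarrow> \<zeta> < \<nu> \<Longrightarrow> (osucc ^^ m) \<zeta> < \<nu>"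
  by (induction m) (auto intro: osucc_less_olimit)

text \<open>Below an ordinal of a successor cardinal there are at most as many ordinals as the
  predecessor cardinal has elements; this is what makes suprema along transfinite recursions
  genuine upper bounds.\<close>

lemma le_osup_image:
  fixes f :: "'o ordinal \<Rightarrow> 'o ordinal"
  assumes "\<zeta> < \<xi>"
  shows "f \<zeta> \<le> osup (f ` {..<\<xi>})"
proof (rule osup_upper)
  let ?c = "card_of (UNIV :: (nat set + 'o) set)"
  let ?r = "cardSuc ?c"
  have co: "Card_order ?r" by (rule cardSuc_Card_order[OF card_of_Card_order])
  have "Rep_ordinal ` {..<\<xi>} \<subseteq> underS ?r (Rep_ordinal \<xi>)"
    by (auto simp: underS_def less_ordinal_def less_eq_ordinal_def Rep_ordinal_inject)
  then have "(card_of (Rep_ordinal ` {..<\<xi>}), card_of (underS ?r (Rep_ordinal \<xi>))) \<in> ordLeq"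
    by (rule card_of_mono1)
  moreover have "(card_of (underS ?r (Rep_ordinal \<xi>)), ?r) \<in> ordLess"
    by (rule card_of_underS[OF co Rep_ordinal])
  ultimately have "(card_of (Rep_ordinal ` {..<\<xi>}), ?r) \<in> ordLess"
    by (rule ordLeq_ordLess_trans)
  then have "(card_of (Rep_ordinal ` {..<\<xi>}), ?c) \<in> ordLeq"
    using cardSuc_ordLeq_ordLess[OF card_of_Card_order card_of_Card_order] by blast
  moreover have "(card_of {..<\<xi>}, card_of (Rep_ordinal ` {..<\<xi>})) \<in> ordLeq"
    by (rule card_of_ordLeqI[of Rep_ordinal]) (auto simp: inj_on_def Rep_ordinal_inject)
  ultimately have "(card_of {..<\<xi>}, ?c) \<in> ordLeq"
    using ordLeq_transitive by blast
  then show "(card_of (f ` {..<\<xi>}), ?c) \<in> ordLeq"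
    by (rule ordLeq_transitive[OF card_of_image])
  show "f \<zeta> \<in> f ` {..<\<xi>}" using assms by simp
qed

lemma osup_image_le:
  assumes "\<And>\<zeta>. \<zeta> < \<xi> \<Longrightarrow> f \<zeta> \<le> \<beta>"
  shows "osup (f ` {..<\<xi>}) \<le> \<beta>"
  unfolding osup_def by (rule Least_le) (use assms in auto)

lemma less_osup_imageD:
  assumes "\<rho> < osup (f ` {..<\<xi>})"
  obtains \<zeta> where "\<zeta> < \<xi>" "\<rho> < f \<zeta>"
  using assms osup_image_le[of \<xi> f \<rho>] by (meson not_le)

lemma oadd_zero [simp]: "oadd \<alpha> ozero = \<alpha>"
  and oadd_osucc: "oadd \<alpha> (osucc \<beta>) = osucc (oadd \<alpha> \<beta>)"
  and omult_zero [simp]: "omult \<alpha> ozero = ozero"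
  and omult_osucc: "omult \<alpha> (osucc \<beta>) = oadd (omult \<alpha> \<beta>) \<alpha>"
  and opow_zero: "opow \<alpha> ozero = osucc ozero"
  and opow_osucc: "opow \<alpha> (osucc \<beta>) = omult (opow \<alpha> \<beta>) \<alpha>"
  by (simp_all add: oadd_def omult_def opow_def orec_zero orec_succ)

lemma less_oadd:
  assumes "\<beta> \<noteq> ozero"
  shows "\<alpha> < oadd \<alpha> \<beta>"
  using assms
proof (induction \<beta> rule: ordinal_induct)
  case (succ \<zeta>)
  then show ?case
    by (cases "\<zeta> = ozero") (auto simp: oadd_osucc ordinal_less_osucc less_osucc_iff less_imp_le)
next
  case (limit l)
  have "oadd \<alpha> (osucc ozero) \<le> oadd \<alpha> l"
    using le_osup_image[of "osucc ozero" l "oadd \<alpha>"] limit(1)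
    by (simp add: oadd_def orec_limit osucc_less_olimit ozero_less_olimit)
  then show ?case
    by (simp add: oadd_osucc osucc_le_iff)
qed simp

lemma less_omega_osucc: "\<zeta> < omega \<Longrightarrow> osucc \<zeta> < omega"
  by (rule osucc_less_olimit[OF olimit_omega])

lemma olimit_omult_omega:
  assumes "\<alpha> \<noteq> ozero"
  shows "olimit (omult \<alpha> omega)"
proof -
  let ?s = "omult \<alpha> omega"
  have s: "?s = osup (omult \<alpha> ` {..<omega})"
    unfolding omult_def by (rule orec_limit[OF olimit_omega])
  have incr: "omult \<alpha> \<zeta> < ?s" if "\<zeta> < omega" for \<zeta>
  proof -
    have "omult \<alpha> \<zeta> < omult \<alpha> (osucc \<zeta>)"
      using less_oadd[OF assms] by (simp add: omult_osucc)
    also have "\<dots> \<le> ?s"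
      unfolding s by (rule le_osup_image[OF less_omega_osucc[OF that]])
    finally show ?thesis .
  qed
  have "?s \<noteq> osucc \<rho>" for \<rho>
  proof
    assume eq: "?s = osucc \<rho>"
    then have "\<rho> < ?s" by (simp add: ordinal_less_osucc)
    then obtain \<zeta> where "\<zeta> < omega" "\<rho> < omult \<alpha> \<zeta>"
      unfolding s by (rule less_osup_imageD)
    then show False
      using incr[of \<zeta>] eq by (auto simp: less_osucc_iff)
  qed
  moreover have "ozero < ?s"
    using incr[OF ozero_less_olimit[OF olimit_omega]] by simp
  ultimately show ?thesis by (auto simp: olimit_def)
qed

text \<open>Losses of finitely many derivations per step are absorbed at limit ordinals, so that only
  \<open>\<omega>\<^sup>0\<close> has to be treated differently.\<close>

lemma olimit_opow_omega:
  fixes \<xi> :: "'o ordinal"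
  assumes "\<xi> \<noteq> ozero"
  shows "olimit (opow omega \<xi>)"
  using assms
proof (induction \<xi> rule: ordinal_induct)
  case (succ \<zeta>)
  then have "opow omega \<zeta> \<noteq> ozero"
    by (cases "\<zeta> = ozero") (auto simp: opow_zero olimit_def)
  then show ?case
    by (simp add: opow_osucc olimit_omult_omega)
next
  case (limit l)
  let ?s = "opow omega l"
  have s: "?s = osup (opow omega ` {..<l})"
    unfolding opow_def by (rule orec_limit[OF limit(1)])
  have one: "osucc ozero < l"
    using limit(1) by (simp add: osucc_less_olimit ozero_less_olimit)
  have lim1: "olimit (opow omega (osucc ozero :: 'o ordinal))"
    using limit(2)[OF one osucc_neq_ozero] .
  have pos: "osucc ozero < ?s"
  proof -
    have "osucc ozero < opow omega (osucc ozero :: 'o ordinal)"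
      by (rule osucc_less_olimit[OF lim1 ozero_less_olimit[OF lim1]])
    also have "\<dots> \<le> ?s" unfolding s by (rule le_osup_image[OF one])
    finally show ?thesis .
  qed
  have "?s \<noteq> osucc \<rho>" for \<rho>
  proof
    assume eq: "?s = osucc \<rho>"
    then have "\<rho> < ?s" by (simp add: ordinal_less_osucc)
    then obtain \<zeta> where \<zeta>: "\<zeta> < l" "\<rho> < opow omega \<zeta>"
      unfolding s by (rule less_osup_imageD)
    from \<zeta>(2) have "?s \<le> opow omega \<zeta>"
      unfolding eq osucc_le_iff .
    moreover have "opow omega \<zeta> \<le> ?s"
      unfolding s by (rule le_osup_image[OF \<zeta>(1)])
    ultimately have "opow omega \<zeta> = ?s"
      by (rule antisym[rotated])
    moreover have "\<not> olimit ?s"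
      using eq by (auto simp: olimit_def)
    ultimately have "\<zeta> = ozero"
      using limit(2)[OF \<zeta>(1)] by auto
    with \<open>opow omega \<zeta> = ?s\<close> pos show False
      by (simp add: opow_zero)
  qed
  moreover have "?s \<noteq> ozero"
    using pos by (metis leD ozero_le)
  ultimately show ?case by (simp add: olimit_def)
qed simp


section \<open>Derivations of trees\<close>

lemma iter_deriv_zero: "iter_deriv d T ozero = T"
  and iter_deriv_osucc: "iter_deriv d T (osucc \<xi>) = d (iter_deriv d T \<xi>)"
  and iter_deriv_olimit: "olimit \<nu> \<Longrightarrow> iter_deriv d T \<nu> = (\<Inter>\<xi>\<in>{..<\<nu>}. iter_deriv d T \<xi>)"
  by (simp_all add: iter_deriv_def orec_zero orec_succ orec_limit)

lemma deriv_index_greaterD: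
  fixes \<alpha> :: "'b ordinal"
  assumes "deriv_index d T > Fin \<alpha>" "\<zeta> \<le> \<alpha>"
  shows "iter_deriv d T \<zeta> \<noteq> {}"
proof
  assume *: "iter_deriv d T \<zeta> = {}"
  then have "deriv_index d T = Fin (LEAST \<xi> :: 'b ordinal. iter_deriv d T \<xi> = {})"
    by (auto simp: deriv_index_def)
  moreover have "(LEAST \<xi>. iter_deriv d T \<xi> = {}) \<le> \<zeta>"
    by (rule Least_le) (rule *)
  ultimately show False using assms by (simp add: leD)
qed

lemma deriv_index_greaterI:
  fixes \<alpha> :: "'b ordinal"
  assumes "\<And>\<zeta>. \<zeta> \<le> \<alpha> \<Longrightarrow> iter_deriv d T \<zeta> \<noteq> {}"
  shows "deriv_index d T > Fin \<alpha>"
proof (cases "\<exists>\<xi> :: 'b ordinal. iter_deriv d T \<xi> = {}")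
  case True
  then have "iter_deriv d T (LEAST \<xi> :: 'b ordinal. iter_deriv d T \<xi> = {}) = {}"
    by (rule LeastI_ex)
  then have "\<alpha> < (LEAST \<xi>. iter_deriv d T \<xi> = {})"
    using assms by (meson not_le)
  then show ?thesis using True by (simp add: deriv_index_def)
qed (simp add: deriv_index_def)

lemma iter_deriv_subset:
  assumes "\<And>U. d U \<subseteq> U"
  shows "iter_deriv d T \<xi> \<subseteq> T"
proof (induction \<xi> rule: ordinal_induct)
  case (succ \<zeta>)
  then show ?case using assms by (fastforce simp: iter_deriv_osucc)
next
  case (limit l)
  then show ?case
    using ozero_less_olimit by (fastforce simp: iter_deriv_olimit)
qed (simp add: iter_deriv_zero)

text \<open>This serves for block trees, where functionals are assigned to nodes by a map. The restriction
  to \<open>U \<subseteq> T\<close> matters because supports are controlled on block sequences only.\<close>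

lemma iter_deriv_image:
  assumes d: "\<And>U. d U \<subseteq> U" and T: "h ` T \<subseteq> T'"
    and step: "\<And>U U'. U \<subseteq> T \<Longrightarrow> h ` U \<subseteq> U' \<Longrightarrow> h ` d U \<subseteq> d' U'"
  shows "h ` iter_deriv d T \<xi> \<subseteq> iter_deriv d' T' \<xi>"
proof (induction \<xi> rule: ordinal_induct)
  case zero
  then show ?case using T by (simp add: iter_deriv_zero)
next
  case (succ \<zeta>)
  then show ?case
    using step[OF iter_deriv_subset[OF d]] by (simp add: iter_deriv_osucc)
next
  case (limit l)
  then show ?case by (fastforce simp: iter_deriv_olimit)
qed

lemma deriv_index_image:
  fixes \<alpha> :: "'o ordinal"
  assumes "\<And>U. d U \<subseteq> U" "h ` T \<subseteq> T'"
    and "\<And>U U'. U \<subseteq> T \<Longrightarrow> h ` U \<subseteq> U' \<Longrightarrow> h ` d U \<subseteq> d' U'"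
    and "deriv_index d T > Fin \<alpha>"
  shows "deriv_index d' T' > Fin \<alpha>"
proof (rule deriv_index_greaterI)
  fix \<zeta> :: "'o ordinal" assume "\<zeta> \<le> \<alpha>"
  then have "iter_deriv d T \<zeta> \<noteq> {}"
    by (rule deriv_index_greaterD[OF assms(4)])
  moreover have "h ` iter_deriv d T \<zeta> \<subseteq> iter_deriv d' T' \<zeta>"
    using assms(1-3) by (rule iter_deriv_image)
  ultimately show "iter_deriv d' T' \<zeta> \<noteq> {}"
    by blast
qed

lemma tree_deriv_iff: "t \<in> tree_deriv U \<longleftrightarrow> t \<in> U \<and> (\<exists>s\<in>U. strict_prefix t s)"
  by (auto simp: tree_deriv_def)

lemma tree_deriv_subset: "tree_deriv U \<subseteq> U"
  by (auto simp: tree_deriv_def)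

lemma fdd_deriv_subset: "fdd_deriv E U \<subseteq> U"
  by (auto simp: fdd_deriv_def)

definition prefix_closed :: "'a list set \<Rightarrow> bool" where
  "prefix_closed T \<longleftrightarrow> (\<forall>t\<in>T. \<forall>s. prefix s t \<longrightarrow> s \<in> T)"

lemma prefix_closedD: "prefix_closed T \<Longrightarrow> t \<in> T \<Longrightarrow> prefix s t \<Longrightarrow> s \<in> T"
  by (auto simp: prefix_closed_def)

lemma prefix_closed_iter_deriv:
  assumes "prefix_closed T"
  shows "prefix_closed (iter_deriv tree_deriv T \<xi>)"
proof (induction \<xi> rule: ordinal_induct)
  case (succ \<zeta>)
  show ?case
    unfolding prefix_closed_def iter_deriv_osucc
  proof (intro ballI allI impI)
    fix t s assume t: "t \<in> tree_deriv (iter_deriv tree_deriv T \<zeta>)" and st: "prefix s t"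
    then obtain u where "u \<in> iter_deriv tree_deriv T \<zeta>" "strict_prefix t u"
      by (auto simp: tree_deriv_iff)
    moreover have "s \<in> iter_deriv tree_deriv T \<zeta>"
      using prefix_closedD[OF succ _ st] t by (simp add: tree_deriv_iff)
    ultimately show "s \<in> tree_deriv (iter_deriv tree_deriv T \<zeta>)"
      using prefix_order.le_less_trans[OF st] by (auto simp: tree_deriv_iff)
  qed
next
  case (limit l)
  then show ?case by (fastforce simp: prefix_closed_def iter_deriv_olimit)
qed (use assms in \<open>simp add: iter_deriv_zero\<close>)

lemma tree_deriv_prefix_closed_iff:
  assumes "prefix_closed U"
  shows "t \<in> tree_deriv U \<longleftrightarrow> (\<exists>x. t @ [x] \<in> U)"
proof
  assume "t \<in> tree_deriv U"
  then obtain s where s: "s \<in> U" "strict_prefix t s" by (auto simp: tree_deriv_iff)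
  then obtain x r where "s = t @ x # r"
    by (auto elim: strict_prefixE')
  then have "prefix (t @ [x]) s" by auto
  with s assms show "\<exists>x. t @ [x] \<in> U"
    by (blast dest: prefix_closedD)
next
  assume "\<exists>x. t @ [x] \<in> U"
  then obtain x where "t @ [x] \<in> U" by blast
  then show "t \<in> tree_deriv U"
    using prefix_closedD[OF assms, of "t @ [x]" t]
    by (auto simp: tree_deriv_iff strict_prefix_def intro!: bexI[of _ "t @ [x]"])
qed

lemma iter_deriv_funpow_extend:
  assumes "prefix_closed T" "t \<in> iter_deriv tree_deriv T ((osucc ^^ N) \<alpha>)"
  shows "\<exists>ys. length ys = N \<and> t @ ys \<in> iter_deriv tree_deriv T \<alpha>"
  using assms(2)
proof (induction N arbitrary: t)
  case (Suc N)
  then have "t \<in> tree_deriv (iter_deriv tree_deriv T ((osucc ^^ N) \<alpha>))"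
    by (simp add: iter_deriv_osucc)
  then obtain x where "t @ [x] \<in> iter_deriv tree_deriv T ((osucc ^^ N) \<alpha>)"
    using tree_deriv_prefix_closed_iff[OF prefix_closed_iter_deriv[OF assms(1)]] by blast
  then obtain ys where "length ys = N" "(t @ [x]) @ ys \<in> iter_deriv tree_deriv T \<alpha>"
    using Suc.IH by blast
  then show ?case by (intro exI[of _ "x # ys"]) simp
qed simp


section \<open>Finite \<open>c\<^sub>0\<close> and \<open>\<ell>\<^sub>1\<close> sequences\<close>

lemma lp_norm_infinity: "lp_norm \<infinity> a = Max (insert 0 (abs ` set a))"
  by (simp add: lp_norm_def)

lemma lp_norm_1: "lp_norm 1 a = (\<Sum>i<length a. \<bar>a ! i\<bar>)"
  by (simp add: lp_norm_def one_ereal_def sum_nonneg)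

lemma subseq_coefficients:
  fixes xs ys :: "'a::real_normed_vector list" and a :: "real list"
  assumes "subseq ys xs" "length a = length ys"
  shows "\<exists>b. length b = length xs \<and> insert 0 (abs ` set b) = insert 0 (abs ` set a)
    \<and> (\<Sum>i<length xs. b ! i *\<^sub>R xs ! i) = (\<Sum>i<length ys. a ! i *\<^sub>R ys ! i)"
  using assms
proof (induction arbitrary: a rule: list_emb.induct)
  case (list_emb_Nil xs)
  then show ?case
    by (intro exI[of _ "replicate (length xs) 0"]) (auto simp: set_replicate_conv_if)
next
  case (list_emb_Cons ys xs x)
  then obtain b where "length b = length xs" "insert 0 (abs ` set b) = insert 0 (abs ` set a)"
    "(\<Sum>i<length xs. b ! i *\<^sub>R xs ! i) = (\<Sum>i<length ys. a ! i *\<^sub>R ys ! i)"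
    by blast
  then show ?case
    by (intro exI[of _ "0 # b"]) (simp add: sum.lessThan_Suc_shift del: sum.lessThan_Suc)
next
  case (list_emb_Cons2 y x ys xs)
  then obtain c a' where a: "a = c # a'" "length a' = length ys"
    by (cases a) auto
  with list_emb_Cons2 obtain b where "length b = length xs"
    "insert 0 (abs ` set b) = insert 0 (abs ` set a')"
    "(\<Sum>i<length xs. b ! i *\<^sub>R xs ! i) = (\<Sum>i<length ys. a' ! i *\<^sub>R ys ! i)"
    by blast
  then show ?case
    using a list_emb_Cons2
    by (intro exI[of _ "c # b"]) (auto simp: sum.lessThan_Suc_shift insert_commute simp del: sum.lessThan_Suc)
qed

lemma lp_tree_infinity_subseq:
  assumes "xs \<in> lp_tree \<infinity> X K" "subseq ys xs"
  shows "ys \<in> lp_tree \<infinity> X K"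
proof -
  have "set ys \<subseteq> set xs"
    using assms(2) by (metis set_nths_subset subseq_conv_nths)
  moreover have "inverse K \<le> norm (\<Sum>i<length ys. a ! i *\<^sub>R ys ! i)
      \<and> norm (\<Sum>i<length ys. a ! i *\<^sub>R ys ! i) \<le> 1"
    if a: "length a = length ys" "lp_norm \<infinity> a = 1" for a
  proof -
    obtain b where "length b = length xs" "insert 0 (abs ` set b) = insert 0 (abs ` set a)"
      and b: "(\<Sum>i<length xs. b ! i *\<^sub>R xs ! i) = (\<Sum>i<length ys. a ! i *\<^sub>R ys ! i)"
      using subseq_coefficients[OF assms(2) a(1)] by blast
    then have "lp_norm \<infinity> b = 1" using a(2) by (simp only: lp_norm_infinity)
    with \<open>length b = length xs\<close> assms(1) show ?thesis
      unfolding b[symmetric] by (auto simp: lp_tree_def)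
  qed
  ultimately show ?thesis
    using assms(1) by (auto simp: lp_tree_def)
qed

lemma lp_tree_infinity_norm_ge:
  assumes "xs \<in> lp_tree \<infinity> X K" "x \<in> set xs"
  shows "inverse K \<le> norm x"
proof -
  have "[x] \<in> lp_tree \<infinity> X K"
    using assms by (intro lp_tree_infinity_subseq[OF assms(1)]) (simp add: subseq_singleton_left)
  then have "inverse K \<le> norm (\<Sum>i<length [x]. [1] ! i *\<^sub>R [x] ! i)"
    unfolding lp_tree_def by (auto simp: lp_norm_infinity dest!: spec[of _ "[1]"])
  then show ?thesis by simp
qed

lemma lp_tree_norm_le: "xs \<in> lp_tree p X K \<Longrightarrow> x \<in> set xs \<Longrightarrow> norm x \<le> 1"
  by (auto simp: lp_tree_def)

lemma lp_tree_infinity_sign_sum_le: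
  fixes s :: "nat \<Rightarrow> real"
  assumes "xs \<in> lp_tree \<infinity> X K" and s: "\<And>i. \<bar>s i\<bar> = 1"
  shows "norm (\<Sum>i<length xs. s i *\<^sub>R xs ! i) \<le> 1"
proof (cases "xs = []")
  case False
  let ?a = "map s [0..<length xs]"
  have "abs ` set ?a = {1}"
    using False s by (auto simp: image_image image_constant_conv)
  then have "lp_norm \<infinity> ?a = 1" by (simp only: lp_norm_infinity) simp
  then have "norm (\<Sum>i<length xs. ?a ! i *\<^sub>R xs ! i) \<le> 1"
    using assms(1) unfolding lp_tree_def by force
  then show ?thesis by simp
qed simp

lemma Nil_in_lp_tree: "[] \<in> lp_tree p X K"
  by (auto simp: lp_tree_def lp_norm_def)

lemma prefix_closed_lp_tree_infinity: "prefix_closed (lp_tree \<infinity> X K)"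
  by (auto simp: prefix_closed_def intro: lp_tree_infinity_subseq)

lemma prefix_closed_lp_tree_1: "prefix_closed (lp_tree 1 X K)"
  unfolding prefix_closed_def
proof (intro ballI allI impI)
  fix t s :: "'a list" assume t: "t \<in> lp_tree 1 X K" and "prefix s t"
  then obtain r where r: "t = s @ r" by (auto elim: prefixE)
  have "inverse K \<le> norm (\<Sum>i<length s. a ! i *\<^sub>R s ! i)
      \<and> norm (\<Sum>i<length s. a ! i *\<^sub>R s ! i) \<le> 1"
    if a: "length a = length s" "lp_norm 1 a = 1" for a
  proof -
    let ?b = "a @ replicate (length r) 0"
    have split: "(\<Sum>i<length t. f i) = (\<Sum>i<length s. f i)"
      if "\<And>i. length s \<le> i \<Longrightarrow> i < length t \<Longrightarrow> f i = 0" for f :: "nat \<Rightarrow> 'b::comm_monoid_add"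
      using that r by (intro sum.mono_neutral_right) auto
    have "length ?b = length t" using a r by simp
    moreover have "lp_norm 1 ?b = 1"
    proof -
      have "lp_norm 1 ?b = (\<Sum>i<length t. \<bar>?b ! i\<bar>)"
        using \<open>length ?b = length t\<close> by (simp only: lp_norm_1)
      also have "\<dots> = (\<Sum>i<length s. \<bar>?b ! i\<bar>)"
        using a r by (intro split) (simp add: nth_append)
      finally show ?thesis
        using a by (simp add: lp_norm_1 nth_append)
    qed
    ultimately have "inverse K \<le> norm (\<Sum>i<length t. ?b ! i *\<^sub>R t ! i)
      \<and> norm (\<Sum>i<length t. ?b ! i *\<^sub>R t ! i) \<le> 1"
      using t unfolding lp_tree_def by blast
    moreover have "(\<Sum>i<length t. ?b ! i *\<^sub>R t ! i) = (\<Sum>i<length s. ?b ! i *\<^sub>R t ! i)"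
      using a r by (intro split) (simp add: nth_append)
    moreover have "\<dots> = (\<Sum>i<length s. a ! i *\<^sub>R s ! i)"
      using a r by (intro sum.cong) (simp_all add: nth_append)
    ultimately show ?thesis by simp
  qed
  then show "s \<in> lp_tree 1 X K"
    using t r by (auto simp: lp_tree_def)
qed

lemma singleton_in_lp_tree_1:
  assumes "x \<in> X" "inverse K \<le> norm x" "norm x \<le> 1"
  shows "[x] \<in> lp_tree 1 X K"
proof -
  have "\<exists>c. a = [c] \<and> \<bar>c\<bar> = 1" if "length a = 1" "lp_norm 1 a = 1" for a
    using that by (auto simp: lp_norm_1 length_Suc_conv)
  then show ?thesis
    using assms by (fastforce simp: lp_tree_def)
qed


section \<open>Almost biorthogonal sequences\<close>

text \<open>The factor \<open>1 / 2\<close> admits a dual space paired with its predual, where norms need not be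
  attained.\<close>

locale norming_pairing = bounded_bilinear B
  for B :: "'z::real_normed_vector \<Rightarrow> 'x::real_normed_vector \<Rightarrow> real" +
  assumes le_norm: "\<bar>B z x\<bar> \<le> norm z * norm x"
    and norming: "\<exists>z. norm z \<le> 1 \<and> norm x / 2 \<le> B z x"
begin

text \<open>The off-diagonal bounds are summable along each row, which suffices for an \<open>\<ell>\<^sub>1\<close> estimate.
  They depend only on the position \<open>j\<close> and decrease in it, so they persist when the sequences are
  extended or thinned out.\<close>

definition almost_biorthogonal :: "real \<Rightarrow> 'x list \<Rightarrow> 'z list \<Rightarrow> bool" where
  "almost_biorthogonal r xs zs \<longleftrightarrow> length zs = length xs
     \<and> (\<forall>i<length xs. norm (zs ! i) \<le> 1 \<and> r \<le> B (zs ! i) (xs ! i)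
         \<and> (\<forall>j<length xs. j \<noteq> i \<longrightarrow> \<bar>B (zs ! i) (xs ! j)\<bar> \<le> r / 2 ^ (j + 2)))"

text \<open>A combination of the \<open>z\<^sub>i\<close> is tested against the combination of the \<open>x\<^sub>j\<close> whose coefficients
  are the signs of the given ones; the upper \<open>c\<^sub>0\<close> estimate says that this vector has norm at
  most \<open>1\<close>.\<close>

lemma almost_biorthogonal_imp_l1:
  assumes r: "0 < r" and xs: "xs \<in> lp_tree \<infinity> X K" and zs: "set zs \<subseteq> Z"
    and bi: "almost_biorthogonal r xs zs"
  shows "zs \<in> lp_tree 1 Z (2 / r)"
proof -
  let ?n = "length xs"
  have len: "length zs = ?n" and nz: "\<And>i. i < ?n \<Longrightarrow> norm (zs ! i) \<le> 1"
    and diag: "\<And>i. i < ?n \<Longrightarrow> r \<le> B (zs ! i) (xs ! i)"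
    and off: "\<And>i j. i < ?n \<Longrightarrow> j < ?n \<Longrightarrow> j \<noteq> i \<Longrightarrow> \<bar>B (zs ! i) (xs ! j)\<bar> \<le> r / 2 ^ (j + 2)"
    using bi by (auto simp: almost_biorthogonal_def)
  have geo: "(\<Sum>j<m. r / 2 ^ (j + 2)) \<le> r / 2" for m
  proof -
    have "(\<Sum>j<m. r / 2 ^ (j + 2)) = r / 2 - r / 2 ^ (m + 1)"
      by (induction m) (auto simp: field_simps)
    then show ?thesis using r by simp
  qed
  have "inverse (2 / r) \<le> norm (\<Sum>i<?n. a ! i *\<^sub>R zs ! i) \<and> norm (\<Sum>i<?n. a ! i *\<^sub>R zs ! i) \<le> 1"
    if a: "length a = ?n" "lp_norm 1 a = 1" for a
  proof
    have a1: "(\<Sum>i<?n. \<bar>a ! i\<bar>) = 1"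
      using a by (simp add: lp_norm_1)
    have "norm (\<Sum>i<?n. a ! i *\<^sub>R zs ! i) \<le> (\<Sum>i<?n. \<bar>a ! i\<bar>)"
      using nz by (intro sum_norm_le) (simp add: mult_left_le)
    then show "norm (\<Sum>i<?n. a ! i *\<^sub>R zs ! i) \<le> 1" using a1 by simp
    define s :: "nat \<Rightarrow> real" where "s j = (if a ! j \<ge> 0 then 1 else - 1)" for j
    define v where "v = (\<Sum>j<?n. s j *\<^sub>R xs ! j)"
    have s: "\<bar>s j\<bar> = 1" "a ! j * s j = \<bar>a ! j\<bar>" for j
      by (auto simp: s_def)
    have v: "norm v \<le> 1"
      unfolding v_def by (rule lp_tree_infinity_sign_sum_le[OF xs s(1)])
    have row: "\<bar>a ! i\<bar> * (r / 2) \<le> a ! i * B (zs ! i) v" if i: "i < ?n" for i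
    proof -
      let ?b = "B (zs ! i) (xs ! i)"
      define e where "e = (\<Sum>j\<in>{..<?n} - {i}. s j * B (zs ! i) (xs ! j))"
      have "\<bar>e\<bar> \<le> (\<Sum>j\<in>{..<?n} - {i}. \<bar>s j * B (zs ! i) (xs ! j)\<bar>)"
        unfolding e_def by (rule sum_abs)
      also have "\<dots> \<le> (\<Sum>j\<in>{..<?n} - {i}. r / 2 ^ (j + 2))"
        using off[OF i] s(1) by (intro sum_mono) (auto simp: abs_mult)
      also have "\<dots> \<le> (\<Sum>j<?n. r / 2 ^ (j + 2))"
        using r by (intro sum_mono2) auto
      also have "\<dots> \<le> r / 2" by (rule geo)
      finally have e: "\<bar>e\<bar> \<le> r / 2" .
      have "B (zs ! i) v = s i * ?b + e"
        using i by (simp add: v_def e_def add_right sum_right scaleR_right sum.remove[of _ i])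
      then have "a ! i * B (zs ! i) v = \<bar>a ! i\<bar> * ?b + a ! i * e"
        by (simp add: distrib_left mult.assoc[symmetric] s(2))
      moreover have "\<bar>a ! i\<bar> * r \<le> \<bar>a ! i\<bar> * ?b"
        using diag[OF i] by (intro mult_left_mono) auto
      moreover have "\<bar>a ! i * e\<bar> \<le> \<bar>a ! i\<bar> * (r / 2)"
        using e unfolding abs_mult by (intro mult_left_mono) auto
      ultimately show ?thesis by simp
    qed
    have "r / 2 = (\<Sum>i<?n. \<bar>a ! i\<bar> * (r / 2))"
      by (simp only: sum_distrib_right[symmetric] a1)
    also have "\<dots> \<le> (\<Sum>i<?n. a ! i * B (zs ! i) v)"
      using row by (intro sum_mono) auto
    also have "\<dots> = B (\<Sum>i<?n. a ! i *\<^sub>R zs ! i) v"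
      by (simp add: sum_left scaleR_left)
    also have "\<dots> \<le> norm (\<Sum>i<?n. a ! i *\<^sub>R zs ! i) * norm v"
      using le_norm[of "\<Sum>i<?n. a ! i *\<^sub>R zs ! i" v] by linarith
    also have "\<dots> \<le> norm (\<Sum>i<?n. a ! i *\<^sub>R zs ! i)"
      using v by (simp add: mult_left_le)
    finally show "inverse (2 / r) \<le> norm (\<Sum>i<?n. a ! i *\<^sub>R zs ! i)" by simp
  qed
  moreover have "norm z \<le> 1" if "z \<in> set zs" for z
    using that nz len by (auto simp: in_set_conv_nth)
  ultimately show ?thesis
    using zs len by (auto simp: lp_tree_def)
qed

lemma sum_abs_pairing_le:
  assumes ys: "ys \<in> lp_tree \<infinity> X K" and z: "norm z \<le> 1"
  shows "(\<Sum>j<length ys. \<bar>B z (ys ! j)\<bar>) \<le> 1"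
proof -
  define s :: "nat \<Rightarrow> real" where "s j = (if B z (ys ! j) \<ge> 0 then 1 else - 1)" for j
  define v where "v = (\<Sum>j<length ys. s j *\<^sub>R ys ! j)"
  have "norm v \<le> 1"
    unfolding v_def by (rule lp_tree_infinity_sign_sum_le[OF ys]) (simp add: s_def)
  then have "norm z * norm v \<le> 1"
    using z by (simp add: mult_le_one)
  moreover have "B z v = (\<Sum>j<length ys. \<bar>B z (ys ! j)\<bar>)"
    by (auto simp: v_def sum_right scaleR_right s_def intro!: sum.cong)
  ultimately show ?thesis using le_norm[of z v] by linarith
qed

lemma card_large_pairing_le:
  assumes ys: "ys \<in> lp_tree \<infinity> X K" and z: "norm z \<le> 1" and d: "0 < d"
  shows "real (card {j. j < length ys \<and> d < \<bar>B z (ys ! j)\<bar>}) \<le> 1 / d"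
proof -
  let ?A = "{j. j < length ys \<and> d < \<bar>B z (ys ! j)\<bar>}"
  have "real (card ?A) * d = (\<Sum>j\<in>?A. d)" by simp
  also have "\<dots> \<le> (\<Sum>j\<in>?A. \<bar>B z (ys ! j)\<bar>)"
    by (intro sum_mono) auto
  also have "\<dots> \<le> (\<Sum>j<length ys. \<bar>B z (ys ! j)\<bar>)"
    by (intro sum_mono2) auto
  also have "\<dots> \<le> 1" by (rule sum_abs_pairing_le[OF ys z])
  finally show ?thesis using d by (simp add: field_simps)
qed

text \<open>The crucial step. Every \<open>y\<^sub>j\<close> has a functional \<open>w\<^sub>j\<close> bounded below at \<open>y\<^sub>j\<close>. If there are many
  \<open>y\<^sub>j\<close>, then many of the \<open>w\<^sub>j\<close> almost agree on the finitely many given \<open>x\<^sub>i\<close>, and differences of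
  such functionals almost vanish there. Fix one of them, \<open>w\<^sub>m\<close>. As \<open>ys\<close> is dominated by the \<open>c\<^sub>0\<close>
  basis, \<open>w\<^sub>m\<close> and the given \<open>z\<^sub>i\<close> are large at boundedly many \<open>y\<^sub>j\<close> only; at any other \<open>y\<^sub>j\<close> the
  difference \<open>z = w\<^sub>j - w\<^sub>m\<close> will do. The number of \<open>y\<^sub>j\<close> needed depends on the length of \<open>xs\<close>
  only, and not on \<open>xs\<close> or \<open>zs\<close>; the transfer of the tree index relies on this uniformity. Only
  norming functionals enter, so the argument treats dual and predual alike.\<close>

lemma almost_biorthogonal_extend:
  assumes K: "1 < K"
  shows "\<exists>N>0. \<forall>xs zs ys. length xs = k \<longrightarrow> (\<forall>x\<in>set xs. norm x \<le> 1)
      \<longrightarrow> almost_biorthogonal (1 / (8 * K)) xs zs \<longrightarrow> ys \<in> lp_tree \<infinity> X K \<longrightarrow> length ys = N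
      \<longrightarrow> (\<exists>y\<in>set ys. \<exists>z. almost_biorthogonal (1 / (8 * K)) (xs @ [y]) (zs @ [z]))"
proof -
  define r where "r = 1 / (8 * K)"
  define d where "d = r / 2 ^ (k + 2)"
  have r: "0 < r" using K by (simp add: r_def)
  have "(1 :: real) \<le> 2 ^ (k + 2)" by (rule one_le_power) simp
  then have d: "0 < d" "d \<le> r"
    using r by (simp_all add: d_def field_simps del: power_add power_Suc)
  \<comment> \<open>\<open>C\<close> contains the values at \<open>xs\<close>, rounded to multiples of \<open>d\<close>, of all functionals in question, and
    \<open>L\<close> bounds the number of \<open>y\<^sub>j\<close> at which one of \<open>k + 1\<close> functionals exceeds \<open>d\<close>.\<close>
  define M where "M = \<lceil>1 / d\<rceil> + 1"
  define C where "C = {l. set l \<subseteq> {- M .. M} \<and> length l = k}"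
  have finC: "finite C" unfolding C_def by (rule finite_lists_length_eq) simp
  have "0 < 1 / d" using d by simp
  then have "0 < M" unfolding M_def by linarith
  then have neC: "C \<noteq> {}"
    unfolding C_def by (auto intro!: exI[of _ "replicate k 0"] simp: set_replicate_conv_if split: if_splits)
  define L where "L = nat \<lceil>real (k + 1) / d\<rceil>"
  have L: "real (k + 1) / d \<le> real L" unfolding L_def by linarith
  define N where "N = card C * (L + 2)"
  have "0 < N" using finC neC by (simp add: N_def card_gt_0_iff)
  moreover have "\<exists>y\<in>set ys. \<exists>z. almost_biorthogonal r (xs @ [y]) (zs @ [z])"
    if len: "length xs = k" and nx: "\<forall>x\<in>set xs. norm x \<le> 1"
      and bi: "almost_biorthogonal r xs zs" and ys: "ys \<in> lp_tree \<infinity> X K" and N: "length ys = N"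
    for xs zs ys
  proof -
    \<comment> \<open>Norm at most \<open>1 / 2\<close> keeps differences in the unit ball.\<close>
    have "\<exists>w. norm w \<le> 1 / 2 \<and> 2 * r \<le> B w y" if "y \<in> set ys" for y
    proof -
      obtain w where w: "norm w \<le> 1" "norm y / 2 \<le> B w y" using norming by blast
      have "inverse K \<le> norm y" by (rule lp_tree_infinity_norm_ge[OF ys that])
      then have "inverse K \<le> 2 * B w y" using w(2) by simp
      moreover have "inverse K = 8 * r" by (simp add: r_def field_simps)
      ultimately have "2 * r \<le> B ((1 / 2) *\<^sub>R w) y"
        by (simp add: scaleR_left)
      then show ?thesis using w(1) by (intro exI[of _ "(1 / 2) *\<^sub>R w"]) simp
    qed
    then have "\<forall>j. \<exists>w. j < N \<longrightarrow> norm w \<le> 1 / 2 \<and> 2 * r \<le> B w (ys ! j)"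
      using N by auto
    from choice[OF this] obtain w where nw: "\<And>j. j < N \<Longrightarrow> norm (w j) \<le> 1 / 2"
      and w: "\<And>j. j < N \<Longrightarrow> 2 * r \<le> B (w j) (ys ! j)" by blast
    define c where "c j = map (\<lambda>x. \<lfloor>B (w j) x / d\<rfloor>) xs" for j
    have "c \<in> {..<N} \<rightarrow> C"
    proof
      fix j assume "j \<in> {..<N}"
      have "\<lfloor>B (w j) x / d\<rfloor> \<in> {- M .. M}" if "x \<in> set xs" for x
      proof -
        have "norm (w j) * norm x \<le> 1"
          using nw[of j] nx that \<open>j \<in> {..<N}\<close> by (intro mult_le_one) force+
        then have "\<bar>B (w j) x\<bar> \<le> 1" using le_norm[of "w j" x] by linarith
        then have "\<bar>B (w j) x / d\<bar> \<le> 1 / d"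
          using d by (simp add: divide_right_mono)
        then show ?thesis unfolding M_def atLeastAtMost_iff by linarith
      qed
      then show "c j \<in> C" using len by (auto simp: C_def c_def)
    qed
    then obtain l where "card (c -` {l} \<inter> {..<N}) * card C \<ge> card {..<N}"
      using pigeonhole_card[OF _ _ finC neC, of c "{..<N}"] by blast
    then have "card C * (L + 2) \<le> card C * card (c -` {l} \<inter> {..<N})"
      by (simp add: N_def mult.commute)
    then have cl: "L + 2 \<le> card (c -` {l} \<inter> {..<N})"
      using finC neC unfolding mult_le_cancel1 by (simp add: card_gt_0_iff del: One_nat_def)
    then have "c -` {l} \<inter> {..<N} \<noteq> {}" by auto
    then obtain m where m: "m < N" "c m = l" by blast
    define F where "F = insert (w m) (set zs)"
    define bad where "bad f = {j. j < length ys \<and> d < \<bar>B f (ys ! j)\<bar>}" for f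
    have lenz: "length zs = k" and nz: "\<And>z. z \<in> set zs \<Longrightarrow> norm z \<le> 1"
      using bi len by (auto simp: almost_biorthogonal_def in_set_conv_nth)
    have "card F \<le> k + 1"
      unfolding F_def using card_insert_le_m1[of "k + 1" "set zs" "w m"] card_length[of zs] lenz
      by simp
    have "real (card (\<Union>f\<in>F. bad f)) \<le> real (\<Sum>f\<in>F. card (bad f))"
      unfolding F_def by (intro of_nat_mono card_UN_le) simp
    also have "\<dots> \<le> (\<Sum>f\<in>F. 1 / d)"
    proof -
      have "norm f \<le> 1" if "f \<in> F" for f
        using that nz nw[OF m(1)] by (auto simp: F_def)
      then show ?thesis
        unfolding of_nat_sum bad_def
        by (intro sum_mono card_large_pairing_le[OF ys _ d(1)])
    qed
    also have "\<dots> = real (card F) / d" by simp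
    also have "\<dots> \<le> real (k + 1) / d"
      using d \<open>card F \<le> k + 1\<close> by (intro divide_right_mono of_nat_mono) auto
    also note L
    finally have "card (insert m (\<Union>f\<in>F. bad f)) \<le> L + 1"
      using card_insert_le_m1[of "L + 1" "\<Union>f\<in>F. bad f" m] by simp
    then have "\<not> c -` {l} \<inter> {..<N} \<subseteq> insert m (\<Union>f\<in>F. bad f)"
    proof -
      have "finite (insert m (\<Union>f\<in>F. bad f))" by (auto simp: F_def bad_def)
      then show ?thesis
        using cl card_mono[of "insert m (\<Union>f\<in>F. bad f)" "c -` {l} \<inter> {..<N}"]
          \<open>card (insert m (\<Union>f\<in>F. bad f)) \<le> L + 1\<close> by linarith
    qed
    then obtain j where j: "j < N" "c j = l" "\<And>f. f \<in> F \<Longrightarrow> j \<notin> bad f" by blast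
    have small: "\<bar>B f (ys ! j)\<bar> \<le> d" if "f \<in> F" for f
      using j(1) j(3)[OF that] N by (simp add: bad_def)
    define z where "z = w j - w m"
    have "norm z \<le> 1"
      using norm_triangle_ineq4[of "w j" "w m"] nw[OF j(1)] nw[OF m(1)] by (simp add: z_def)
    moreover have "r \<le> B z (ys ! j)"
      using w[OF j(1)] small[of "w m"] d(2) by (simp add: z_def diff_left F_def)
    moreover have "\<bar>B z (xs ! i)\<bar> \<le> r / 2 ^ (i + 2)" if i: "i < k" for i
    proof -
      have "c j ! i = c m ! i" using j m by simp
      then have "\<lfloor>B (w j) (xs ! i) / d\<rfloor> = \<lfloor>B (w m) (xs ! i) / d\<rfloor>"
        using i len by (simp add: c_def)
      then have "\<bar>B (w j) (xs ! i) / d - B (w m) (xs ! i) / d\<bar> \<le> 1" by linarith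
      then have "\<bar>B z (xs ! i)\<bar> \<le> d"
        using d(1) by (simp add: z_def diff_left diff_divide_distrib[symmetric] field_simps)
      also have "d \<le> r / 2 ^ (i + 2)"
        unfolding d_def using i r by (intro divide_left_mono power_increasing) auto
      finally show ?thesis .
    qed
    moreover have "\<bar>B (zs ! i) (ys ! j)\<bar> \<le> r / 2 ^ (k + 2)" if "i < k" for i
      using small[of "zs ! i"] that lenz by (simp add: F_def d_def)
    ultimately have "almost_biorthogonal r (xs @ [ys ! j]) (zs @ [z])"
      using bi len lenz by (auto simp: almost_biorthogonal_def nth_append less_Suc_eq)
    then show ?thesis using j(1) N by (metis nth_mem)
  qed
  ultimately show ?thesis unfolding r_def by blast
qed

lemma almost_biorthogonal_Nil: "almost_biorthogonal r [] []"
  by (simp add: almost_biorthogonal_def)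

end


section \<open>Transfer of the tree index\<close>

context norming_pairing
begin

lemma exists_norm_between:
  fixes x :: 'x
  assumes "x \<noteq> 0"
  shows "\<exists>z :: 'z. 1 / 2 \<le> norm z \<and> norm z \<le> 1"
proof -
  obtain z where z: "norm z \<le> 1" "norm x / 2 \<le> B z x" using norming by blast
  then have "norm x / 2 \<le> norm z * norm x" using le_norm[of z x] by linarith
  then have "1 / 2 \<le> norm z" using assms by (simp add: field_simps)
  with z(1) show ?thesis by blast
qed

lemma almost_biorthogonal_imp_l1':
  assumes K: "1 < K" and xs: "xs \<in> lp_tree \<infinity> X K"
    and bi: "almost_biorthogonal (1 / (8 * K)) xs zs"
  shows "zs \<in> lp_tree 1 UNIV (16 * K)"
proof -
  have "0 < 1 / (8 * K)" and eq: "2 / (1 / (8 * K)) = 16 * K" using K by simp_all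
  from almost_biorthogonal_imp_l1[OF this(1) xs subset_UNIV bi] show ?thesis
    unfolding eq .
qed

text \<open>Choosing one more functional costs a bounded number of terms of the branch, so reaching
  level \<open>\<beta>\<close> of the \<open>\<ell>\<^sub>1\<close> tree takes finitely many derivations beyond \<open>\<beta>\<close>. The finite excess \<open>m\<close>
  depends on \<open>\<beta>\<close> and on the number of functionals already chosen, but not on the node. At a limit
  ordinal no excess is needed: a node that survives up to \<open>\<beta>\<close> survives to \<open>\<gamma> + m\<close> for all
  \<open>\<gamma> < \<beta>\<close> and all finite \<open>m\<close>.\<close>

lemma iter_deriv_lp_tree_transfer:
  fixes X :: "'x set" and \<beta> :: "'o ordinal"
  assumes K: "1 < K"
  shows "\<exists>m. (olimit \<beta> \<longrightarrow> m = 0) \<and> (\<forall>t xs zs. length xs = k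
      \<longrightarrow> t \<in> iter_deriv tree_deriv (lp_tree \<infinity> X K) ((osucc ^^ m) \<beta>) \<longrightarrow> subseq xs t
      \<longrightarrow> almost_biorthogonal (1 / (8 * K)) xs zs
      \<longrightarrow> zs \<in> iter_deriv tree_deriv (lp_tree 1 UNIV (16 * K)) \<beta>)"
proof -
  let ?T = "lp_tree \<infinity> X K" and ?S = "lp_tree 1 (UNIV :: 'z set) (16 * K)"
  define P where "P k \<beta> m \<longleftrightarrow> (\<forall>t xs zs. length xs = k
      \<longrightarrow> t \<in> iter_deriv tree_deriv ?T ((osucc ^^ m) \<beta>) \<longrightarrow> subseq xs t
      \<longrightarrow> almost_biorthogonal (1 / (8 * K)) xs zs \<longrightarrow> zs \<in> iter_deriv tree_deriv ?S \<beta>)"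
    for k and \<beta> :: "'o ordinal" and m
  have PI: "P k \<beta> m"
    if "\<And>t xs zs. \<lbrakk>length xs = k; t \<in> iter_deriv tree_deriv ?T ((osucc ^^ m) \<beta>); subseq xs t;
      almost_biorthogonal (1 / (8 * K)) xs zs\<rbrakk> \<Longrightarrow> zs \<in> iter_deriv tree_deriv ?S \<beta>"
    for k \<beta> m
    unfolding P_def
  proof (intro allI impI)
    fix t xs zs
    assume "length xs = k" "t \<in> iter_deriv tree_deriv ?T ((osucc ^^ m) \<beta>)" "subseq xs t"
      "almost_biorthogonal (1 / (8 * K)) xs zs"
    then show "zs \<in> iter_deriv tree_deriv ?S \<beta>" by (rule that)
  qed
  have PD: "zs \<in> iter_deriv tree_deriv ?S \<beta>"
    if "P k \<beta> m" "length xs = k" "t \<in> iter_deriv tree_deriv ?T ((osucc ^^ m) \<beta>)" "subseq xs t"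
      "almost_biorthogonal (1 / (8 * K)) xs zs" for k \<beta> m t xs zs
    by (rule that(1)[unfolded P_def, rule_format, OF that(2-5)])
  have "\<exists>m. (olimit \<beta> \<longrightarrow> m = 0) \<and> P k \<beta> m"
  proof (induction \<beta> arbitrary: k rule: ordinal_induct)
    case zero
    have "P k ozero 0"
    proof (rule PI)
      fix t xs zs
      assume t: "t \<in> iter_deriv tree_deriv ?T ((osucc ^^ 0) ozero)" "subseq xs t"
        and bi: "almost_biorthogonal (1 / (8 * K)) xs zs"
      have "xs \<in> ?T"
        using t lp_tree_infinity_subseq unfolding funpow.simps id_apply iter_deriv_zero by blast
      then show "zs \<in> iter_deriv tree_deriv ?S ozero"
        unfolding iter_deriv_zero by (rule almost_biorthogonal_imp_l1'[OF K _ bi])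
    qed
    then show ?case by blast
  next
    case (succ \<beta>)
    then obtain m where m: "P (Suc k) \<beta> m" by blast
    obtain N where N: "N > 0" and ext: "\<And>xs zs ys. length xs = k \<Longrightarrow> \<forall>x\<in>set xs. norm x \<le> 1
        \<Longrightarrow> almost_biorthogonal (1 / (8 * K)) xs zs \<Longrightarrow> ys \<in> ?T \<Longrightarrow> length ys = N
        \<Longrightarrow> \<exists>y\<in>set ys. \<exists>z. almost_biorthogonal (1 / (8 * K)) (xs @ [y]) (zs @ [z])"
      using almost_biorthogonal_extend[OF K, of k X] by metis
    have "P k (osucc \<beta>) (N + m)"
    proof (rule PI)
      fix t xs zs
      assume len: "length xs = k" and sub: "subseq xs t"
        and t: "t \<in> iter_deriv tree_deriv ?T ((osucc ^^ (N + m)) (osucc \<beta>))"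
        and bi: "almost_biorthogonal (1 / (8 * K)) xs zs"
      have "(osucc ^^ (N + m)) (osucc \<beta>) = (osucc ^^ Suc N) ((osucc ^^ m) \<beta>)"
        by (simp only: funpow_swap1[symmetric] funpow_add o_apply funpow.simps)
      with t obtain ys0 where ys0: "length ys0 = Suc N"
        "t @ ys0 \<in> iter_deriv tree_deriv ?T ((osucc ^^ m) \<beta>)"
        using iter_deriv_funpow_extend[OF prefix_closed_lp_tree_infinity] by metis
      \<comment> \<open>\<open>osucc \<beta>\<close> supplies one term more than the choice of the next functional needs.\<close>
      define ys where "ys = take N ys0"
      have ys: "length ys = N" "t @ ys \<in> iter_deriv tree_deriv ?T ((osucc ^^ m) \<beta>)"
        using ys0 prefix_closedD[OF prefix_closed_iter_deriv[OF prefix_closed_lp_tree_infinity] ys0(2), of "t @ ys"]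
        by (simp_all add: ys_def take_is_prefix)
      have "t @ ys \<in> ?T"
        using ys(2) iter_deriv_subset[OF tree_deriv_subset] by (rule subsetD[rotated])
      then have "ys \<in> ?T" "xs \<in> ?T"
        using sub by (auto intro: lp_tree_infinity_subseq subseq_drop_many subseq_rev_drop_many)
      moreover from this(2) have "\<forall>x\<in>set xs. norm x \<le> 1"
        using lp_tree_norm_le by blast
      ultimately obtain y z where y: "y \<in> set ys"
        and z: "almost_biorthogonal (1 / (8 * K)) (xs @ [y]) (zs @ [z])"
        using ext[OF len _ bi _ ys(1)] by blast
      have "subseq (xs @ [y]) (t @ ys)"
        using sub y by (simp add: list_emb_append_mono subseq_singleton_left)
      then have "zs @ [z] \<in> iter_deriv tree_deriv ?S \<beta>"
        using len by (intro PD[OF m _ ys(2) _ z]) simp_all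
      then show "zs \<in> iter_deriv tree_deriv ?S (osucc \<beta>)"
        unfolding iter_deriv_osucc
          tree_deriv_prefix_closed_iff[OF prefix_closed_iter_deriv[OF prefix_closed_lp_tree_1]]
        by blast
    qed
    moreover have "\<not> olimit (osucc \<beta>)" unfolding olimit_def by blast
    ultimately show ?case by blast
  next
    case (limit \<nu>)
    have "P k \<nu> 0"
    proof (rule PI)
      fix t xs zs
      assume len: "length xs = k" and sub: "subseq xs t"
        and bi: "almost_biorthogonal (1 / (8 * K)) xs zs"
        and t: "t \<in> iter_deriv tree_deriv ?T ((osucc ^^ 0) \<nu>)"
      have "zs \<in> iter_deriv tree_deriv ?S \<beta>" if \<beta>: "\<beta> < \<nu>" for \<beta>
      proof -
        obtain m where m: "P k \<beta> m" using limit(2)[OF \<beta>] by blast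
        have "t \<in> iter_deriv tree_deriv ?T ((osucc ^^ m) \<beta>)"
          using t osucc_funpow_less_olimit[OF limit(1) \<beta>, of m]
          by (simp add: iter_deriv_olimit[OF limit(1)])
        then show ?thesis by (rule PD[OF m len _ sub bi])
      qed
      then show "zs \<in> iter_deriv tree_deriv ?S \<nu>"
        by (simp add: iter_deriv_olimit[OF limit(1)])
    qed
    then show ?case by blast
  qed
  then show ?thesis by (simp only: P_def)
qed

text \<open>The case \<open>\<xi> = 0\<close> is separate because \<open>\<omega>\<^sup>0\<close> is not a limit ordinal; it only says that the space
  is non-trivial.\<close>

lemma index_I_transfer:
  assumes K: "1 < K" and I: "index_I \<infinity> (UNIV :: 'x set) K > Fin (opow omega (\<xi> :: 'o ordinal))"
  shows "index_I 1 (UNIV :: 'z set) (16 * K) > Fin (opow omega \<xi>)"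
proof -
  let ?T = "lp_tree \<infinity> (UNIV :: 'x set) K" and ?S = "lp_tree 1 (UNIV :: 'z set) (16 * K)"
  have T: "iter_deriv tree_deriv ?T (opow omega \<xi>) \<noteq> {}"
    using I unfolding index_I_def by (rule deriv_index_greaterD) simp
  show ?thesis
    unfolding index_I_def
  proof (rule deriv_index_greaterI)
    fix \<zeta> assume \<zeta>: "\<zeta> \<le> opow omega \<xi>"
    show "iter_deriv tree_deriv ?S \<zeta> \<noteq> {}"
    proof (cases "\<xi> = ozero")
      case True
      then have "tree_deriv ?T \<noteq> {}"
        using T by (simp add: opow_zero iter_deriv_osucc iter_deriv_zero)
      then obtain t s where "s \<in> ?T" "strict_prefix t s"
        by (auto simp: tree_deriv_iff)
      moreover from this(2) have "s \<noteq> []" by auto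
      ultimately obtain x where "x \<in> set s" "inverse K \<le> norm x"
        using lp_tree_infinity_norm_ge by (metis list.set_sel(1))
      then have "x \<noteq> 0" using K by auto
      then obtain z :: 'z where "1 / 2 \<le> norm z" "norm z \<le> 1"
        using exists_norm_between by blast
      moreover have "inverse (16 * K) \<le> 1 / 2" using K by (simp add: field_simps)
      ultimately have "[z] \<in> ?S"
        by (intro singleton_in_lp_tree_1) auto
      then have "[] \<in> tree_deriv ?S"
        by (subst tree_deriv_prefix_closed_iff[OF prefix_closed_lp_tree_1]) auto
      moreover have "\<zeta> = ozero \<or> \<zeta> = osucc ozero"
      proof -
        have "\<zeta> \<le> osucc ozero" using \<zeta> True by (simp add: opow_zero)
        then show ?thesis
          using less_osucc_iff[of \<zeta> ozero] ozero_le[of \<zeta>] by (auto simp: order_le_less)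
      qed
      ultimately show ?thesis
        using Nil_in_lp_tree[of 1 "UNIV :: 'z set" "16 * K"]
        by (auto simp: iter_deriv_osucc iter_deriv_zero)
    next
      case False
      then have lim: "olimit (opow omega \<xi>)" by (rule olimit_opow_omega)
      obtain t where t: "t \<in> iter_deriv tree_deriv ?T (opow omega \<xi>)" using T by blast
      have "[] \<in> iter_deriv tree_deriv ?S (opow omega \<xi>)"
        using iter_deriv_lp_tree_transfer[OF K, of "opow omega \<xi>" 0 UNIV] lim t
          almost_biorthogonal_Nil by auto
      then have "[] \<in> iter_deriv tree_deriv ?S \<zeta>"
        using \<zeta> by (cases "\<zeta> = opow omega \<xi>") (auto simp: iter_deriv_olimit[OF lim])
      then show ?thesis by blast
    qed
  qed
qed

lemma class_P1_transfer:
  assumes "class_P1 \<xi> \<infinity> (UNIV :: 'x set)" "banach_carrier (UNIV :: 'z set)"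
  shows "class_P1 \<xi> 1 (UNIV :: 'z set)"
proof -
  obtain K where K: "1 < K" "index_I \<infinity> (UNIV :: 'x set) K > Fin (opow omega \<xi>)"
    using assms(1) by (auto simp: class_P1_def)
  have "(1 :: real) < 16 * K" using K(1) by simp
  then show ?thesis
    using index_I_transfer[OF K] assms(2) unfolding class_P1_def by blast
qed

end


section \<open>Schreier families\<close>

lemma schreier_system_osucc:
  fixes \<S> :: "'o ordinal \<Rightarrow> nat set set"
  assumes "schreier_system \<S>" "\<zeta> < omega1"
  shows "\<S> (osucc \<zeta>) = family_compose schreier (\<S> \<zeta>)"
proof -
  have "\<forall>\<xi><omega1. \<S> (osucc \<xi>) = family_compose schreier (\<S> \<xi>)"
    using assms(1) unfolding schreier_system_def by (elim conjE)
  then show ?thesis using assms(2) by (elim allE impE)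
qed

lemma schreier_system_olimit:
  fixes \<S> :: "'o ordinal \<Rightarrow> nat set set"
  assumes "schreier_system \<S>" "\<nu> < omega1" "olimit \<nu>"
  obtains s :: "nat \<Rightarrow> 'o ordinal" where "\<forall>n\<ge>1. s n < \<nu>"
    "\<S> \<nu> = insert {} {A. A \<noteq> {} \<and> (\<exists>n\<ge>1. n \<le> Min A \<and> A \<in> \<S> (osucc (s n)))}"
proof -
  have "\<forall>\<xi><omega1. olimit \<xi> \<longrightarrow> (\<exists>s :: nat \<Rightarrow> 'o ordinal.
      strict_mono_on {1..} s \<and> (\<forall>n\<ge>1. s n < \<xi>) \<and> (\<forall>\<zeta><\<xi>. \<exists>n\<ge>1. \<zeta> < s n)
      \<and> (\<forall>n\<ge>1. \<S> (osucc (s n)) \<subseteq> \<S> (s (Suc n)))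
      \<and> \<S> \<xi> = insert {} {A. A \<noteq> {} \<and> (\<exists>n\<ge>1. n \<le> Min A \<and> A \<in> \<S> (osucc (s n)))})"
    using assms(1) unfolding schreier_system_def by (elim conjE)
  from this[THEN spec, THEN mp, THEN mp, OF assms(2,3)] obtain s :: "nat \<Rightarrow> 'o ordinal"
    where s: "\<forall>n\<ge>1. s n < \<nu>"
      and eq: "\<S> \<nu> = insert {} {A. A \<noteq> {} \<and> (\<exists>n\<ge>1. n \<le> Min A \<and> A \<in> \<S> (osucc (s n)))}"
    by (elim exE conjE)
  show thesis
    by (rule that[OF s eq])
qed

lemma schreier_induct [consumes 2, case_names zero compose limit finite]:
  fixes \<S> :: "'o ordinal \<Rightarrow> nat set set"
  assumes S: "schreier_system \<S>" and "\<xi> \<le> omega1"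
    and zero: "P {A. finite A \<and> A \<subseteq> {1..} \<and> card A \<le> 1}"
    and compose: "\<And>\<F>. P \<F> \<Longrightarrow> P (family_compose schreier \<F>)"
    and limit: "\<And>F. (\<And>n. 1 \<le> n \<Longrightarrow> P (F n))
      \<Longrightarrow> P (insert {} {A. A \<noteq> {} \<and> (\<exists>n\<ge>1. n \<le> Min A \<and> A \<in> F n)})"
    and fin: "P {A. finite A \<and> A \<subseteq> {1..}}"
  shows "P (\<S> \<xi>)"
proof (cases "\<xi> = omega1")
  case True
  then show ?thesis using S fin by (simp add: schreier_system_def)
next
  case False
  then have "\<xi> < omega1" using assms(2) by simp
  then show ?thesis
  proof (induction \<xi> rule: ordinal_induct)
    case zero
    then show ?case using S \<open>P {A. finite A \<and> A \<subseteq> {1..} \<and> card A \<le> 1}\<close>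
      by (simp add: schreier_system_def)
  next
    case (succ \<zeta>)
    then have "\<zeta> < omega1" using ordinal_less_osucc order.strict_trans by metis
    then show ?case
      using compose[OF succ.IH] schreier_system_osucc[OF S] by simp
  next
    case l: (limit \<nu>)
    obtain s where s: "\<forall>n\<ge>1. s n < \<nu>"
      and eq: "\<S> \<nu> = insert {} {A. A \<noteq> {} \<and> (\<exists>n\<ge>1. n \<le> Min A \<and> A \<in> \<S> (osucc (s n)))}"
      by (rule schreier_system_olimit[OF S l(3,1)])
    have "P (\<S> (osucc (s n)))" if "1 \<le> n" for n
    proof -
      have *: "osucc (s n) < \<nu>"
        using s that by (intro osucc_less_olimit[OF l(1)]) blast
      show ?thesis by (rule l(2)[OF * order.strict_trans[OF * l(3)]])
    qed
    then show ?case unfolding eq by (rule limit)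
  qed
qed

lemma schreier_spread:
  assumes "A \<in> schreier" "strict_mono \<phi>"
  shows "\<phi> ` A \<in> schreier"
proof (cases "A = {}")
  case False
  then have A: "finite A" "A \<subseteq> {1..}" "card A \<le> Min A"
    using assms(1) by (auto simp: schreier_def)
  have ge: "n \<le> \<phi> n" for n by (rule strict_mono_imp_increasing[OF assms(2)])
  have "card (\<phi> ` A) = card A"
    using assms(2) by (intro card_image) (meson inj_on_subset strict_mono_imp_inj_on subset_UNIV)
  also have "\<dots> \<le> \<phi> (Min A)" using A(3) ge order_trans by blast
  also have "\<dots> = Min (\<phi> ` A)"
    by (rule mono_Min_commute[OF strict_mono_mono[OF assms(2)] A(1) False])
  finally have "card (\<phi> ` A) \<le> Min (\<phi> ` A)" .
  moreover have "\<phi> ` A \<subseteq> {1..}"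
    using A(2) ge by (auto intro: order_trans)
  ultimately show ?thesis using A(1) False by (simp add: schreier_def)
qed (simp add: schreier_def)

text \<open>Spreading is what allows passing to subsequences of spreading models.\<close>

lemma schreier_system_spread:
  assumes "schreier_system \<S>" "\<xi> \<le> omega1" and \<phi>: "strict_mono \<phi>"
  shows "\<forall>A\<in>\<S> \<xi>. finite A \<and> A \<subseteq> {1..} \<and> \<phi> ` A \<in> \<S> \<xi>"
  using assms(1,2)
proof (induction rule: schreier_induct)
  case zero
  have "n \<le> \<phi> n" for n by (rule strict_mono_imp_increasing[OF \<phi>])
  then show ?case
    by (auto intro: order_trans card_image_le)
next
  case (compose \<F>)
  have mono: "mono \<phi>" by (rule strict_mono_mono[OF \<phi>])
  show ?case
  proof
    fix A assume A: "A \<in> family_compose schreier \<F>"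
    show "finite A \<and> A \<subseteq> {1..} \<and> \<phi> ` A \<in> family_compose schreier \<F>"
    proof (cases "A = {}")
      case False
      then obtain Es where A: "A = \<Union> (set Es)" and Es: "\<And>E. E \<in> set Es \<Longrightarrow> E \<noteq> {} \<and> E \<in> \<F>"
        and succ: "successively (\<lambda>A B. Max A < Min B) Es" and min: "Min ` set Es \<in> schreier"
        using A unfolding family_compose_def by blast
      have fin: "finite E" if "E \<in> set Es" for E using compose Es[OF that] by blast
      have "A \<subseteq> {1..}" using compose Es unfolding A by blast
      let ?Fs = "map ((`) \<phi>) Es"
      have "successively (\<lambda>A B. Max A < Min B) ?Fs"
        unfolding successively_map
      proof (rule successively_mono[OF succ])
        fix E F assume EF: "E \<in> set Es" "F \<in> set Es" "Max E < Min F"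
        then have "\<phi> (Max E) < \<phi> (Min F)" using \<phi> by (simp add: strict_mono_def)
        then show "Max (\<phi> ` E) < Min (\<phi> ` F)"
          using mono_Max_commute[OF mono fin[OF EF(1)]] mono_Min_commute[OF mono fin[OF EF(2)]]
            Es EF by metis
      qed
      moreover have "Min ` set ?Fs = \<phi> ` Min ` set Es"
        using mono_Min_commute[OF mono fin] Es by (auto simp: image_image intro!: image_cong)
      then have "Min ` set ?Fs \<in> schreier"
        using schreier_spread[OF min \<phi>] by simp
      moreover have "\<forall>E\<in>set ?Fs. E \<noteq> {} \<and> E \<in> \<F>"
        using compose Es by auto
      moreover have "\<phi> ` A = \<Union> (set ?Fs)" by (simp add: A image_Union)
      ultimately have "\<phi> ` A \<in> family_compose schreier \<F>"
        unfolding family_compose_def by blast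
      then show ?thesis using \<open>A \<subseteq> {1..}\<close> fin by (auto simp: A)
    qed (simp add: family_compose_def)
  qed
next
  case (limit F)
  show ?case
  proof (rule ballI)
    fix A assume "A \<in> insert {} {A. A \<noteq> {} \<and> (\<exists>n\<ge>1. n \<le> Min A \<and> A \<in> F n)}"
    then consider "A = {}" | n where "A \<noteq> {}" "1 \<le> n" "n \<le> Min A" "A \<in> F n" by blast
    then show "finite A \<and> A \<subseteq> {1..}
      \<and> \<phi> ` A \<in> insert {} {A. A \<noteq> {} \<and> (\<exists>n\<ge>1. n \<le> Min A \<and> A \<in> F n)}"
    proof cases
      case 2
      then have A: "finite A" "A \<subseteq> {1..}" "\<phi> ` A \<in> F n" using limit by blast+
      have "n \<le> \<phi> (Min A)" using 2(3) strict_mono_imp_increasing[OF \<phi>] order_trans by blast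
      then have "n \<le> Min (\<phi> ` A)"
        using mono_Min_commute[OF strict_mono_mono[OF \<phi>] A(1) 2(1)] by simp
      then show ?thesis using A 2 by blast
    qed simp
  qed
next
  case finite
  have "n \<le> \<phi> n" for n by (rule strict_mono_imp_increasing[OF \<phi>])
  then show ?case by (auto intro: order_trans)
qed

lemma subset_family_compose_schreier:
  assumes "A \<in> \<F>" "A \<noteq> {}" "finite A" "A \<subseteq> {1..}"
  shows "A \<in> family_compose schreier \<F>"
proof -
  have "Min A \<in> {1..}" using assms Min_in by blast
  then have "Min ` set [A] \<in> schreier" by (simp add: schreier_def)
  then show ?thesis
    using assms unfolding family_compose_def
    by (intro insertI2 CollectI exI[of _ "[A]"]) simp
qed

lemma schreier_system_singleton:
  assumes "schreier_system \<S>" "\<xi> \<le> omega1"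
  shows "\<forall>n\<ge>1. {n} \<in> \<S> \<xi>"
  using assms
proof (induction rule: schreier_induct)
  case (compose \<F>)
  then show ?case by (auto intro!: subset_family_compose_schreier)
qed (auto intro!: exI[of _ "Suc 0"])

lemma schreier_system_interval:
  assumes S: "schreier_system \<S>" and "\<xi> \<le> omega1" "\<xi> \<noteq> ozero" and MN: "1 \<le> N" "N \<le> M"
  shows "{M..<M + N} \<in> \<S> \<xi>"
  using assms(2,3)
proof (induction \<xi> rule: ordinal_induct)
  case (succ \<zeta>)
  let ?Es = "map (\<lambda>n. {n}) [M..<M + N]"
  have less: "\<zeta> < omega1" using succ.prems(1) by (simp add: osucc_le_iff)
  have Es: "\<forall>E\<in>set ?Es. E \<noteq> {} \<and> E \<in> \<S> \<zeta>"
    using schreier_system_singleton[OF S less_imp_le[OF less]] MN by auto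
  have succ: "successively (\<lambda>A B. Max A < Min B) ?Es"
    unfolding successively_map by (rule successively_if_sorted_wrt) simp
  have "Min {M..<M + N} = M" using MN by (intro Min_eqI) auto
  then have "{M..<M + N} \<in> schreier" using MN by (auto simp: schreier_def)
  moreover have "Min ` set ?Es = {M..<M + N}" by (auto simp: image_image)
  ultimately have "Min ` set ?Es \<in> schreier" by simp
  with Es succ have "\<Union> (set ?Es) \<in> family_compose schreier (\<S> \<zeta>)"
    unfolding family_compose_def by (intro insertI2 CollectI exI[of _ ?Es] conjI refl)
  moreover have "\<Union> (set ?Es) = {M..<M + N}" by auto
  ultimately have "{M..<M + N} \<in> family_compose schreier (\<S> \<zeta>)" by (simp only:)
  then show ?case using schreier_system_osucc[OF S less] by simp
next
  case (limit \<nu>)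
  show ?case
  proof (cases "\<nu> = omega1")
    case True
    then show ?thesis using S MN by (auto simp: schreier_system_def)
  next
    case False
    then have "\<nu> < omega1" using limit.prems by simp
    then obtain s where s: "\<forall>n\<ge>1. s n < \<nu>"
      and eq: "\<S> \<nu> = insert {} {A. A \<noteq> {} \<and> (\<exists>n\<ge>1. n \<le> Min A \<and> A \<in> \<S> (osucc (s n)))}"
      by (rule schreier_system_olimit[OF S _ limit(1)])
    have less: "osucc (s 1) < \<nu>" using s by (intro osucc_less_olimit[OF limit(1)]) blast
    then have "{M..<M + N} \<in> \<S> (osucc (s 1))"
      using limit(2)[OF less] limit.prems(1) by simp
    moreover have "1 \<le> Min {M..<M + N}" using MN by auto
    ultimately show ?thesis using MN unfolding eq by auto
  qed
qed simp


section \<open>Transfer of spreading models\<close>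

lemma map_sorted_list_of_set_image:
  assumes "strict_mono \<phi>" "finite (A :: nat set)"
  shows "sorted_list_of_set (\<phi> ` A) = map \<phi> (sorted_list_of_set A)"
proof (rule sorted_distinct_set_unique)
  show "sorted (map \<phi> (sorted_list_of_set A))"
    using assms(1) by (auto simp: sorted_map strict_mono_less_eq intro: sorted_wrt_mono_rel)
  show "distinct (map \<phi> (sorted_list_of_set A))"
    using assms(1) by (simp add: distinct_map strict_mono_imp_inj_on inj_on_subset)
qed (use assms in simp_all)

context norming_pairing
begin

lemma almost_biorthogonal_extend_spreading_model:
  fixes x :: "nat \<Rightarrow> 'x"
  assumes K: "1 < K" and S: "schreier_system \<S>" and \<xi>: "\<xi> \<le> omega1" "\<xi> \<noteq> ozero"
    and x: "spreading_model \<S> \<infinity> \<xi> UNIV K x"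
    and ns: "set ns \<subseteq> {1..}" and bi: "almost_biorthogonal (1 / (8 * K)) (map x ns) zs"
  shows "\<exists>n z. 1 \<le> n \<and> (\<forall>m\<in>set ns. m < n)
    \<and> almost_biorthogonal (1 / (8 * K)) (map x (ns @ [n])) (zs @ [z])"
proof -
  obtain N where N: "N > 0" and ext: "\<And>xs zs ys. length xs = length ns \<Longrightarrow> \<forall>x\<in>set xs. norm x \<le> 1
      \<Longrightarrow> almost_biorthogonal (1 / (8 * K)) xs zs \<Longrightarrow> ys \<in> lp_tree \<infinity> UNIV K \<Longrightarrow> length ys = N
      \<Longrightarrow> \<exists>y\<in>set ys. \<exists>z. almost_biorthogonal (1 / (8 * K)) (xs @ [y]) (zs @ [z])"
    using almost_biorthogonal_extend[OF K, of "length ns" UNIV] by metis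
  define M where "M = N + Suc (sum_list ns)"
  have "\<forall>y\<in>set (map x ns). norm y \<le> 1"
  proof
    fix y assume "y \<in> set (map x ns)"
    then obtain n where n: "1 \<le> n" "y = x n" using ns by auto
    then have "map x (sorted_list_of_set {n}) \<in> lp_tree \<infinity> UNIV K"
      using x schreier_system_singleton[OF S \<xi>(1)] unfolding spreading_model_def by blast
    then show "norm y \<le> 1" using n by (auto intro: lp_tree_norm_le)
  qed
  moreover have "map x [M..<M + N] \<in> lp_tree \<infinity> UNIV K"
  proof -
    have "{M..<M + N} \<in> \<S> \<xi>"
      using N by (intro schreier_system_interval[OF S \<xi>]) (auto simp: M_def)
    then have "map x (sorted_list_of_set {M..<M + N}) \<in> lp_tree \<infinity> UNIV K"
      using x unfolding spreading_model_def by blast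
    then show ?thesis by simp
  qed
  ultimately obtain y z where "y \<in> set (map x [M..<M + N])"
    and z: "almost_biorthogonal (1 / (8 * K)) (map x ns @ [y]) (zs @ [z])"
    using ext[OF _ _ bi, of "map x [M..<M + N]"] by auto
  then obtain n where n: "M \<le> n" "y = x n" by auto
  have "m < n" if "m \<in> set ns" for m
    using member_le_sum_list[OF that] n(1) by (simp add: M_def)
  then show ?thesis
    using n z by (intro exI[of _ n] exI[of _ z]) (auto simp: M_def)
qed

text \<open>Unlike in the tree, the functionals have to be chosen along one sequence. The intervals in the
  Schreier family supply the long \<open>c\<^sub>0\<close> sequences needed in each step, although the initial segments
  of the resulting subsequence are not themselves \<open>c\<^sub>0\<close> sequences.\<close>

lemma spreading_model_biorthogonal_subsequence:
  fixes x :: "nat \<Rightarrow> 'x"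
  assumes K: "1 < K" and S: "schreier_system \<S>" and \<xi>: "\<xi> \<le> omega1" "\<xi> \<noteq> ozero"
    and x: "spreading_model \<S> \<infinity> \<xi> UNIV K x"
  obtains \<phi> z where "strict_mono \<phi>"
    "\<And>k. almost_biorthogonal (1 / (8 * K)) (map (x \<circ> \<phi>) [0..<k]) (map z [0..<k])"
proof -
  define P where "P k s \<longleftrightarrow> length (fst s) = k \<and> set (fst s) \<subseteq> {1..} \<and> sorted_wrt (<) (fst s)
    \<and> almost_biorthogonal (1 / (8 * K)) (map x (fst s)) (snd s)"
    for k :: nat and s :: "nat list \<times> 'z list"
  define Q where "Q s s' \<longleftrightarrow> (\<exists>n z. s' = (fst s @ [n], snd s @ [z]))"
    for s s' :: "nat list \<times> 'z list"
  have step: "\<exists>s'. P (Suc k) s' \<and> Q s s'" if s: "P k s" for k s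
  proof -
    obtain n z where "1 \<le> n" "\<forall>m\<in>set (fst s). m < n"
      "almost_biorthogonal (1 / (8 * K)) (map x (fst s @ [n])) (snd s @ [z])"
      using almost_biorthogonal_extend_spreading_model[OF K S \<xi> x, of "fst s" "snd s"] s
      unfolding P_def by blast
    then have "P (Suc k) (fst s @ [n], snd s @ [z])"
      using s by (auto simp: P_def sorted_wrt_append)
    then show ?thesis by (auto simp: Q_def)
  qed
  have "\<exists>s. P 0 s"
    by (intro exI[of _ "([], [])"]) (simp add: P_def almost_biorthogonal_Nil)
  then obtain f where f: "\<And>k. P k (f k)" "\<And>k. Q (f k) (f (Suc k))"
    using dependent_nat_choice[of P "\<lambda>_. Q"] step by metis
  define \<phi> where "\<phi> k = last (fst (f (Suc k)))" for k
  define z where "z k = last (snd (f (Suc k)))" for k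
  have f_eq: "f k = (map \<phi> [0..<k], map z [0..<k])" for k
  proof (induction k)
    case 0
    show ?case using f(1)[of 0] by (auto simp: P_def almost_biorthogonal_def prod_eq_iff)
  next
    case (Suc k)
    then show ?case using f(2)[of k] by (auto simp: Q_def \<phi>_def z_def)
  qed
  have "\<phi> k < \<phi> (Suc k)" for k
    using f(1)[of "Suc (Suc k)"] by (auto simp: P_def f_eq sorted_wrt_append)
  then have "strict_mono \<phi>" by (simp add: strict_mono_Suc_iff)
  moreover have "almost_biorthogonal (1 / (8 * K)) (map (x \<circ> \<phi>) [0..<k]) (map z [0..<k])" for k
    using f(1)[of k] by (simp add: P_def f_eq)
  ultimately show thesis by (rule that)
qed

lemma spreading_model_transfer:
  fixes x :: "nat \<Rightarrow> 'x"
  assumes K: "1 < K" and S: "schreier_system \<S>" and \<xi>: "\<xi> \<le> omega1"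
    and x: "spreading_model \<S> \<infinity> \<xi> UNIV K x"
  shows "\<exists>z. spreading_model \<S> 1 \<xi> (UNIV :: 'z set) (16 * K) z"
proof (cases "\<xi> = ozero")
  case True
  have "map x (sorted_list_of_set {1}) \<in> lp_tree \<infinity> UNIV K"
    using x schreier_system_singleton[OF S \<xi>] unfolding spreading_model_def by blast
  then have "inverse K \<le> norm (x 1)" by (auto intro: lp_tree_infinity_norm_ge)
  then have "x 1 \<noteq> 0" using K by auto
  then obtain w :: 'z where w: "1 / 2 \<le> norm w" "norm w \<le> 1"
    using exists_norm_between by blast
  have "map (\<lambda>_. w) (sorted_list_of_set A) \<in> lp_tree 1 UNIV (16 * K)" if "A \<in> \<S> \<xi>" for A
  proof -
    have "finite A" "card A \<le> 1"
      using that S True by (auto simp: schreier_system_def)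
    then have "A = {} \<or> (\<exists>n. A = {n})"
      by (metis card_0_eq card_1_singletonE le_zero_eq less_one nat_less_le)
    moreover have "inverse (16 * K) \<le> 1 / 2" using K by (simp add: field_simps)
    then have "[w] \<in> lp_tree 1 UNIV (16 * K)"
      using w by (intro singleton_in_lp_tree_1) auto
    ultimately show ?thesis using Nil_in_lp_tree by auto
  qed
  then show ?thesis by (intro exI[of _ "\<lambda>_. w"]) (simp add: spreading_model_def)
next
  case False
  obtain \<phi> z where \<phi>: "strict_mono \<phi>"
    and bi: "\<And>k. almost_biorthogonal (1 / (8 * K)) (map (x \<circ> \<phi>) [0..<k]) (map z [0..<k])"
    using spreading_model_biorthogonal_subsequence[OF K S \<xi> False x] by blast
  have diag: "norm (z i) \<le> 1 \<and> 1 / (8 * K) \<le> B (z i) (x (\<phi> i))" for i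
    using bi[of "Suc i"] by (auto simp: almost_biorthogonal_def simp del: upt_Suc)
  have off: "\<bar>B (z i) (x (\<phi> j))\<bar> \<le> 1 / (8 * K) / 2 ^ (j + 2)" if "j \<noteq> i" for i j
    using bi[of "Suc (max i j)"] that
    by (auto simp: almost_biorthogonal_def simp del: upt_Suc)
  have "map z (sorted_list_of_set A) \<in> lp_tree 1 UNIV (16 * K)" if A: "A \<in> \<S> \<xi>" for A
  proof -
    let ?l = "sorted_list_of_set A"
    have fin: "finite A" and "\<phi> ` A \<in> \<S> \<xi>"
      using schreier_system_spread[OF S \<xi> \<phi>] A by auto
    then have "map x (sorted_list_of_set (\<phi> ` A)) \<in> lp_tree \<infinity> UNIV K"
      using x unfolding spreading_model_def by blast
    then have xs: "map (x \<circ> \<phi>) ?l \<in> lp_tree \<infinity> UNIV K"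
      by (simp add: map_sorted_list_of_set_image[OF \<phi> fin])
    have "almost_biorthogonal (1 / (8 * K)) (map (x \<circ> \<phi>) ?l) (map z ?l)"
      unfolding almost_biorthogonal_def
    proof (intro conjI allI impI)
      fix i j assume ij: "i < length (map (x \<circ> \<phi>) ?l)" "j < length (map (x \<circ> \<phi>) ?l)" "j \<noteq> i"
      then have "?l ! j \<noteq> ?l ! i" by (simp add: nth_eq_iff_index_eq)
      then have "\<bar>B (z (?l ! i)) (x (\<phi> (?l ! j)))\<bar> \<le> 1 / (8 * K) / 2 ^ (?l ! j + 2)"
        by (rule off)
      also have "\<dots> \<le> 1 / (8 * K) / 2 ^ (j + 2)"
        using K ij by (intro divide_left_mono power_increasing add_mono sorted_wrt_less_idx) auto
      finally show "\<bar>B (map z ?l ! i) (map (x \<circ> \<phi>) ?l ! j)\<bar> \<le> 1 / (8 * K) / 2 ^ (j + 2)"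
        using ij by simp
    qed (use diag in auto)
    then show ?thesis
      by (rule almost_biorthogonal_imp_l1'[OF K xs])
  qed
  then show ?thesis by (auto simp: spreading_model_def)
qed

lemma index_SM_transfer:
  assumes K: "1 < K" and S: "schreier_system \<S>"
    and I: "index_SM \<S> \<infinity> (UNIV :: 'x set) K > Fin \<xi>"
  shows "index_SM \<S> 1 (UNIV :: 'z set) (16 * K) > Fin \<xi>"
proof -
  let ?X = "\<lambda>\<zeta>. \<zeta> \<le> omega1 \<and> (\<nexists>x. spreading_model \<S> \<infinity> \<zeta> (UNIV :: 'x set) K x)"
  let ?Z = "\<lambda>\<zeta>. \<zeta> \<le> omega1 \<and> (\<nexists>z. spreading_model \<S> 1 \<zeta> (UNIV :: 'z set) (16 * K) z)"
  have "\<xi> < (LEAST \<zeta>. ?Z \<zeta>)" if ex: "\<exists>\<zeta>. ?Z \<zeta>"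
  proof -
    have "?Z (LEAST \<zeta>. ?Z \<zeta>)" using ex by (rule LeastI_ex)
    then have X: "?X (LEAST \<zeta>. ?Z \<zeta>)"
      using spreading_model_transfer[OF K S] by blast
    then have "index_SM \<S> \<infinity> (UNIV :: 'x set) K = Fin (LEAST \<zeta>. ?X \<zeta>)"
      unfolding index_SM_def by (auto simp del: not_ex)
    then have "\<xi> < (LEAST \<zeta>. ?X \<zeta>)" using I by simp
    also have "\<dots> \<le> (LEAST \<zeta>. ?Z \<zeta>)" using X by (rule Least_le)
    finally show ?thesis .
  qed
  then show ?thesis by (auto simp: index_SM_def)
qed

lemma class_P4_transfer:
  assumes "class_P4 \<S> \<xi> \<infinity> (UNIV :: 'x set)" "schreier_system \<S>" "banach_carrier (UNIV :: 'z set)"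
  shows "class_P4 \<S> \<xi> 1 (UNIV :: 'z set)"
proof -
  obtain K where K: "1 < K" "index_SM \<S> \<infinity> (UNIV :: 'x set) K > Fin \<xi>"
    using assms(1) by (auto simp: class_P4_def)
  have "(1 :: real) < 16 * K" using K(1) by simp
  then show ?thesis
    using index_SM_transfer[OF K(1) assms(2) K(2)] assms(3) unfolding class_P4_def by blast
qed

end


section \<open>Norming functionals\<close>

text \<open>The Hahn--Banach theorem in the form needed for the duality between a space and its dual.
  Partial functionals of norm at most \<open>1\<close> are represented by their graphs, linear subspaces on
  which the second component is dominated by the norm of the first; such a subspace is
  automatically single-valued.\<close>

lemma exists_norming_functional:
  fixes x :: "'a::real_normed_vector"
  shows "\<exists>f :: 'a \<Rightarrow>\<^sub>L real. norm f \<le> 1 \<and> blinfun_apply f x = norm x"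
proof -
  define \<A> where "\<A> = {G :: ('a \<times> real) set. subspace G \<and> (x, norm x) \<in> G
    \<and> (\<forall>p\<in>G. snd p \<le> norm (fst p))}"
  have "span {(x, norm x)} \<in> \<A>"
  proof -
    have "snd p \<le> norm (fst p)" if p: "p \<in> span {(x, norm x)}" for p
    proof -
      obtain k where "p = k *\<^sub>R (x, norm x)" using p by (auto simp: span_singleton)
      then show ?thesis by (simp add: mult_right_mono)
    qed
    then show ?thesis by (simp add: \<A>_def span_base)
  qed
  then have "\<A> \<noteq> {}" by blast
  moreover have "\<Union>\<C> \<in> \<A>" if "\<C> \<noteq> {}" and ch: "subset.chain \<A> \<C>" for \<C>
  proof -
    have sub: "subspace G" and xG: "(x, norm x) \<in> G" and le: "\<forall>p\<in>G. snd p \<le> norm (fst p)"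
      if "G \<in> \<C>" for G
      using ch that by (auto simp: \<A>_def subset.chain_def)
    have "subspace (\<Union>\<C>)"
    proof (rule subspaceI)
      show "0 \<in> \<Union>\<C>" using \<open>\<C> \<noteq> {}\<close> sub subspace_0 by fastforce
    next
      fix p q assume "p \<in> \<Union>\<C>" "q \<in> \<Union>\<C>"
      then obtain G H where GH: "G \<in> \<C>" "p \<in> G" "H \<in> \<C>" "q \<in> H" by blast
      then have "G \<subseteq> H \<or> H \<subseteq> G" using ch by (auto simp: subset.chain_def)
      then show "p + q \<in> \<Union>\<C>"
        using GH sub subspace_add by (meson UnionI subsetD)
    next
      fix c :: real and p assume "p \<in> \<Union>\<C>"
      then show "c *\<^sub>R p \<in> \<Union>\<C>" using sub subspace_scale by blast
    qed
    moreover have "(x, norm x) \<in> \<Union>\<C>" using \<open>\<C> \<noteq> {}\<close> xG by blast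
    ultimately show ?thesis using le by (auto simp: \<A>_def)
  qed
  ultimately obtain G where "G \<in> \<A>" and max: "\<And>H. H \<in> \<A> \<Longrightarrow> G \<subseteq> H \<Longrightarrow> H = G"
    using subset_Zorn_nonempty[of \<A>] by auto
  then have sub: "subspace G" and xG: "(x, norm x) \<in> G"
    and le: "\<And>u r. (u, r) \<in> G \<Longrightarrow> r \<le> norm u"
    by (auto simp: \<A>_def)
  have total: "\<exists>r. (v, r) \<in> G" for v
  proof (rule ccontr)
    assume no: "\<nexists>r. (v, r) \<in> G"
    \<comment> \<open>The admissible values at \<open>v\<close> lie between the lower bounds \<open>r - norm (u - v)\<close> and the upper
      bounds \<open>norm (u + v) - r\<close>.\<close>
    let ?L = "(\<lambda>(u, r). r - norm (u - v)) ` G"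
    have cross: "r - norm (u - v) \<le> norm (u' + v) - r'" if "(u, r) \<in> G" "(u', r') \<in> G" for u r u' r'
    proof -
      have "(u + u', r + r') \<in> G" using subspace_add[OF sub that] by simp
      then have "r + r' \<le> norm (u + u')" by (rule le)
      also have "\<dots> \<le> norm (u - v) + norm (u' + v)"
        using norm_triangle_ineq[of "u - v" "u' + v"] by simp
      finally show ?thesis by simp
    qed
    define c where "c = Sup ?L"
    have zero: "(0, 0) \<in> G" using subspace_0[OF sub] by (simp add: zero_prod_def)
    have "bdd_above ?L"
      using cross[OF _ zero] by (intro bdd_aboveI2[where M = "norm v"]) auto
    then have lower: "r - norm (u - v) \<le> c" if "(u, r) \<in> G" for u r
      unfolding c_def using that by (intro cSup_upper) force+
    have upper: "c \<le> norm (u + v) - r" if "(u, r) \<in> G" for u r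
      unfolding c_def using that zero cross by (intro cSup_least) auto
    have "snd p \<le> norm (fst p)" if p: "p \<in> span (insert (v, c) G)" for p
    proof -
      obtain t where "p - t *\<^sub>R (v, c) \<in> span G"
        using p unfolding span_breakdown_eq by blast
      then obtain u r where ur: "(u, r) \<in> G" and p: "p = (u + t *\<^sub>R v, r + t * c)"
        using sub by (cases p) (auto simp: span_eq_iff[THEN iffD2])
      consider "t = 0" | "t > 0" | "t < 0" by linarith
      then show ?thesis
      proof cases
        case 1
        then show ?thesis using le[OF ur] by (simp add: p)
      next
        case 2
        have "((1 / t) *\<^sub>R u, (1 / t) * r) \<in> G" using subspace_scale[OF sub ur, of "1 / t"] by simp
        from upper[OF this] have "t * (c + r / t) \<le> t * norm ((1 / t) *\<^sub>R u + v)"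
          using 2 by (intro mult_left_mono) auto
        also have "t * norm ((1 / t) *\<^sub>R u + v) = norm (t *\<^sub>R ((1 / t) *\<^sub>R u + v))"
          using 2 by simp
        finally show ?thesis using 2 by (simp add: p distrib_left scaleR_add_right add.commute)
      next
        case 3
        have "((- 1 / t) *\<^sub>R u, (- 1 / t) * r) \<in> G"
          using subspace_scale[OF sub ur, of "- 1 / t"] by simp
        from lower[OF this] have "(- t) * (- r / t - c) \<le> (- t) * norm ((- 1 / t) *\<^sub>R u - v)"
          using 3 by (intro mult_left_mono) auto
        also have "(- t) * norm ((- 1 / t) *\<^sub>R u - v) = norm ((- t) *\<^sub>R ((- 1 / t) *\<^sub>R u - v))"
          using 3 by simp
        finally show ?thesis using 3 by (simp add: p right_diff_distrib scaleR_diff_right)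
      qed
    qed
    then have "span (insert (v, c) G) \<in> \<A>"
      using xG by (auto simp: \<A>_def intro: span_base)
    moreover have "G \<subseteq> span (insert (v, c) G)" using span_superset by blast
    ultimately have "span (insert (v, c) G) = G" by (rule max)
    then have "(v, c) \<in> G" using span_base[of "(v, c)" "insert (v, c) G"] by simp
    with no show False by blast
  qed
  have uniq: "r = r'" if "(v, r) \<in> G" "(v, r') \<in> G" for v r r'
    using le[of 0 "r - r'"] le[of 0 "r' - r"] subspace_diff[OF sub that]
      subspace_diff[OF sub that(2,1)] by simp
  define f where "f v = (THE r. (v, r) \<in> G)" for v
  have fG: "(v, f v) \<in> G" for v
    unfolding f_def using total[of v] uniq by (metis theI)
  have f_eq: "f v = r" if "(v, r) \<in> G" for v r by (rule uniq[OF fG that])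
  have scale: "f (c *\<^sub>R v) = c *\<^sub>R f v" for c v
    using subspace_scale[OF sub fG[of v], of c] by (intro f_eq) simp
  have abs: "norm (f v) \<le> norm v * 1" for v
    using le[OF fG[of v]] le[OF fG[of "- v"]] scale[of "- 1" v] by simp
  have "bounded_linear f"
  proof (rule bounded_linear_intro[OF _ scale abs])
    show "f (u + v) = f u + f v" for u v
      using subspace_add[OF sub fG[of u] fG[of v]] by (intro f_eq) simp
  qed
  then have app: "blinfun_apply (Blinfun f) = f" by (rule bounded_linear_Blinfun_apply)
  have "norm (Blinfun f) \<le> 1"
    using abs by (intro norm_blinfun_bound) (simp_all add: app)
  moreover have "blinfun_apply (Blinfun f) x = norm x" using f_eq[OF xG] by (simp add: app)
  ultimately show ?thesis by blast
qed

lemma norming_pairing_dual: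
  "norming_pairing (blinfun_apply :: ('a::real_normed_vector \<Rightarrow>\<^sub>L real) \<Rightarrow> 'a \<Rightarrow> real)"
proof (intro norming_pairing.intro bounded_bilinear_blinfun_apply norming_pairing_axioms.intro)
  fix f :: "'a \<Rightarrow>\<^sub>L real" and x :: 'a
  show "\<bar>blinfun_apply f x\<bar> \<le> norm f * norm x"
    using norm_blinfun[of f x] by simp
  show "\<exists>f :: 'a \<Rightarrow>\<^sub>L real. norm f \<le> 1 \<and> norm x / 2 \<le> blinfun_apply f x"
  proof -
    obtain f :: "'a \<Rightarrow>\<^sub>L real" where "norm f \<le> 1" "blinfun_apply f x = norm x"
      using exists_norming_functional[of x] by blast
    then show ?thesis by (intro exI[of _ f]) simp
  qed
qed

lemma norming_pairing_predual:
  fixes J :: "'x::real_normed_vector \<Rightarrow> ('y::real_normed_vector \<Rightarrow>\<^sub>L real)"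
  assumes lin: "linear J" and iso: "\<And>x. norm (J x) = norm x"
  shows "norming_pairing (\<lambda>y x. blinfun_apply (J x) y)"
proof (intro norming_pairing.intro norming_pairing_axioms.intro)
  show le: "\<bar>blinfun_apply (J x) y\<bar> \<le> norm y * norm x" for x y
    using norm_blinfun[of "J x" y] iso[of x] by (simp add: mult.commute)
  show "bounded_bilinear (\<lambda>y x. blinfun_apply (J x) y)"
    using le by unfold_locales
      (auto simp: blinfun.add_right blinfun.add_left blinfun.scaleR_right blinfun.scaleR_left
        linear_add[OF lin] linear_scale[OF lin] intro!: exI[of _ 1])
  show "\<exists>y. norm y \<le> 1 \<and> norm x / 2 \<le> blinfun_apply (J x) y" for x
  proof (rule ccontr)
    assume "\<nexists>y. norm y \<le> 1 \<and> norm x / 2 \<le> blinfun_apply (J x) y"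
    then have small: "blinfun_apply (J x) y < norm x / 2" if "norm y \<le> 1" for y
      using that by (meson not_le)
    have "norm (blinfun_apply (J x) y) \<le> norm x / 2 * norm y" for y
    proof (cases "y = 0")
      case False
      have "blinfun_apply (J x) (sgn y) < norm x / 2" "blinfun_apply (J x) (- sgn y) < norm x / 2"
        by (rule small, simp add: norm_sgn)+
      then have "\<bar>blinfun_apply (J x) (sgn y)\<bar> \<le> norm x / 2"
        by (simp add: blinfun.minus_right)
      then have "norm y * \<bar>blinfun_apply (J x) (sgn y)\<bar> \<le> norm y * (norm x / 2)"
        by (intro mult_left_mono) auto
      moreover have "norm y * \<bar>blinfun_apply (J x) (sgn y)\<bar> = \<bar>blinfun_apply (J x) y\<bar>"
        using False by (simp add: sgn_div_norm blinfun.scaleR_right abs_mult)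
      ultimately show ?thesis by (simp add: mult.commute)
    qed simp
    then have "norm (J x) \<le> norm x / 2" by (intro norm_blinfun_bound) auto
    then have "x = 0" using iso[of x] by simp
    then show False using small[of 0] by simp
  qed
qed


section \<open>Finite dimensional subspaces\<close>

lemma closed_span_insert:
  fixes a :: "'a::real_normed_vector"
  assumes S: "closed (span S)"
  shows "closed (span (insert a S))"
proof (cases "a \<in> span S")
  case True
  then show ?thesis using S by (simp add: span_redundant)
next
  case False
  then obtain d where d: "d > 0" "ball a d \<subseteq> - span S"
    using S by (metis ComplI open_Compl open_contains_ball)
  \<comment> \<open>\<open>a\<close> has positive distance from the span, so the coefficients of \<open>a\<close> along a convergent sequence
    are Cauchy.\<close>
  have dist: "\<bar>k\<bar> * d \<le> norm (s + k *\<^sub>R a)" if s: "s \<in> span S" for s k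
  proof (cases "k = 0")
    case False
    have "- (1 / k) *\<^sub>R s \<in> span S" by (rule span_scale[OF s])
    then have "d \<le> dist a (- (1 / k) *\<^sub>R s)" using d(2) by (auto simp: not_less[symmetric])
    then have "\<bar>k\<bar> * d \<le> \<bar>k\<bar> * norm (a + (1 / k) *\<^sub>R s)"
      by (intro mult_left_mono) (auto simp: dist_norm)
    also have "\<dots> = norm (k *\<^sub>R (a + (1 / k) *\<^sub>R s))" by simp
    finally show ?thesis using False by (simp add: scaleR_add_right add.commute)
  qed simp
  show ?thesis
    unfolding closed_sequential_limits
  proof (intro allI impI)
    fix x l assume x: "(\<forall>n. x n \<in> span (insert a S)) \<and> x \<longlonglongrightarrow> l"
    then have "\<forall>n. \<exists>k. x n - k *\<^sub>R a \<in> span S"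
      by (simp add: span_breakdown_eq)
    from choice[OF this] obtain k where k: "\<And>n. x n - k n *\<^sub>R a \<in> span S" by blast
    have "Cauchy k"
    proof (rule metric_CauchyI)
      fix e :: real assume "e > 0"
      then have "e * d > 0" using d by simp
      moreover have "Cauchy x" using x LIMSEQ_imp_Cauchy by blast
      ultimately obtain M where M: "\<And>m n. m \<ge> M \<Longrightarrow> n \<ge> M \<Longrightarrow> dist (x m) (x n) < e * d"
        using metric_CauchyD by blast
      have "dist (k m) (k n) < e" if "m \<ge> M" "n \<ge> M" for m n
      proof -
        have "\<bar>k m - k n\<bar> * d
            \<le> norm (((x m - k m *\<^sub>R a) - (x n - k n *\<^sub>R a)) + (k m - k n) *\<^sub>R a)"
          by (intro dist span_diff k)
        also have "\<dots> = dist (x m) (x n)" by (simp add: dist_norm algebra_simps)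
        also have "\<dots> < e * d" by (rule M[OF that])
        finally show ?thesis using d by (simp add: dist_real_def)
      qed
      then show "\<exists>M. \<forall>m\<ge>M. \<forall>n\<ge>M. dist (k m) (k n) < e" by blast
    qed
    then obtain c where "k \<longlonglongrightarrow> c" using convergent_eq_Cauchy by blast
    then have "(\<lambda>n. x n - k n *\<^sub>R a) \<longlonglongrightarrow> l - c *\<^sub>R a"
      using x by (intro tendsto_intros) auto
    then have "l - c *\<^sub>R a \<in> span S"
      by (rule closed_sequentially[OF S k])
    then show "l \<in> span (insert a S)" unfolding span_breakdown_eq by blast
  qed
qed

lemma closed_span_finite:
  fixes B :: "'a::real_normed_vector set"
  assumes "finite B"
  shows "closed (span B)"
  using assms by (induction rule: finite_induct) (simp_all add: closed_span_insert)

text \<open>Induction on the points: the functionals that vanish at one of them form a subspace of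
  codimension at most one.\<close>

lemma finite_span_of_separated:
  fixes V :: "('a::real_normed_vector \<Rightarrow>\<^sub>L real) set"
  assumes "finite B" "subspace V" "\<And>f. f \<in> V \<Longrightarrow> \<forall>b\<in>B. blinfun_apply f b = 0 \<Longrightarrow> f = 0"
  shows "\<exists>D. finite D \<and> span D = V"
  using assms
proof (induction B arbitrary: V rule: finite_induct)
  case empty
  then have "V = {0}" using subspace_0 by auto
  then show ?case by (intro exI[of _ "{}"]) simp
next
  case (insert b B)
  define V0 where "V0 = {f \<in> V. blinfun_apply f b = 0}"
  have "subspace V0"
    using insert.prems(1) unfolding V0_def subspace_def
    by (auto simp: blinfun.add_left blinfun.scaleR_left)
  moreover have "f = 0" if "f \<in> V0" "\<forall>b\<in>B. blinfun_apply f b = 0" for f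
    using that insert.prems(2)[of f] by (auto simp: V0_def)
  ultimately have "\<exists>D. finite D \<and> span D = V0" by (rule insert.IH)
  then obtain D where D: "finite D" "span D = V0" by blast
  show ?case
  proof (cases "V0 = V")
    case False
    then obtain g where g: "g \<in> V" "blinfun_apply g b \<noteq> 0" by (auto simp: V0_def)
    have "span (insert g D) = V"
    proof
      show "span (insert g D) \<subseteq> V"
      proof (rule span_minimal[OF _ insert.prems(1)])
        have "D \<subseteq> V0" using D(2) span_superset by blast
        then show "insert g D \<subseteq> V" using g(1) by (auto simp: V0_def)
      qed
      show "V \<subseteq> span (insert g D)"
      proof
        fix f assume f: "f \<in> V"
        let ?k = "blinfun_apply f b / blinfun_apply g b"
        have "f - ?k *\<^sub>R g \<in> V"
          using f g(1) insert.prems(1) by (intro subspace_diff subspace_scale)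
        then have "f - ?k *\<^sub>R g \<in> V0"
          using g(2) by (simp add: V0_def blinfun.diff_left blinfun.scaleR_left)
        then show "f \<in> span (insert g D)" unfolding span_breakdown_eq D(2) by blast
      qed
    qed
    then show ?thesis using D(1) by blast
  qed (use D in blast)
qed


section \<open>Finite dimensional decompositions\<close>

lemma is_FDD_carrier:
  assumes "is_FDD E X"
  shows "subspace X" "E n \<subseteq> X" "subspace (E n)" "\<exists>B. finite B \<and> span B = E n"
  using assms unfolding is_FDD_def banach_carrier_def by blast+

lemma
  assumes "is_FDD E X" "x \<in> X"
  shows fdd_proj_in: "fdd_proj E n x \<in> E n"
    and fdd_proj_sums: "(\<lambda>n. fdd_proj E n x) sums x"
    and fdd_proj_eqI: "\<And>f. \<lbrakk>\<And>k. f k \<in> E k; f sums x\<rbrakk> \<Longrightarrow> fdd_proj E n x = f n"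
proof -
  have ex1: "\<exists>!f. (\<forall>k. f k \<in> E k) \<and> f sums x"
    using assms unfolding is_FDD_def by blast
  have eq: "(\<lambda>n. fdd_proj E n x) = (THE f. (\<forall>k. f k \<in> E k) \<and> f sums x)"
    by (simp add: fdd_proj_def)
  have *: "(\<forall>k. fdd_proj E k x \<in> E k) \<and> (\<lambda>n. fdd_proj E n x) sums x"
    using theI'[OF ex1] unfolding eq[symmetric] by blast
  then show "fdd_proj E n x \<in> E n" "(\<lambda>n. fdd_proj E n x) sums x" by blast+
  show "fdd_proj E n x = f n" if f: "\<And>k. f k \<in> E k" "f sums x" for f
  proof -
    have "(\<forall>k. f k \<in> E k) \<and> f sums x" using f by simp
    then have "(THE f. (\<forall>k. f k \<in> E k) \<and> f sums x) = f" by (rule the1_equality[OF ex1])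
    then show ?thesis by (simp add: fdd_proj_def)
  qed
qed

lemma fdd_proj_sum:
  assumes fdd: "is_FDD E X" and v: "\<And>i. v i \<in> E i" and I: "finite I"
  shows "fdd_proj E n (\<Sum>i\<in>I. v i) = (if n \<in> I then v n else 0)"
proof -
  have "(\<Sum>i\<in>I. v i) \<in> X"
    using is_FDD_carrier[OF fdd] v by (intro subspace_sum) blast+
  moreover have "(\<lambda>i. if i \<in> I then v i else 0) sums (\<Sum>i\<in>I. v i)"
    using sums_If_finite_set[OF I, of v] .
  moreover have "(if k \<in> I then v k else 0) \<in> E k" for k
    using v is_FDD_carrier(3)[OF fdd] subspace_0 by auto
  ultimately show ?thesis
    by (intro fdd_proj_eqI[OF fdd, where f = "\<lambda>i. if i \<in> I then v i else 0"])
qed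

lemma fdd_supp_sum_subset:
  assumes "is_FDD E X" "\<And>i. v i \<in> E i" "finite I"
  shows "fdd_supp E (\<Sum>i\<in>I. v i) \<subseteq> I"
  using fdd_proj_sum[OF assms] by (auto simp: fdd_supp_def)

lemma fdd_supp_nonempty:
  assumes "is_FDD E X" "x \<in> X" "x \<noteq> 0"
  shows "fdd_supp E x \<noteq> {}"
proof
  assume "fdd_supp E x = {}"
  then have "(\<lambda>n. fdd_proj E n x) = (\<lambda>n. 0)" by (auto simp: fdd_supp_def)
  then have "(\<lambda>n. 0) sums x" using fdd_proj_sums[OF assms(1,2)] by metis
  then show False using assms(3) sums_unique2[OF _ sums_zero] by blast
qed

lemma sum_fdd_proj_eq:
  assumes "is_FDD E X" "x \<in> X" "finite I" "fdd_supp E x \<subseteq> I"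
  shows "(\<Sum>i\<in>I. fdd_proj E i x) = x"
proof -
  have "(\<lambda>n. fdd_proj E n x) sums (\<Sum>i\<in>I. fdd_proj E i x)"
    using assms(3,4) by (intro sums_finite) (auto simp: fdd_supp_def)
  then show ?thesis using fdd_proj_sums[OF assms(1,2)] sums_unique2 by blast
qed

lemma subspace_closure:
  fixes V :: "'a::real_normed_vector set"
  assumes "subspace V"
  shows "subspace (closure V)"
proof (rule subspaceI)
  show "0 \<in> closure V" using subspace_0[OF assms] closure_subset by (rule subsetD[rotated])
next
  fix x y assume "x \<in> closure V" "y \<in> closure V"
  then obtain f g where f: "\<forall>n. f n \<in> V" "f \<longlonglongrightarrow> x" and g: "\<forall>n. g n \<in> V" "g \<longlonglongrightarrow> y"
    by (auto simp: closure_sequential)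
  have "\<forall>n. f n + g n \<in> V" using f(1) g(1) subspace_add[OF assms] by simp
  then show "x + y \<in> closure V"
    using tendsto_add[OF f(2) g(2)] unfolding closure_sequential by (intro exI conjI)
next
  fix c :: real and x assume "x \<in> closure V"
  then obtain f where f: "\<forall>n. f n \<in> V" "f \<longlonglongrightarrow> x" by (auto simp: closure_sequential)
  have "\<forall>n. c *\<^sub>R f n \<in> V" using f(1) subspace_scale[OF assms] by simp
  then show "c *\<^sub>R x \<in> closure V"
    using tendsto_scaleR[OF tendsto_const f(2)] unfolding closure_sequential by (intro exI conjI)
qed

locale fdd =
  fixes E :: "nat \<Rightarrow> 'a::banach set"
  assumes is_FDD: "is_FDD E UNIV"
begin

abbreviation P :: "nat \<Rightarrow> 'a \<Rightarrow> 'a" where "P \<equiv> fdd_proj E"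

lemma P_in: "P n x \<in> E n"
  and P_sums: "(\<lambda>n. P n x) sums x"
  and P_eqI: "\<lbrakk>\<And>k. f k \<in> E k; f sums x\<rbrakk> \<Longrightarrow> P n x = f n"
  by (rule fdd_proj_in[OF is_FDD UNIV_I], rule fdd_proj_sums[OF is_FDD UNIV_I],
      rule fdd_proj_eqI[OF is_FDD UNIV_I])

lemma subspace_E: "subspace (E n)"
  by (rule is_FDD_carrier(3)[OF is_FDD])

lemma P_linear: "linear (P n)"
proof (rule linearI)
  fix x y and c :: real
  show "P n (x + y) = P n x + P n y"
    by (rule P_eqI) (auto intro: sums_add P_sums subspace_add[OF subspace_E] P_in)
  show "P n (c *\<^sub>R x) = c *\<^sub>R P n x"
    by (rule P_eqI) (auto intro: sums_scaleR_right P_sums subspace_scale[OF subspace_E] P_in)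
qed

lemma P_P: "P m (P n x) = (if m = n then P n x else 0)"
proof -
  have "P m (\<Sum>i\<in>{n}. P i x) = (if m \<in> {n} then P m x else 0)"
    by (rule fdd_proj_sum[OF is_FDD P_in]) simp
  then show ?thesis by simp
qed

definition S :: "nat \<Rightarrow> 'a \<Rightarrow> 'a" where
  "S n x = (\<Sum>i<n. P i x)"

lemma S_linear: "linear (S n)"
  unfolding S_def by (intro linear_compose_sum ballI P_linear)

lemma S_tendsto: "(\<lambda>n. S n x) \<longlonglongrightarrow> x"
  using P_sums[of x] by (simp add: S_def sums_def)

lemma S_bounded_pointwise: "\<exists>m :: nat. \<forall>n. norm (S n x) \<le> real m"
proof -
  have "Bseq (\<lambda>n. S n x)" using S_tendsto convergentI convergent_imp_Bseq by blast
  then obtain K where K: "\<And>n. norm (S n x) \<le> K" by (auto simp: Bseq_def)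
  obtain m :: nat where "K \<le> real m" using real_arch_simple by blast
  then show ?thesis using K order_trans by blast
qed

text \<open>Baire category: some set of vectors with uniformly bounded partial sums is dense in a ball.
  Differences move the ball to the origin.\<close>

lemma S_bounded_dense_ball:
  "\<exists>m \<rho>. 0 < \<rho> \<and> 0 \<le> m \<and> (\<forall>y e. norm y < \<rho> \<longrightarrow> 0 < e \<longrightarrow>
    (\<exists>u. (\<forall>n. norm (S n u) \<le> m) \<and> norm (u - y) < e))"
proof -
  define A where "A m = {x. \<forall>n. norm (S n x) \<le> real m}" for m
  have "\<exists>m. interior (closure (A m)) \<noteq> {}"
  proof (rule ccontr)
    assume "\<nexists>m. interior (closure (A m)) \<noteq> {}"
    then have "Met_TC.mtopology interior_of \<Union> (range (\<lambda>m. closure (A m))) = {}"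
      using complete_UNIV
      by (intro Met_TC.metric_Baire_category_alt) auto
    moreover have "UNIV = \<Union> (range (\<lambda>m. closure (A m)))"
    proof (rule UNIV_eq_I)
      fix x
      obtain m where "x \<in> A m" using S_bounded_pointwise[of x] by (auto simp: A_def)
      then have "x \<in> closure (A m)" using closure_subset[of "A m"] by (rule subsetD[rotated])
      then show "x \<in> \<Union> (range (\<lambda>m. closure (A m)))" by blast
    qed
    ultimately have "Met_TC.mtopology interior_of (UNIV :: 'a set) = {}" by (simp only:)
    then show False by simp
  qed
  then obtain m x0 where "x0 \<in> interior (closure (A m))" by blast
  then obtain \<rho> where \<rho>: "\<rho> > 0" "ball x0 \<rho> \<subseteq> closure (A m)"
    by (meson mem_interior)
  have approx: "\<exists>u. (\<forall>n. norm (S n u) \<le> real m) \<and> norm (u - y) < e"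
    if y: "norm y < \<rho>" and e: "0 < e" for y e
  proof -
    have "x0 + y \<in> closure (A m)" "x0 - y \<in> closure (A m)"
      using \<rho>(2) y by (auto simp: dist_norm)
    then obtain u v where uv: "u \<in> A m" "v \<in> A m" "dist u (x0 + y) < e" "dist v (x0 - y) < e"
      using e unfolding closure_approachable by blast
    define w where "w = (1 / 2) *\<^sub>R (u - v)"
    have "norm (S n w) \<le> real m" for n
    proof -
      have "norm (S n w) = norm (S n u - S n v) / 2"
        by (simp add: w_def linear_scale[OF S_linear] linear_diff[OF S_linear])
      also have "\<dots> \<le> (norm (S n u) + norm (S n v)) / 2"
        by (intro divide_right_mono norm_triangle_ineq4) simp
      also have "\<dots> \<le> real m" using uv(1,2) by (simp add: A_def) (smt (verit))
      finally show ?thesis .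
    qed
    moreover have "norm (w - y) < e"
    proof -
      have "w - y = (1 / 2) *\<^sub>R ((u - (x0 + y)) - (v - (x0 - y)))"
        by (simp add: w_def algebra_simps flip: scaleR_2 scaleR_add_left)
      then have "norm (w - y) \<le> (norm (u - (x0 + y)) + norm (v - (x0 - y))) / 2"
        using norm_triangle_ineq4[of "u - (x0 + y)" "v - (x0 - y)"] by simp
      then show ?thesis using uv(3,4) by (simp add: dist_norm)
    qed
    ultimately show ?thesis by blast
  qed
  show ?thesis
    by (rule exI[of _ "real m"], rule exI[of _ \<rho>]) (use \<rho>(1) approx in auto)
qed

lemma S_bounded_approximation:
  "\<exists>M\<ge>0. \<forall>x. \<exists>u. (\<forall>n. norm (S n u) \<le> M * norm x) \<and> norm (x - u) \<le> norm x / 2"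
proof -
  obtain m \<rho> where \<rho>: "0 < \<rho>" "0 \<le> m" and
    approx: "\<And>y e. norm y < \<rho> \<Longrightarrow> 0 < e \<Longrightarrow> \<exists>u. (\<forall>n. norm (S n u) \<le> m) \<and> norm (u - y) < e"
    using S_bounded_dense_ball by blast
  have "\<exists>u. (\<forall>n. norm (S n u) \<le> 2 * m / \<rho> * norm x) \<and> norm (x - u) \<le> norm x / 2" for x
  proof (cases "x = 0")
    case True
    then show ?thesis by (intro exI[of _ 0]) (simp add: linear_0[OF S_linear])
  next
    case False
    define t where "t = 2 * norm x / \<rho>"
    have t: "t > 0" using False \<rho> by (simp add: t_def)
    have "norm ((1 / t) *\<^sub>R x) < \<rho>" using t False \<rho> by (simp add: t_def)
    then obtain u where u: "\<And>n. norm (S n u) \<le> m" "norm (u - (1 / t) *\<^sub>R x) < \<rho> / 4"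
      using approx[of "(1 / t) *\<^sub>R x" "\<rho> / 4"] \<rho> by auto
    have "norm (S n (t *\<^sub>R u)) \<le> 2 * m / \<rho> * norm x" for n
    proof -
      have "norm (S n (t *\<^sub>R u)) = t * norm (S n u)" using t by (simp add: linear_scale[OF S_linear])
      also have "\<dots> \<le> t * m" using t u(1) by (intro mult_left_mono) auto
      also have "\<dots> = 2 * m / \<rho> * norm x" by (simp add: t_def)
      finally show ?thesis .
    qed
    moreover have "norm (x - t *\<^sub>R u) \<le> norm x / 2"
    proof -
      have "x - t *\<^sub>R u = - (t *\<^sub>R (u - (1 / t) *\<^sub>R x))" using t by (simp add: scaleR_diff_right)
      then have "norm (x - t *\<^sub>R u) = t * norm (u - (1 / t) *\<^sub>R x)" using t by simp
      also have "\<dots> \<le> t * (\<rho> / 4)" using t u(2) by (intro mult_left_mono) auto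
      also have "\<dots> = norm x / 2" using \<rho> by (simp add: t_def)
      finally show ?thesis .
    qed
    ultimately show ?thesis by blast
  qed
  moreover have "0 \<le> 2 * m / \<rho>" using \<rho> by simp
  ultimately show ?thesis by blast
qed

text \<open>The approximation is iterated as in the open
  mapping theorem: a vector is a series of vectors \<open>u\<^sub>k\<close> whose partial sums are bounded by a
  geometric series. Summing the expansions of the \<open>u\<^sub>k\<close> gives an expansion of the vector, which by
  uniqueness is the expansion.\<close>

lemma S_uniformly_bounded: "\<exists>b>0. \<forall>n x. norm (S n x) \<le> b * norm x"
proof -
  obtain M where M: "0 \<le> M" and
    ex: "\<forall>x. \<exists>u. (\<forall>n. norm (S n u) \<le> M * norm x) \<and> norm (x - u) \<le> norm x / 2"
    using S_bounded_approximation by blast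
  from choice[OF ex] obtain g where g: "\<And>x n. norm (S n (g x)) \<le> M * norm x"
    "\<And>x. norm (x - g x) \<le> norm x / 2" by blast
  have "norm (S n x) \<le> 2 * M * norm x" for n x
  proof -
    define res where "res = rec_nat x (\<lambda>_ y. y - g y)"
    define u where "u k = g (res k)" for k
    have res_0: "res 0 = x" and res_Suc: "res (Suc k) = res k - u k" for k
      by (simp_all add: res_def u_def)
    have res: "norm (res k) \<le> norm x * (1 / 2) ^ k" for k
    proof (induction k)
      case (Suc k)
      have "norm (res (Suc k)) \<le> norm (res k) / 2" using g(2)[of "res k"] by (simp add: res_Suc u_def)
      then show ?case using Suc by simp
    qed (simp add: res_0)
    have Su: "norm (S n (u k)) \<le> M * norm x * (1 / 2) ^ k" for n k
    proof -
      have "norm (S n (u k)) \<le> M * norm (res k)" unfolding u_def by (rule g(1))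
      also have "\<dots> \<le> M * (norm x * (1 / 2) ^ k)" by (rule mult_left_mono[OF res M])
      finally show ?thesis by (simp add: mult.assoc)
    qed
    have u: "norm (u k) \<le> 2 * norm x * (1 / 2) ^ k" for k
    proof -
      have "u k = res k - res (Suc k)" by (simp add: res_Suc)
      then have "norm (u k) \<le> norm (res k) + norm (res (Suc k))" by (simp add: norm_triangle_ineq4)
      also have "\<dots> \<le> norm x * (1 / 2) ^ k + norm x * (1 / 2) ^ Suc k" by (intro add_mono res)
      also have "\<dots> \<le> 2 * norm x * (1 / 2) ^ k" by simp
      finally show ?thesis .
    qed
    have geo: "(\<lambda>k. c * (1 / 2) ^ k) sums (2 * c)" for c :: real
      using sums_mult[OF geometric_sums[of "1 / 2 :: real"], of c] by (simp add: mult.commute)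
    then have geo_summable: "summable (\<lambda>k. c * (1 / 2 :: real) ^ k)" for c
      by (rule sums_summable)
    have u_sums: "u sums x"
    proof -
      have partial: "(\<Sum>k<n. u k) = x - res n" for n
        by (induction n) (simp_all add: res_0 res_Suc)
      have "res \<longlonglongrightarrow> 0"
      proof (rule Lim_null_comparison)
        show "\<forall>\<^sub>F k in sequentially. norm (res k) \<le> norm x * (1 / 2) ^ k" using res by simp
        show "(\<lambda>k. norm x * (1 / 2) ^ k) \<longlonglongrightarrow> 0" by (rule summable_LIMSEQ_zero[OF geo_summable])
      qed
      then have "(\<lambda>n. x - res n) \<longlonglongrightarrow> x - 0" by (intro tendsto_diff tendsto_const)
      then show ?thesis unfolding sums_def partial by simp
    qed
    have S_summable: "summable (\<lambda>k. S n (u k))" for n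
      by (rule summable_comparison_test'[OF geo_summable]) (rule Su)
    have P_summable: "summable (\<lambda>k. P i (u k))" for i
    proof -
      have "P i v = S (Suc i) v - S i v" for v by (simp add: S_def)
      then show ?thesis using summable_diff[OF S_summable S_summable] by simp
    qed
    define y where "y i = (\<Sum>k. P i (u k))" for i
    have y_in: "y i \<in> E i" for i
    proof -
      obtain B where B: "finite B" "span B = E i" using is_FDD_carrier(4)[OF is_FDD] by blast
      have closed: "closed (E i)" using closed_span_finite[OF B(1)] unfolding B(2) .
      have lim: "(\<lambda>m. \<Sum>k<m. P i (u k)) \<longlonglongrightarrow> y i"
        unfolding y_def by (rule summable_LIMSEQ[OF P_summable])
      have "(\<Sum>k<m. P i (u k)) \<in> E i" for m
        by (intro subspace_sum[OF subspace_E] P_in)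
      then show ?thesis by (rule closed_sequentially[OF closed _ lim])
    qed
    have sum_y: "(\<Sum>i<n. y i) = (\<Sum>k. S n (u k))" for n
      unfolding y_def S_def by (rule suminf_sum[symmetric]) (rule P_summable)
    have "y sums x"
    proof -
      have bound: "norm (S n (u k) - u k) \<le> (M * norm x + 2 * norm x) * (1 / 2) ^ k" for n k
        using norm_triangle_ineq4[of "S n (u k)" "u k"] Su[of n k] u[of k]
        by (simp add: distrib_right)
      have "(\<lambda>n. \<Sum>k. norm (S n (u k) - u k)) \<longlonglongrightarrow> (\<Sum>k. 0 :: real)"
      proof (intro conjunct2[OF conjunct2[OF tannerys_theorem[where
              M = "\<lambda>k. (M * norm x + 2 * norm x) * (1 / 2) ^ k"]]] geo_summable)
        show "(\<lambda>n. norm (S n (u k) - u k)) \<longlonglongrightarrow> 0" for k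
          using tendsto_norm[OF tendsto_diff[OF S_tendsto[of "u k"] tendsto_const[of "u k"]]] by simp
        show "\<forall>\<^sub>F (k, n) in sequentially \<times>\<^sub>F sequentially.
            norm (norm (S n (u k) - u k)) \<le> (M * norm x + 2 * norm x) * (1 / 2) ^ k"
          using bound by (intro always_eventually) auto
      qed simp
      then have lim: "(\<lambda>n. \<Sum>k. norm (S n (u k) - u k)) \<longlonglongrightarrow> 0" by simp
      have le: "norm ((\<Sum>i<n. y i) - x) \<le> (\<Sum>k. norm (S n (u k) - u k))" for n
      proof -
        have eq: "(\<Sum>i<n. y i) - x = (\<Sum>k. S n (u k) - u k)"
          unfolding sum_y using suminf_diff[OF S_summable sums_summable[OF u_sums]]
            sums_unique[OF u_sums] by simp
        have "summable (\<lambda>k. norm (S n (u k) - u k))"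
          by (rule summable_norm_comparison_test[OF _ geo_summable]) (use bound in blast)
        then show ?thesis unfolding eq by (rule summable_norm)
      qed
      have "(\<lambda>n. (\<Sum>i<n. y i) - x) \<longlonglongrightarrow> 0"
        by (rule Lim_null_comparison[OF always_eventually[OF allI[OF le]] lim])
      then show ?thesis unfolding sums_def by (simp add: LIM_zero_iff)
    qed
    then have "P i x = y i" for i by (rule P_eqI[OF y_in])
    then have "S n x = (\<Sum>k. S n (u k))" by (simp add: S_def[of n x] sum_y)
    moreover have "norm (\<Sum>k. S n (u k)) \<le> 2 * (M * norm x)"
      using norm_suminf_le[OF Su geo_summable] sums_unique[OF geo[of "M * norm x"]] by simp
    ultimately show ?thesis by simp
  qed
  moreover have "2 * M * norm x \<le> (2 * M + 1) * norm x" for x :: 'a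
    by (simp add: distrib_right)
  ultimately have *: "\<forall>n x. norm (S n x) \<le> (2 * M + 1) * norm x"
    using order_trans by blast
  have "0 < 2 * M + 1" using M by simp
  with * show ?thesis by blast
qed

definition basis_constant :: real where
  "basis_constant = (SOME b. b > 0 \<and> (\<forall>n x. norm (S n x) \<le> b * norm x))"

lemma basis_constant_pos: "0 < basis_constant"
  and norm_S_le: "norm (S n x) \<le> basis_constant * norm x"
  using someI_ex[OF S_uniformly_bounded] unfolding basis_constant_def by blast+

lemma norm_interval_proj_le: "norm (\<Sum>i\<in>{a..c}. P i x) \<le> 2 * basis_constant * norm x"
proof (cases "a \<le> c")
  case True
  have "(\<Sum>i\<in>{a..c}. P i x) = S (Suc c) x - S a x"
    unfolding S_def lessThan_atLeast0 using True
    by (subst sum.atLeastLessThan_concat[of 0 a "Suc c", symmetric]) (auto simp: atLeastLessThanSuc_atLeastAtMost)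
  then show ?thesis
    using norm_triangle_ineq4[of "S (Suc c) x" "S a x"] norm_S_le[of "Suc c" x] norm_S_le[of a x]
    by simp
next
  case False
  then show ?thesis using basis_constant_pos by simp
qed

lemma P_bounded_linear: "bounded_linear (P n)"
proof (rule bounded_linear_intro)
  show "norm (P n x) \<le> norm x * (2 * basis_constant)" for x
    using norm_interval_proj_le[where a = n and c = n and x = x] by (simp add: mult.commute)
qed (simp_all add: linear_add[OF P_linear] linear_scale[OF P_linear])


section \<open>The dual decomposition\<close>

text \<open>The adjoint of \<open>P n\<close>.\<close>

definition Q :: "nat \<Rightarrow> ('a \<Rightarrow>\<^sub>L real) \<Rightarrow> ('a \<Rightarrow>\<^sub>L real)" where
  "Q n f = f o\<^sub>L Blinfun (P n)"

lemma Q_apply [simp]: "blinfun_apply (Q n f) x = blinfun_apply f (P n x)"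
  by (simp add: Q_def bounded_linear_Blinfun_apply[OF P_bounded_linear])

lemma fdd_dual_iff: "f \<in> fdd_dual E n \<longleftrightarrow> Q n f = f"
proof
  assume "f \<in> fdd_dual E n"
  then obtain \<phi> where "\<forall>x. blinfun_apply f x = \<phi> (P n x)" by (auto simp: fdd_dual_def)
  then show "Q n f = f" by (intro blinfun_eqI) (simp add: P_P)
next
  assume "Q n f = f"
  then have "\<forall>x. blinfun_apply f x = blinfun_apply f (P n x)" by (metis Q_apply)
  then show "f \<in> fdd_dual E n"
    unfolding fdd_dual_def
    by (intro CollectI exI[of _ "blinfun_apply f"]) (auto simp: blinfun.add_right blinfun.scaleR_right)
qed

lemma Q_in: "Q n f \<in> fdd_dual E n"
  unfolding fdd_dual_iff by (rule blinfun_eqI) (simp add: P_P)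

lemma Q_dual: "f \<in> fdd_dual E m \<Longrightarrow> Q n f = (if n = m then f else 0)"
proof -
  assume "f \<in> fdd_dual E m"
  then have f: "Q m f = f" by (simp add: fdd_dual_iff)
  show "Q n f = (if n = m then f else 0)"
  proof (cases "n = m")
    case False
    have "Q n (Q m f) = 0"
      using False by (intro blinfun_eqI) (simp add: P_P)
    then show ?thesis using f False by simp
  qed (simp add: f)
qed

lemma Q_linear: "linear (Q n)"
  by (rule linearI) (auto intro!: blinfun_eqI simp: blinfun.add_left blinfun.scaleR_left)

lemma sum_Q_apply: "blinfun_apply (\<Sum>i\<in>I. Q i f) x = blinfun_apply f (\<Sum>i\<in>I. P i x)"
  by (simp add: blinfun.sum_left blinfun.sum_right)

lemma norm_interval_sum_Q_le: "norm (\<Sum>i\<in>{a..c}. Q i f) \<le> 2 * basis_constant * norm f"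
proof (rule norm_blinfun_bound)
  show "norm (blinfun_apply (\<Sum>i\<in>{a..c}. Q i f) x) \<le> 2 * basis_constant * norm f * norm x" for x
  proof -
    have "norm (blinfun_apply (\<Sum>i\<in>{a..c}. Q i f) x) \<le> norm f * norm (\<Sum>i\<in>{a..c}. P i x)"
      unfolding sum_Q_apply by (rule norm_blinfun)
    also have "\<dots> \<le> norm f * (2 * basis_constant * norm x)"
      by (intro mult_left_mono norm_interval_proj_le) simp
    finally show ?thesis by (simp add: mult_ac)
  qed
qed (use basis_constant_pos in simp)

lemma norm_sum_Q_le: "norm (\<Sum>i<n. Q i f) \<le> basis_constant * norm f"
proof (rule norm_blinfun_bound)
  show "norm (blinfun_apply (\<Sum>i<n. Q i f) x) \<le> basis_constant * norm f * norm x" for x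
  proof -
    have "norm (blinfun_apply (\<Sum>i<n. Q i f) x) \<le> norm f * norm (S n x)"
      unfolding sum_Q_apply S_def by (rule norm_blinfun)
    also have "\<dots> \<le> norm f * (basis_constant * norm x)"
      by (intro mult_left_mono norm_S_le) simp
    finally show ?thesis by (simp add: mult_ac)
  qed
qed (use basis_constant_pos in simp)

lemma subspace_fdd_dual: "subspace (fdd_dual E n)"
  by (auto simp: subspace_def fdd_dual_iff linear_0[OF Q_linear] linear_add[OF Q_linear] linear_scale[OF Q_linear])

lemma subspace_closed_span: "subspace (closed_span_of (fdd_dual E))"
  unfolding closed_span_of_def by (rule subspace_closure[OF subspace_span])

lemma fdd_dual_subset: "fdd_dual E n \<subseteq> closed_span_of (fdd_dual E)"
  unfolding closed_span_of_def using closure_subset span_superset by fast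

lemma Q_sums:
  assumes "f \<in> closed_span_of (fdd_dual E)"
  shows "(\<lambda>n. Q n f) sums f"
proof -
  have lin: "linear (\<lambda>f. \<Sum>i<n. Q i f)" for n
    by (intro linear_compose_sum ballI Q_linear)
  have span: "(\<lambda>n. Q n f) sums f" if "f \<in> span (\<Union>n. fdd_dual E n)" for f
    using that
  proof (induction rule: span_induct_alt)
    case base
    then show ?case by (simp add: linear_0[OF Q_linear])
  next
    case (step c g h)
    then obtain m where "g \<in> fdd_dual E m" by blast
    then have "(\<lambda>n. Q n g) sums g"
      using sums_single[of m "\<lambda>_. g"] by (simp add: Q_dual)
    then show ?case
      using step(2) by (simp add: linear_add[OF Q_linear] linear_scale[OF Q_linear]
          sums_add sums_scaleR_right)
  qed
  show ?thesis
    unfolding sums_def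
  proof (rule metric_LIMSEQ_I)
    fix e :: real assume e: "0 < e"
    define b where "b = basis_constant"
    have b: "0 < b" by (simp add: b_def basis_constant_pos)
    obtain g where g: "g \<in> span (\<Union>n. fdd_dual E n)" "dist g f < e / (2 * (b + 1))"
      using assms e b unfolding closed_span_of_def closure_approachable
      by (metis divide_pos_pos mult_pos_pos zero_less_numeral add_pos_pos zero_less_one)
    obtain N where N: "\<And>n. n \<ge> N \<Longrightarrow> dist (\<Sum>i<n. Q i g) g < e / 2"
      using span[OF g(1)] e unfolding sums_def by (metis metric_LIMSEQ_D half_gt_zero)
    have "dist (\<Sum>i<n. Q i f) f < e" if "n \<ge> N" for n
    proof -
      have "norm (\<Sum>i<n. Q i (f - g)) \<le> b * norm (f - g)"
        unfolding b_def by (rule norm_sum_Q_le)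
      then have "norm ((\<Sum>i<n. Q i f) - (\<Sum>i<n. Q i g)) \<le> b * norm (f - g)"
        by (simp add: linear_diff[OF lin])
      moreover have "norm ((\<Sum>i<n. Q i f) - f) \<le> norm ((\<Sum>i<n. Q i f) - (\<Sum>i<n. Q i g))
          + norm ((\<Sum>i<n. Q i g) - g) + norm (f - g)"
        by (smt (verit) norm_minus_commute dist_norm dist_triangle)
      moreover have "(b + 1) * norm (f - g) < e / 2"
        using g(2) b e by (simp add: dist_norm norm_minus_commute field_simps)
      ultimately show ?thesis
        using N[OF that] by (simp add: dist_norm algebra_simps)
    qed
    then show "\<exists>N. \<forall>n\<ge>N. dist (\<Sum>i<n. Q i f) f < e" by blast
  qed
qed

lemma Q_unique:
  assumes h: "\<And>k. h k \<in> fdd_dual E k" "h sums f"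
  shows "h n = Q n f"
proof (rule blinfun_eqI)
  fix x
  have "(\<lambda>k. blinfun_apply (h k) (P n x)) sums blinfun_apply f (P n x)"
    by (rule bounded_linear.sums[OF blinfun.bounded_linear_left h(2)])
  moreover have "blinfun_apply (h k) (P n x) = (if k = n then blinfun_apply (h n) x else 0)" for k
  proof -
    have "blinfun_apply (h k) (P n x) = blinfun_apply (Q n (h k)) x" by simp
    then show ?thesis using Q_dual[OF h(1), of n k] by auto
  qed
  ultimately have "(\<lambda>k. if k = n then blinfun_apply (h n) x else 0) sums blinfun_apply f (P n x)"
    by simp
  then have "blinfun_apply (h n) x = blinfun_apply f (P n x)"
    using sums_unique2 sums_single[of n "\<lambda>_. blinfun_apply (h n) x"] by blast
  then show "blinfun_apply (h n) x = blinfun_apply (Q n f) x" by simp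
qed

lemma is_FDD_dual: "is_FDD (fdd_dual E) (closed_span_of (fdd_dual E))"
  unfolding is_FDD_def
proof (intro conjI allI ballI)
  show "banach_carrier (closed_span_of (fdd_dual E))"
    using subspace_closed_span unfolding banach_carrier_def complete_eq_closed
    by (simp add: closed_span_of_def)
  show "fdd_dual E n \<subseteq> closed_span_of (fdd_dual E)" "subspace (fdd_dual E n)" for n
    by (rule fdd_dual_subset, rule subspace_fdd_dual)
  show "\<exists>B. finite B \<and> span B = fdd_dual E n" for n
  proof -
    obtain B where B: "finite B" "span B = E n" using is_FDD_carrier(4)[OF is_FDD] by blast
    show ?thesis
    proof (rule finite_span_of_separated[OF B(1) subspace_fdd_dual])
      fix f assume f: "f \<in> fdd_dual E n" and 0: "\<forall>b\<in>B. blinfun_apply f b = 0"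
      have "blinfun_apply f x = 0" if "x \<in> span B" for x
        using that 0 by (induction rule: span_induct_alt)
          (auto simp: blinfun.add_right blinfun.scaleR_right)
      then have "blinfun_apply f (P n x) = 0" for x using B(2) P_in by blast
      then have "Q n f = 0" by (intro blinfun_eqI) simp
      then show "f = 0" using f by (simp add: fdd_dual_iff)
    qed
  qed
  show "\<exists>!h. (\<forall>n. h n \<in> fdd_dual E n) \<and> h sums f" if f: "f \<in> closed_span_of (fdd_dual E)" for f
  proof (rule ex1I[of _ "\<lambda>n. Q n f"])
    show "(\<forall>n. Q n f \<in> fdd_dual E n) \<and> (\<lambda>n. Q n f) sums f" using Q_in Q_sums[OF f] by blast
    show "h = (\<lambda>n. Q n f)" if "(\<forall>n. h n \<in> fdd_dual E n) \<and> h sums f" for h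
      using that by (intro ext Q_unique) simp_all
  qed
qed

end


section \<open>Transfer of the block indices\<close>

text \<open>The projections \<open>R n\<close> are defined on the whole type because in the case of a dual space a
  norming functional need not lie in the closed span of the dual decomposition; only its
  restriction to finitely many coordinates does.\<close>

locale fdd_pairing = norming_pairing B + fdd E
  for B :: "'z::real_normed_vector \<Rightarrow> 'x::banach \<Rightarrow> real" and E :: "nat \<Rightarrow> 'x set" +
  fixes G :: "nat \<Rightarrow> 'z set" and Z :: "'z set" and R :: "nat \<Rightarrow> 'z \<Rightarrow> 'z" and C :: real
  assumes G: "is_FDD G Z" and R_in: "R n z \<in> G n"
    and R_bound: "norm (\<Sum>i\<in>{a..c}. R i z) \<le> C * norm z" and C_pos: "0 < C"
    and adjoint: "B (R n z) x = B z (P n x)"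
begin

abbreviation interval :: "'x \<Rightarrow> nat set" where
  "interval x \<equiv> {Min (fdd_supp E x) .. Max (fdd_supp E x)}"

lemma supp_subset_interval: "finite (fdd_supp E x) \<Longrightarrow> fdd_supp E x \<subseteq> interval x"
  by auto

text \<open>Cutting a functional that norms \<open>x\<close> down to the support of \<open>x\<close> gives a functional that norms
  \<open>x\<close> up to a constant and vanishes at the vectors supported elsewhere.\<close>

lemma block_functional:
  assumes "finite (fdd_supp E x)" "x \<noteq> 0"
  shows "\<exists>z\<in>Z. norm z \<le> 1 \<and> norm x / (2 * C) \<le> B z x \<and> fdd_supp G z \<subseteq> interval x
    \<and> (\<forall>y. fdd_supp E y \<inter> interval x = {} \<longrightarrow> B z y = 0)"
proof -
  obtain w where w: "norm w \<le> 1" "norm x / 2 \<le> B w x" using norming by blast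
  define v where "v i = (1 / C) *\<^sub>R R i w" for i
  define z where "z = (\<Sum>i\<in>interval x. v i)"
  have z_eq: "z = (1 / C) *\<^sub>R (\<Sum>i\<in>interval x. R i w)"
    by (simp add: z_def v_def scaleR_sum_right)
  have B_z: "B z y = B w (\<Sum>i\<in>interval x. P i y) / C" for y
    by (simp add: z_eq scaleR_left sum_left sum_right adjoint)
  have v_in: "v i \<in> G i" for i
    unfolding v_def by (rule subspace_scale[OF is_FDD_carrier(3)[OF G] R_in])
  have "z \<in> Z"
    unfolding z_def using is_FDD_carrier(2)[OF G] v_in
    by (intro subspace_sum[OF is_FDD_carrier(1)[OF G]]) blast
  moreover have "norm z \<le> 1"
  proof -
    have "norm (\<Sum>i\<in>interval x. R i w) \<le> C * norm w" by (rule R_bound)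
    also have "\<dots> \<le> C" using w(1) C_pos by simp
    finally show ?thesis using C_pos by (simp add: z_eq field_simps)
  qed
  moreover have "norm x / (2 * C) \<le> B z x"
  proof -
    have "(norm x / 2) / C \<le> B w x / C"
      using w(2) C_pos by (intro divide_right_mono) auto
    also have "\<dots> = B z x"
      by (simp only: B_z sum_fdd_proj_eq[OF is_FDD UNIV_I _ supp_subset_interval[OF assms(1)]]
          finite_atLeastAtMost)
    finally show ?thesis by simp
  qed
  moreover have "fdd_supp G z \<subseteq> interval x"
    unfolding z_def by (rule fdd_supp_sum_subset[OF G v_in]) simp
  moreover have "B z y = 0" if "fdd_supp E y \<inter> interval x = {}" for y
  proof -
    have "(\<Sum>i\<in>interval x. P i y) = 0"
      using that by (intro sum.neutral) (auto simp: fdd_supp_def)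
    then show ?thesis using B_z[of y] by (simp add: zero_right)
  qed
  ultimately show ?thesis by blast
qed

definition functional :: "'x \<Rightarrow> 'z" where
  "functional x = (SOME z. z \<in> Z \<and> norm z \<le> 1 \<and> norm x / (2 * C) \<le> B z x
    \<and> fdd_supp G z \<subseteq> interval x \<and> (\<forall>y. fdd_supp E y \<inter> interval x = {} \<longrightarrow> B z y = 0))"

lemma functional:
  assumes "finite (fdd_supp E x)" "x \<noteq> 0"
  shows "functional x \<in> Z" "norm (functional x) \<le> 1" "norm x / (2 * C) \<le> B (functional x) x"
    "fdd_supp G (functional x) \<subseteq> interval x"
    "fdd_supp E y \<inter> interval x = {} \<Longrightarrow> B (functional x) y = 0"
proof -
  have "\<exists>z. z \<in> Z \<and> norm z \<le> 1 \<and> norm x / (2 * C) \<le> B z x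
    \<and> fdd_supp G z \<subseteq> interval x \<and> (\<forall>y. fdd_supp E y \<inter> interval x = {} \<longrightarrow> B z y = 0)"
    using block_functional[OF assms] by blast
  from someI_ex[OF this]
  show "functional x \<in> Z" "norm (functional x) \<le> 1" "norm x / (2 * C) \<le> B (functional x) x"
    "fdd_supp G (functional x) \<subseteq> interval x"
    "fdd_supp E y \<inter> interval x = {} \<Longrightarrow> B (functional x) y = 0"
    unfolding functional_def[symmetric] by blast+
qed

lemma functional_block:
  assumes x: "finite (fdd_supp E x)" "x \<noteq> 0"
  shows "functional x \<noteq> 0" "finite (fdd_supp G (functional x))" "fdd_supp G (functional x) \<noteq> {}"
    "Min (fdd_supp E x) \<le> Min (fdd_supp G (functional x))"
    "Max (fdd_supp G (functional x)) \<le> Max (fdd_supp E x)"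
proof -
  have "0 < norm x / (2 * C)" using x(2) C_pos by simp
  then show nz: "functional x \<noteq> 0" using functional(3)[OF x] by (auto simp: zero_left)
  show fin: "finite (fdd_supp G (functional x))"
    using finite_subset[OF functional(4)[OF x]] by simp
  show ne: "fdd_supp G (functional x) \<noteq> {}"
    by (rule fdd_supp_nonempty[OF G functional(1)[OF x] nz])
  have "Min (fdd_supp G (functional x)) \<in> interval x" "Max (fdd_supp G (functional x)) \<in> interval x"
    using functional(4)[OF x] Min_in[OF fin ne] Max_in[OF fin ne] by blast+
  then show "Min (fdd_supp E x) \<le> Min (fdd_supp G (functional x))"
    "Max (fdd_supp G (functional x)) \<le> Max (fdd_supp E x)" by simp_all
qed

text \<open>For blocks the functionals depend on one vector only and are exactly biorthogonal, so the
  transfer is a map between the trees that acts term by term.\<close>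

lemma map_functional_block_tree:
  assumes K: "0 < K" and xs: "xs \<in> lp_block_tree \<infinity> E UNIV K"
  shows "map functional xs \<in> lp_block_tree 1 G Z (4 * C * K)"
proof -
  have tree: "xs \<in> lp_tree \<infinity> UNIV K"
    and block: "\<And>x. x \<in> set xs \<Longrightarrow> finite (fdd_supp E x) \<and> x \<noteq> 0"
    and succ: "successively (\<lambda>x y. Max (fdd_supp E x) < Min (fdd_supp E y)) xs"
    using xs by (auto simp: lp_block_tree_def block_sequences_def)
  have Min_le_Max: "Min (fdd_supp E x) \<le> Max (fdd_supp E x)" if "x \<in> set xs" for x
    using block[OF that] fdd_supp_nonempty[OF is_FDD UNIV_I, of x] by (intro Min_le Max_in) auto
  have sorted: "sorted_wrt (\<lambda>x y. Max (fdd_supp E x) < Min (fdd_supp E y)) xs"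
  proof (rule successively_iff_sorted_wrt_strong[THEN iffD1, OF _ succ])
    fix x y z assume "y \<in> set xs" "Max (fdd_supp E x) < Min (fdd_supp E y)"
      "Max (fdd_supp E y) < Min (fdd_supp E z)"
    then show "Max (fdd_supp E x) < Min (fdd_supp E z)" using Min_le_Max[of y] by simp
  qed
  have disjoint: "fdd_supp E (xs ! j) \<inter> interval (xs ! i) = {}"
    if ij: "i < length xs" "j < length xs" "j \<noteq> i" for i j
  proof -
    have sub: "fdd_supp E (xs ! j) \<subseteq> interval (xs ! j)"
      using block[OF nth_mem[OF ij(2)]] supp_subset_interval by blast
    consider "i < j" | "j < i" using ij(3) by linarith
    then show ?thesis
    proof cases
      case 1
      then have "Max (fdd_supp E (xs ! i)) < Min (fdd_supp E (xs ! j))"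
        using sorted_wrt_nth_less[OF sorted 1 ij(2)] by simp
      then show ?thesis using sub by fastforce
    next
      case 2
      then have "Max (fdd_supp E (xs ! j)) < Min (fdd_supp E (xs ! i))"
        using sorted_wrt_nth_less[OF sorted 2 ij(1)] by simp
      then show ?thesis using sub by fastforce
    qed
  qed
  define r where "r = 1 / (2 * C * K)"
  have r: "0 < r" using C_pos K by (simp add: r_def)
  have "almost_biorthogonal r xs (map functional xs)"
    unfolding almost_biorthogonal_def
  proof (intro conjI allI impI)
    fix i assume i: "i < length xs"
    note b = block[OF nth_mem[OF i], THEN conjunct1] block[OF nth_mem[OF i], THEN conjunct2]
    show "norm (map functional xs ! i) \<le> 1"
      using functional(2)[OF b] i by simp
    have "r \<le> norm (xs ! i) / (2 * C)"
      using lp_tree_infinity_norm_ge[OF tree nth_mem[OF i]] C_pos K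
      by (simp add: r_def field_simps)
    then show "r \<le> B (map functional xs ! i) (xs ! i)"
      using functional(3)[OF b] i by simp
    fix j assume "j < length xs" "j \<noteq> i"
    then have "B (map functional xs ! i) (xs ! j) = 0"
      using functional(5)[OF b disjoint[OF i]] i by simp
    then show "\<bar>B (map functional xs ! i) (xs ! j)\<bar> \<le> r / 2 ^ (j + 2)"
      using r by simp
  qed simp
  moreover have "set (map functional xs) \<subseteq> Z"
    using block functional(1) by auto
  ultimately have "map functional xs \<in> lp_tree 1 Z (2 / r)"
    by (intro almost_biorthogonal_imp_l1[OF r tree])
  moreover have "2 / r = 4 * C * K" by (simp add: r_def)
  moreover have "map functional xs \<in> block_sequences G Z"
  proof -
    have "successively (\<lambda>x y. Max (fdd_supp G x) < Min (fdd_supp G y)) (map functional xs)"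
      unfolding successively_map
    proof (rule successively_mono[OF succ])
      fix x y assume xy: "x \<in> set xs" "y \<in> set xs" "Max (fdd_supp E x) < Min (fdd_supp E y)"
      show "Max (fdd_supp G (functional x)) < Min (fdd_supp G (functional y))"
        using functional_block(5)[of x] functional_block(4)[of y] block[OF xy(1)] block[OF xy(2)] xy(3)
        by linarith
    qed
    moreover have "\<forall>z\<in>set (map functional xs). z \<in> Z \<and> z \<noteq> 0 \<and> finite (fdd_supp G z)"
      using block functional(1) functional_block(1,2) by auto
    ultimately show ?thesis by (auto simp: block_sequences_def)
  qed
  ultimately show ?thesis by (simp add: lp_block_tree_def)
qed

lemma index_I_block_transfer:
  assumes "0 < K" "index_I_block \<infinity> E UNIV K > Fin \<alpha>"
  shows "index_I_block 1 G Z (4 * C * K) > Fin \<alpha>"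
  unfolding index_I_block_def
proof (rule deriv_index_image[where h = "map functional", OF tree_deriv_subset])
  show "map functional ` lp_block_tree \<infinity> E UNIV K \<subseteq> lp_block_tree 1 G Z (4 * C * K)"
    using map_functional_block_tree[OF assms(1)] by blast
  show "map functional ` tree_deriv U \<subseteq> tree_deriv U'" if "map functional ` U \<subseteq> U'" for U U'
  proof
    fix zs assume "zs \<in> map functional ` tree_deriv U"
    then obtain t s where t: "zs = map functional t" "t \<in> U" "s \<in> U" "strict_prefix t s"
      by (auto simp: tree_deriv_iff)
    then have "strict_prefix (map functional t) (map functional s)"
      by (elim strict_prefixE') (simp add: strict_prefix_def)
    then show "zs \<in> tree_deriv U'" using t that by (auto simp: tree_deriv_iff)
  qed
  show "deriv_index tree_deriv (lp_block_tree \<infinity> E UNIV K) > Fin \<alpha>"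
    using assms(2) by (simp add: index_I_block_def)
qed

lemma index_I_asymp_transfer:
  assumes "0 < K" "index_I_asymp \<infinity> E UNIV K > Fin \<alpha>"
  shows "index_I_asymp 1 G Z (4 * C * K) > Fin \<alpha>"
  unfolding index_I_asymp_def
proof (rule deriv_index_image[where h = "map functional", OF fdd_deriv_subset])
  show "map functional ` lp_block_tree \<infinity> E UNIV K \<subseteq> lp_block_tree 1 G Z (4 * C * K)"
    using map_functional_block_tree[OF assms(1)] by blast
  show "map functional ` fdd_deriv E U \<subseteq> fdd_deriv G U'"
    if U: "U \<subseteq> lp_block_tree \<infinity> E UNIV K" and image: "map functional ` U \<subseteq> U'" for U U'
  proof
    fix zs assume "zs \<in> map functional ` fdd_deriv E U"
    then obtain t y where t: "zs = map functional t" "t \<in> U"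
      and y: "\<And>i. i \<le> Min (fdd_supp E (y i))" "\<And>i. t @ [y i] \<in> U"
      by (auto simp: fdd_deriv_def)
    have "i \<le> Min (fdd_supp G (functional (y i)))" for i
    proof -
      have "finite (fdd_supp E (y i))" "y i \<noteq> 0"
        using y(2)[of i] U by (auto simp: lp_block_tree_def block_sequences_def)
      then show ?thesis using functional_block(4) y(1)[of i] le_trans by blast
    qed
    moreover have "zs @ [functional (y i)] \<in> U'" for i
    proof -
      have "map functional (t @ [y i]) \<in> U'" using y(2) image by blast
      then show ?thesis by (simp add: t(1))
    qed
    ultimately have "\<forall>i. i \<le> Min (fdd_supp G (functional (y i))) \<and> zs @ [functional (y i)] \<in> U'"
      by blast
    moreover have "zs \<in> U'" using t image by blast
    ultimately show "zs \<in> fdd_deriv G U'"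
      unfolding fdd_deriv_def by (intro CollectI conjI exI[of _ "\<lambda>i. functional (y i)"])
  qed
  show "deriv_index (fdd_deriv E) (lp_block_tree \<infinity> E UNIV K) > Fin \<alpha>"
    using assms(2) by (simp add: index_I_asymp_def)
qed

text \<open>The classes ask for an \<open>\<ell>\<^sub>1\<close> constant above \<open>1\<close>, which \<open>4 * C * K\<close> need not be.\<close>

lemma fdd_pairing_enlarge: "fdd_pairing B E G Z R (max C 1)"
proof unfold_locales
  show "norm (\<Sum>i\<in>{a..c}. R i z) \<le> max C 1 * norm z" for a c z
    by (rule order_trans[OF R_bound mult_right_mono]) auto
qed (use G R_in adjoint in auto)

lemma class_P2_transfer:
  assumes "class_P2 \<xi> \<infinity> E UNIV"
  shows "class_P2 \<xi> 1 G Z"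
proof -
  interpret max: fdd_pairing B E G Z R "max C 1" by (rule fdd_pairing_enlarge)
  obtain K where K: "1 < K" "index_I_block \<infinity> E UNIV K > Fin (opow omega \<xi>)"
    using assms by (auto simp: class_P2_def)
  have "1 * 1 < (4 * max C 1) * K" using K(1) by (intro mult_le_less_imp_less) auto
  moreover have "index_I_block 1 G Z (4 * max C 1 * K) > Fin (opow omega \<xi>)"
    using K by (intro max.index_I_block_transfer) auto
  ultimately show ?thesis using G unfolding class_P2_def by (metis mult_1)
qed

lemma class_P3_transfer:
  assumes "class_P3 \<xi> \<infinity> E UNIV"
  shows "class_P3 \<xi> 1 G Z"
proof -
  interpret max: fdd_pairing B E G Z R "max C 1" by (rule fdd_pairing_enlarge)
  obtain K where K: "1 < K" "index_I_asymp \<infinity> E UNIV K > Fin (opow omega \<xi>)"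
    using assms by (auto simp: class_P3_def)
  have "1 * 1 < (4 * max C 1) * K" using K(1) by (intro mult_le_less_imp_less) auto
  moreover have "index_I_asymp 1 G Z (4 * max C 1 * K) > Fin (opow omega \<xi>)"
    using K by (intro max.index_I_asymp_transfer) auto
  ultimately show ?thesis using G unfolding class_P3_def by (metis mult_1)
qed

end

text \<open>For the dual, \<open>R n\<close> is the adjoint of \<open>P n\<close> on the whole dual space.\<close>

lemma fdd_pairing_dual:
  fixes E :: "nat \<Rightarrow> 'x::banach set"
  assumes "is_FDD E UNIV"
  shows "\<exists>R C. fdd_pairing blinfun_apply E (fdd_dual E) (closed_span_of (fdd_dual E)) R C"
proof -
  interpret fdd E by (rule fdd.intro[OF assms])
  have "fdd_pairing blinfun_apply E (fdd_dual E) (closed_span_of (fdd_dual E)) Q (2 * basis_constant)"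
    by (intro fdd_pairing.intro fdd_pairing_axioms.intro norming_pairing_dual fdd_axioms
        is_FDD_dual Q_in norm_interval_sum_Q_le Q_apply)
      (use basis_constant_pos in simp)
  then show ?thesis by blast
qed

text \<open>For a predual, \<open>R n\<close> is the projection of \<open>F\<close>. Adjointness says that the isometry \<open>J\<close> carries
  the expansion of \<open>x\<close> along \<open>E\<close> to that of \<open>J x\<close> along \<open>F\<^sup>*\<close>, which follows from the uniqueness
  of the latter.\<close>

lemma fdd_pairing_predual:
  fixes E :: "nat \<Rightarrow> 'x::banach set" and F :: "nat \<Rightarrow> 'y::banach set"
  assumes E: "is_FDD E UNIV" and F: "is_FDD F UNIV" and J: "fdd_predual_via J E F"
  shows "\<exists>R C. fdd_pairing (\<lambda>y x. blinfun_apply (J x) y) E F UNIV R C"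
proof -
  interpret E: fdd E by (rule fdd.intro[OF E])
  interpret F: fdd F by (rule fdd.intro[OF F])
  have lin: "linear J" and iso: "\<And>x. norm (J x) = norm x"
    and JE: "\<And>n. J ` E n = fdd_dual F n"
    using J by (auto simp: fdd_predual_via_def)
  have bl: "bounded_linear J"
    using iso by (intro bounded_linear_intro[where K = 1])
      (simp_all add: linear_add[OF lin] linear_scale[OF lin])
  have "J (E.P n x) = F.Q n (J x)" for n x
  proof (rule F.Q_unique[where h = "\<lambda>k. J (E.P k x)"])
    show "J (E.P k x) \<in> fdd_dual F k" for k using E.P_in JE by blast
    show "(\<lambda>k. J (E.P k x)) sums J x" by (rule bounded_linear.sums[OF bl E.P_sums])
  qed
  then have adj: "blinfun_apply (J x) (F.P n y) = blinfun_apply (J (E.P n x)) y" for n x y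
    by simp
  have "fdd_pairing (\<lambda>y x. blinfun_apply (J x) y) E F UNIV F.P (2 * F.basis_constant)"
    by (intro fdd_pairing.intro fdd_pairing_axioms.intro norming_pairing_predual lin iso E.fdd_axioms
        F F.P_in F.norm_interval_proj_le adj)
      (use F.basis_constant_pos in simp)
  then show ?thesis by blast
qed

lemma banach_carrier_UNIV: "banach_carrier (UNIV :: 'a::banach set)"
  by (simp add: banach_carrier_def complete_UNIV)

theorem theorem5p2:
  fixes \<xi> :: "'o ordinal"
  shows
    "(class_P1 \<xi> \<infinity> (UNIV :: 'x::banach set) \<longrightarrow>
        class_P1 \<xi> 1 (UNIV :: ('x \<Rightarrow>\<^sub>L real) set)
        \<and> (\<forall>J :: 'x \<Rightarrow> ('y::banach \<Rightarrow>\<^sub>L real). predual_via J \<longrightarrow> class_P1 \<xi> 1 (UNIV :: 'y set)))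
   \<and> (\<forall>E :: nat \<Rightarrow> 'x set. is_FDD E UNIV \<longrightarrow>
        (class_P2 \<xi> \<infinity> E UNIV \<longrightarrow>
           class_P2 \<xi> 1 (fdd_dual E) (closed_span_of (fdd_dual E))
           \<and> (\<forall>(F :: nat \<Rightarrow> 'y set) (J :: 'x \<Rightarrow> ('y \<Rightarrow>\<^sub>L real)).
                is_FDD F UNIV \<and> fdd_predual_via J E F \<longrightarrow> class_P2 \<xi> 1 F UNIV))
      \<and> (class_P3 \<xi> \<infinity> E UNIV \<longrightarrow>
           class_P3 \<xi> 1 (fdd_dual E) (closed_span_of (fdd_dual E))
           \<and> (\<forall>(F :: nat \<Rightarrow> 'y set) (J :: 'x \<Rightarrow> ('y \<Rightarrow>\<^sub>L real)).
                is_FDD F UNIV \<and> fdd_predual_via J E F \<longrightarrow> class_P3 \<xi> 1 F UNIV)))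
   \<and> (\<forall>\<S> :: 'o ordinal \<Rightarrow> nat set set. schreier_system \<S> \<longrightarrow>
        class_P4 \<S> \<xi> \<infinity> (UNIV :: 'x set) \<longrightarrow>
        class_P4 \<S> \<xi> 1 (UNIV :: ('x \<Rightarrow>\<^sub>L real) set)
        \<and> (\<forall>J :: 'x \<Rightarrow> ('y \<Rightarrow>\<^sub>L real). predual_via J \<longrightarrow> class_P4 \<S> \<xi> 1 (UNIV :: 'y set)))"
proof (intro conjI allI impI)
  have predual: "norming_pairing (\<lambda>y x. blinfun_apply (J x) y)"
    if "predual_via J" for J :: "'x \<Rightarrow> ('y \<Rightarrow>\<^sub>L real)"
    using that by (intro norming_pairing_predual) (simp_all add: predual_via_def)
  {
    assume P1: "class_P1 \<xi> \<infinity> (UNIV :: 'x set)"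
    show "class_P1 \<xi> 1 (UNIV :: ('x \<Rightarrow>\<^sub>L real) set)"
      by (rule norming_pairing.class_P1_transfer[OF norming_pairing_dual P1 banach_carrier_UNIV])
    show "class_P1 \<xi> 1 (UNIV :: 'y set)" if "predual_via J" for J :: "'x \<Rightarrow> ('y \<Rightarrow>\<^sub>L real)"
      by (rule norming_pairing.class_P1_transfer[OF predual[OF that] P1 banach_carrier_UNIV])
  }
  {
    fix \<S> :: "'o ordinal \<Rightarrow> nat set set"
    assume S: "schreier_system \<S>" and P4: "class_P4 \<S> \<xi> \<infinity> (UNIV :: 'x set)"
    show "class_P4 \<S> \<xi> 1 (UNIV :: ('x \<Rightarrow>\<^sub>L real) set)"
      by (rule norming_pairing.class_P4_transfer[OF norming_pairing_dual P4 S banach_carrier_UNIV])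
    show "class_P4 \<S> \<xi> 1 (UNIV :: 'y set)" if "predual_via J" for J :: "'x \<Rightarrow> ('y \<Rightarrow>\<^sub>L real)"
      by (rule norming_pairing.class_P4_transfer[OF predual[OF that] P4 S banach_carrier_UNIV])
  }
  fix E :: "nat \<Rightarrow> 'x set" assume E: "is_FDD E UNIV"
  obtain R C where dual: "fdd_pairing blinfun_apply E (fdd_dual E) (closed_span_of (fdd_dual E)) R C"
    using fdd_pairing_dual[OF E] by blast
  show "class_P2 \<xi> 1 (fdd_dual E) (closed_span_of (fdd_dual E))" if "class_P2 \<xi> \<infinity> E UNIV"
    by (rule fdd_pairing.class_P2_transfer[OF dual that])
  show "class_P3 \<xi> 1 (fdd_dual E) (closed_span_of (fdd_dual E))" if "class_P3 \<xi> \<infinity> E UNIV"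
    by (rule fdd_pairing.class_P3_transfer[OF dual that])
  fix F :: "nat \<Rightarrow> 'y set" and J :: "'x \<Rightarrow> ('y \<Rightarrow>\<^sub>L real)"
  assume "is_FDD F UNIV \<and> fdd_predual_via J E F"
  then obtain R C where predual: "fdd_pairing (\<lambda>y x. blinfun_apply (J x) y) E F UNIV R C"
    using fdd_pairing_predual[OF E] by blast
  show "class_P2 \<xi> 1 F UNIV" if "class_P2 \<xi> \<infinity> E UNIV"
    by (rule fdd_pairing.class_P2_transfer[OF predual that])
  show "class_P3 \<xi> 1 F UNIV" if "class_P3 \<xi> \<infinity> E UNIV"
    by (rule fdd_pairing.class_P3_transfer[OF predual that])
qed

end
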